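(* Let $L>0$, $T>0$, let $\omega=(l_1,l_2)$ with $-L<l_1<l_2<L$, and let $\psi\in C^3([-L,L])$ be a weight function associated with $\omega$ (satisfying the conditions (i)--(v) listed in the context). Then there exist positive constants $s_0=s_0(T,\omega)$ and $C=C(T,\omega)$ such that, for all $s\ge s_0$ and any $u_0\in L^2(-L,L)$, the solution $u=S_L(\cdot)u_0$ of $$\begin{cases} u_t-u_{xx}+u_{xxx}=0 & \text{in } (-L,L)\times(0,T),\\ u(-L,t)=u(L,t)=u_x(L,t)=0 & \text{in } (0,T),\\ u(x,0)=u_0(x) & \text{in } (-L,L),\end{cases}$$ fulfills $$\begin{aligned}&\int_{0}^{T}\!\!\int_{-L}^{L}\left\{\frac{s^5\psi^5}{t^5(T-t)^5}|u|^2+\frac{s^3\psi^3}{t^3(T-t)^3}|u_x|^2+\frac{s\psi}{t(T-t)}|u_{xx}|^2\right\}e^{-\frac{2s\psi(x)}{t(T-t)}}\,dx\,dt\\ &\quad+\int_0^T\left\{\frac{s^3\psi(L)^3}{t^3(T-t)^3}|u_x(-L,t)|^2+\frac{s\psi(L)}{t(T-t)}|u_{xx}(-L,t)|^2\right\}e^{-\frac{2s\psi(L)}{t(T-t)}}\,dt\\ &\le C\int_0^T\!\!\int_{\omega}\left\{\frac{s^5\psi^5}{t^5(T-t)^5}|u|^2+\frac{s^3\psi^3}{t^3(T-t)^3}|u_x|^2+\frac{s\psi}{t(T-t)}|u_{xx}|^2\right\}e^{-\frac{2s\psi(x)}{t(T-t)}}\,dx\,dt.\end{aligned}$$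
   Context: $\{S_L(t)\}_{t\ge0}$ is the $C_0$ semigroup of contractions on $L^2(-L,L)$ generated by $Au=u_{xx}-u_{xxx}$ with domain $D(A)=\{u\in H^3(-L,L): u(-L)=u(L)=u_x(L)=0\}$; the solution of the problem is $u(\cdot,t)=S_L(t)u_0$. For $\omega=(l_1,l_2)$, a weight function $\psi\in C^3([-L,L])$ is one that satisfies: (i) $\psi>0$ in $[-L,L]$; (ii) $|\psi'|>0$, $\psi''<0$ and $\psi'\psi'''<0$ in $[-L,L]\setminus\omega$; (iii) $\psi'(-L)<0$ and $\psi'(L)>0$; (iv) for some $l_3\in(l_1,l_2)$, $\min_{x\in[l_1,l_2]}\psi(x)=\psi(l_3)<\max_{x\in[l_1,l_2]}\psi(x)=\psi(l_1)=\psi(l_2)$ and $\max_{x\in[-L,L]}\psi(x)=\psi(-L)=\psi(L)$; (v) $\psi(-L)\le\frac43\psi(l_3)$. The function $\psi$ is fixed once $L$ and $\omega$ are fixed (dependence of constants on $L$ and $\psi$ is not displayed). *)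

theory Defs
  imports "HOL-Analysis.Analysis"
begin

text \<open>
  Elements of \<open>L\<^sup>2(\<Omega>)\<close>, for an open \<open>\<Omega>\<close> in the real line, are represented by real-valued
  square-integrable functions; two representatives are identified when they agree almost everywhere
  in \<open>\<Omega>\<close>. Values outside \<open>\<Omega>\<close> are irrelevant.
\<close>

definition L2_on :: "real set \<Rightarrow> (real \<Rightarrow> real) set" where
  "L2_on \<Omega> = {f. f \<in> borel_measurable (lebesgue_on \<Omega>) \<and> integrable (lebesgue_on \<Omega>) (\<lambda>x. (f x)\<^sup>2)}"

definition L2_norm_on :: "real set \<Rightarrow> (real \<Rightarrow> real) \<Rightarrow> real" where
  "L2_norm_on \<Omega> f = sqrt (integral\<^sup>L (lebesgue_on \<Omega>) (\<lambda>x. (f x)\<^sup>2))"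

definition ae_eq_on :: "real set \<Rightarrow> (real \<Rightarrow> real) \<Rightarrow> (real \<Rightarrow> real) \<Rightarrow> bool" where
  "ae_eq_on \<Omega> f g \<longleftrightarrow> (AE x in lebesgue_on \<Omega>. f x = g x)"

definition test_function_on :: "real set \<Rightarrow> (real \<Rightarrow> real) \<Rightarrow> bool" where
  "test_function_on \<Omega> \<phi> \<longleftrightarrow>
     (\<forall>n x. (deriv ^^ n) \<phi> field_differentiable at x) \<and>
     (\<exists>K. compact K \<and> K \<subseteq> \<Omega> \<and> (\<forall>x. x \<notin> K \<longrightarrow> \<phi> x = 0))"

definition has_weak_deriv_on :: "real set \<Rightarrow> nat \<Rightarrow> (real \<Rightarrow> real) \<Rightarrow> (real \<Rightarrow> real) \<Rightarrow> bool" where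
  "has_weak_deriv_on \<Omega> k f g \<longleftrightarrow> f \<in> L2_on \<Omega> \<and> g \<in> L2_on \<Omega> \<and>
     (\<forall>\<phi>. test_function_on \<Omega> \<phi> \<longrightarrow>
        integral\<^sup>L (lebesgue_on \<Omega>) (\<lambda>x. f x * (deriv ^^ k) \<phi> x) =
        (-1) ^ k * integral\<^sup>L (lebesgue_on \<Omega>) (\<lambda>x. g x * \<phi> x))"

definition sobolev_H :: "nat \<Rightarrow> real set \<Rightarrow> (real \<Rightarrow> real) set" where
  "sobolev_H k \<Omega> = {f \<in> L2_on \<Omega>. \<forall>j\<le>k. \<exists>g. has_weak_deriv_on \<Omega> j f g}"

text \<open>A representative of the \<open>k\<close>-th weak derivative, which is unique almost everywhere.\<close>

definition weak_deriv_on :: "real set \<Rightarrow> nat \<Rightarrow> (real \<Rightarrow> real) \<Rightarrow> (real \<Rightarrow> real)" where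
  "weak_deriv_on \<Omega> k f = (SOME g. has_weak_deriv_on \<Omega> k f g)"

text \<open>
  The value at a point of the closure of the representative that is continuous up to the boundary.
  When \<open>\<Omega>\<close> is a bounded open interval this representative exists for \<open>f\<close> of class \<open>H\<^sup>1\<close> and is
  unique on the closed interval.
\<close>

definition trace_on :: "real set \<Rightarrow> (real \<Rightarrow> real) \<Rightarrow> real \<Rightarrow> real" where
  "trace_on \<Omega> f p =
     (THE y. \<exists>g. continuous_on (closure \<Omega>) g \<and> ae_eq_on \<Omega> f g \<and> y = g p)"

text \<open>
  A semigroup acts on representatives, and its laws hold up to almost everywhere equality.
  Linearity together with contractivity makes it well defined on classes.
\<close>

definition C0_contraction_semigroup ::
    "real set \<Rightarrow> (real \<Rightarrow> (real \<Rightarrow> real) \<Rightarrow> (real \<Rightarrow> real)) \<Rightarrow> bool" where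
  "C0_contraction_semigroup \<Omega> S \<longleftrightarrow>
     (\<forall>t\<ge>0. \<forall>f\<in>L2_on \<Omega>. S t f \<in> L2_on \<Omega>) \<and>
     (\<forall>t\<ge>0. \<forall>f\<in>L2_on \<Omega>. \<forall>g\<in>L2_on \<Omega>. \<forall>a b.
        ae_eq_on \<Omega> (S t (\<lambda>x. a * f x + b * g x)) (\<lambda>x. a * S t f x + b * S t g x)) \<and>
     (\<forall>f\<in>L2_on \<Omega>. ae_eq_on \<Omega> (S 0 f) f) \<and>
     (\<forall>r\<ge>0. \<forall>t\<ge>0. \<forall>f\<in>L2_on \<Omega>. ae_eq_on \<Omega> (S (r + t) f) (S r (S t f))) \<and>
     (\<forall>f\<in>L2_on \<Omega>. ((\<lambda>t. L2_norm_on \<Omega> (\<lambda>x. S t f x - f x)) \<longlongrightarrow> 0) (at_right 0)) \<and>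
     (\<forall>t\<ge>0. \<forall>f\<in>L2_on \<Omega>. L2_norm_on \<Omega> (S t f) \<le> L2_norm_on \<Omega> f)"

text \<open>Unbounded operators are given by their graphs.\<close>

definition generator_graph ::
    "real set \<Rightarrow> (real \<Rightarrow> (real \<Rightarrow> real) \<Rightarrow> (real \<Rightarrow> real)) \<Rightarrow> ((real \<Rightarrow> real) \<times> (real \<Rightarrow> real)) set"
  where
  "generator_graph \<Omega> S = {(f, g). f \<in> L2_on \<Omega> \<and> g \<in> L2_on \<Omega> \<and>
     ((\<lambda>h. L2_norm_on \<Omega> (\<lambda>x. (S h f x - f x) / h - g x)) \<longlongrightarrow> 0) (at_right 0)}"

definition A_domain :: "real \<Rightarrow> (real \<Rightarrow> real) set" where
  "A_domain L = {f \<in> sobolev_H 3 {-L<..<L}.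
     trace_on {-L<..<L} f (-L) = 0 \<and> trace_on {-L<..<L} f L = 0 \<and>
     trace_on {-L<..<L} (weak_deriv_on {-L<..<L} 1 f) L = 0}"

definition A_graph :: "real \<Rightarrow> ((real \<Rightarrow> real) \<times> (real \<Rightarrow> real)) set" where
  "A_graph L = {(f, g). f \<in> A_domain L \<and> g \<in> L2_on {-L<..<L} \<and>
     ae_eq_on {-L<..<L} g
       (\<lambda>x. weak_deriv_on {-L<..<L} 2 f x - weak_deriv_on {-L<..<L} 3 f x)}"

text \<open>
  \<open>S\<close> is the semigroup generated by \<open>A\<close>; a semigroup is determined by its generator, up to the
  choice of representatives.
\<close>

definition is_S_L :: "real \<Rightarrow> (real \<Rightarrow> (real \<Rightarrow> real) \<Rightarrow> (real \<Rightarrow> real)) \<Rightarrow> bool" where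
  "is_S_L L S \<longleftrightarrow> C0_contraction_semigroup {-L<..<L} S \<and> generator_graph {-L<..<L} S = A_graph L"

text \<open>Derivatives are one-sided at the end points of the closed interval.\<close>

definition weight_function :: "real \<Rightarrow> real \<Rightarrow> real \<Rightarrow> (real \<Rightarrow> real) \<Rightarrow> bool" where
  "weight_function L l\<^sub>1 l\<^sub>2 \<psi> \<longleftrightarrow> (\<exists>\<psi>' \<psi>'' \<psi>'''.
     (\<forall>x\<in>{-L..L}. (\<psi> has_real_derivative \<psi>' x) (at x within {-L..L})) \<and>
     (\<forall>x\<in>{-L..L}. (\<psi>' has_real_derivative \<psi>'' x) (at x within {-L..L})) \<and>
     (\<forall>x\<in>{-L..L}. (\<psi>'' has_real_derivative \<psi>''' x) (at x within {-L..L})) \<and>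
     continuous_on {-L..L} \<psi>''' \<and>
     (\<forall>x\<in>{-L..L}. \<psi> x > 0) \<and>
     (\<forall>x\<in>{-L..L} - {l\<^sub>1<..<l\<^sub>2}. \<bar>\<psi>' x\<bar> > 0 \<and> \<psi>'' x < 0 \<and> \<psi>' x * \<psi>''' x < 0) \<and>
     \<psi>' (-L) < 0 \<and> \<psi>' L > 0 \<and>
     (\<exists>l\<^sub>3\<in>{l\<^sub>1<..<l\<^sub>2}.
        (\<forall>x\<in>{l\<^sub>1..l\<^sub>2}. \<psi> l\<^sub>3 \<le> \<psi> x) \<and>
        \<psi> l\<^sub>3 < \<psi> l\<^sub>1 \<and>
        (\<forall>x\<in>{l\<^sub>1..l\<^sub>2}. \<psi> x \<le> \<psi> l\<^sub>1) \<and> \<psi> l\<^sub>1 = \<psi> l\<^sub>2 \<and>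
        (\<forall>x\<in>{-L..L}. \<psi> x \<le> \<psi> (-L)) \<and> \<psi> (-L) = \<psi> L \<and>
        \<psi> (-L) \<le> 4 / 3 * \<psi> l\<^sub>3))"

end

theory Submission
  imports Defs
begin

text \<open>
  For \<open>t > 0\<close> the solution is classical. With \<open>V = u\<^sub>x\<^sub>x - u\<^sub>x\<^sub>x\<^sub>x\<close>, the functional
  \<open>t\<^sup>4 \<parallel>V\<parallel>\<^sup>2 + K \<parallel>u\<parallel>\<^sup>2\<close> decreases for large \<open>K\<close>, because the two dissipations \<open>\<parallel>V\<^sub>x\<parallel>\<^sup>2\<close> and
  \<open>\<parallel>u\<^sub>x\<parallel>\<^sup>2\<close> control \<open>\<parallel>V\<parallel>\<^sup>2\<close> by interpolation. Hence \<open>t\<^sup>2 \<parallel>A S(t) u\<^sub>0\<parallel> \<le> C \<parallel>u\<^sub>0\<parallel>\<close>, first for test functions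
  and then by density, since the graph norm of \<open>A\<close> controls the \<open>C\<^sup>2\<close> norm.

  With \<open>k = s / (t (T - t))\<close>, \<open>p = k \<psi>'\<close> and \<open>w = exp (- k \<psi>) u\<close> the equation becomes
  \<open>M\<^sub>1 + M\<^sub>2 = R\<close> with \<open>M\<^sub>1 = w\<^sub>t + w\<^sub>x\<^sub>x\<^sub>x + 3 p\<^sup>2 w\<^sub>x\<close>, \<open>M\<^sub>2 = p\<^sup>3 w + 3 (p w\<^sub>x)\<^sub>x\<close> and \<open>R\<close> of lower order in \<open>k\<close>;
  the term \<open>w\<^sub>x\<^sub>x\<close> coming from the viscosity is itself of lower order. Since
  \<open>M\<^sub>1 M\<^sub>2 \<le> R\<^sup>2 / 2\<close>, integrating \<open>M\<^sub>1 M\<^sub>2\<close> by parts gives the time derivative of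
  \<open>\<integral> (p\<^sup>3 w\<^sup>2 - 3 p w\<^sub>x\<^sup>2) / 2\<close>, positive boundary terms at the end points (where \<open>\<psi>'\<close> points
  outwards), and the quadratic form with density \<open>- (15/2) p\<^sup>4 p\<^sub>x w\<^sup>2 - (9/2) p\<^sub>x w\<^sub>x\<^sub>x\<^sup>2\<close>, which is positive
  outside \<open>\<omega>\<close> because \<open>\<psi>'' < 0\<close> there. The contributions of \<open>w\<^sub>x\<^sup>2\<close> cancel, and \<open>w\<^sub>x\<close> is recovered from
  \<open>\<integral> w\<^sub>x\<^sup>2 = - \<integral> w w\<^sub>x\<^sub>x\<close>. The energy vanishes at both ends of \<open>(0, T)\<close> by the smoothing estimate.
\<close>

section \<open>Smooth functions and test functions\<close>

text \<open>The obstacle is regularity. The semigroup is known only through its generator, and its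
  laws hold only almost everywhere, whereas the Carleman computation needs three derivatives in
  \<open>x\<close>, time derivatives of \<open>u\<close> and \<open>u_x\<close>, and traces at
  \<open>-L\<close>. All of this rests on one fact: on the domain of \<open>A\<close>, the L2 norm
  of \<open>A f\<close> controls \<open>f\<close> in C^2. Applied to differences and difference
  quotients along an orbit, it upgrades L2 convergence in time to convergence uniform in
  \<open>x\<close>; third derivatives are then read off from the equation. This asks for orbits in
  the domain of high powers of \<open>A\<close>, which is clear for test functions and follows for
  all data at positive times by smoothing. Smoothing also bounds \<open>u\<close> and
  \<open>u_x\<close> by a multiple of \<open>t^(-2)\<close>, hence of \<open>k^2\<close>, and the
  factor \<open>exp (- 2 k \<psi>)\<close> beats any power of \<open>k\<close> at the ends of (0,T).
  Terms with \<open>k'\<close> are of lower order since \<open>|k'| \<le> T k^2\<close> for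
  \<open>s \<ge> 1\<close>, and \<open>k \<ge> s / T^2\<close> makes \<open>k\<close> large at all
  times at once. The time integrals take values in [0, \<infinity>], so estimates on compact
  subintervals suffice.\<close>

definition smooth :: "(real \<Rightarrow> real) \<Rightarrow> bool" where
  "smooth f \<longleftrightarrow> (\<forall>n x. (deriv ^^ n) f field_differentiable at x)"

lemma test_function_on_iff:
  "test_function_on \<Omega> \<phi> \<longleftrightarrow>
     smooth \<phi> \<and> (\<exists>K. compact K \<and> K \<subseteq> \<Omega> \<and> (\<forall>x. x \<notin> K \<longrightarrow> \<phi> x = 0))"
  by (simp add: test_function_on_def smooth_def)

lemma smooth_deriv: "smooth f \<Longrightarrow> smooth (deriv f)"
  unfolding smooth_def by (metis funpow_Suc_right o_apply)

lemma smooth_has_derivative: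
  "smooth f \<Longrightarrow> (f has_real_derivative deriv f x) (at x)"
  unfolding smooth_def by (metis DERIV_deriv_iff_field_differentiable funpow_0)

text \<open>A coinduction principle: the iterates of \<open>deriv\<close> never leave a class that
  is closed under differentiation, so smoothness reduces to finding an invariant class.\<close>

lemma smooth_class:
  assumes "P f"
    and step: "\<And>g. P g \<Longrightarrow> \<exists>g'. P g' \<and> (\<forall>x. (g has_real_derivative g' x) (at x))"
  shows "smooth f"
proof -
  have dP: "P (deriv g) \<and> (\<forall>x. g field_differentiable at x)" if "P g" for g
  proof -
    from step[OF that] obtain g' where g': "P g'" "\<And>x. (g has_real_derivative g' x) (at x)"
      by blast
    then have "deriv g = g'" by (intro ext DERIV_imp_deriv)
    with g' show ?thesis by (auto simp: field_differentiable_def)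
  qed
  have "P ((deriv ^^ n) f)" for n
    by (induction n) (use assms(1) dP in auto)
  then show ?thesis unfolding smooth_def using dP by blast
qed

lemma smooth_affine: "smooth (\<lambda>x. a * x + b)"
proof (rule smooth_class[where P = "\<lambda>g. \<exists>a b. g = (\<lambda>x. a * x + b)"])
  fix g :: "real \<Rightarrow> real" assume "\<exists>a b. g = (\<lambda>x. a * x + b)"
  then obtain a b where g: "g = (\<lambda>x. a * x + b)" by blast
  show "\<exists>g'. (\<exists>a b. g' = (\<lambda>x. a * x + b)) \<and> (\<forall>x. (g has_real_derivative g' x) (at x))"
    unfolding g
    by (intro exI[of _ "\<lambda>x. 0 * x + a"] conjI exI[of _ 0] exI[of _ a])
      (auto intro!: derivative_eq_intros)
qed auto

lemma smooth_const: "smooth (\<lambda>x. c)"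
  using smooth_affine[of 0 c] by simp

text \<open>Products of smooth functions alone are not closed under differentiation; by the Leibniz
  rule their finite sums are. Sums and products are thus handled by the same class.\<close>

inductive sum_of_products :: "(real \<Rightarrow> real) \<Rightarrow> bool" where
  prod: "smooth f \<Longrightarrow> smooth g \<Longrightarrow> sum_of_products (\<lambda>x. f x * g x)"
| sum: "sum_of_products f \<Longrightarrow> sum_of_products g \<Longrightarrow> sum_of_products (\<lambda>x. f x + g x)"

lemma smooth_sum_of_products: "sum_of_products f \<Longrightarrow> smooth f"
proof (erule smooth_class)
  fix g assume "sum_of_products g"
  then show "\<exists>g'. sum_of_products g' \<and> (\<forall>x. (g has_real_derivative g' x) (at x))"
  proof induction
    case (prod f g)
    have "sum_of_products (\<lambda>x. deriv f x * g x + f x * deriv g x)"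
      by (intro sum_of_products.intros prod smooth_deriv)
    with prod show ?case
      by (intro exI[of _ "\<lambda>x. deriv f x * g x + f x * deriv g x"])
        (auto intro!: derivative_eq_intros smooth_has_derivative)
  next
    case (sum f g)
    then obtain f' g' where "sum_of_products f'" "\<forall>x. (f has_real_derivative f' x) (at x)"
      "sum_of_products g'" "\<forall>x. (g has_real_derivative g' x) (at x)" by blast
    then show ?case
      by (intro exI[of _ "\<lambda>x. f' x + g' x"])
        (auto intro!: sum_of_products.intros derivative_eq_intros)
  qed
qed

lemma smooth_mult: "smooth f \<Longrightarrow> smooth g \<Longrightarrow> smooth (\<lambda>x. f x * g x)"
  by (rule smooth_sum_of_products[OF sum_of_products.prod])

lemma smooth_add:
  assumes "smooth f" "smooth g"
  shows "smooth (\<lambda>x. f x + g x)"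
proof -
  have "sum_of_products (\<lambda>x. f x * 1 + g x * 1)"
    by (rule sum_of_products.sum[OF sum_of_products.prod sum_of_products.prod])
      (auto intro: assms smooth_const)
  from smooth_sum_of_products[OF this] show ?thesis by simp
qed

lemma smooth_cmult: "smooth f \<Longrightarrow> smooth (\<lambda>x. c * f x)"
  by (intro smooth_mult smooth_const)

lemma smooth_diff: "smooth f \<Longrightarrow> smooth g \<Longrightarrow> smooth (\<lambda>x. f x - g x)"
  using smooth_add[of f "\<lambda>x. -1 * g x"] smooth_cmult[of g "-1"] by simp

lemma smooth_power: "smooth f \<Longrightarrow> smooth (\<lambda>x. f x ^ n)"
  by (induction n) (auto intro: smooth_const smooth_mult)

text \<open>The constant \<open>c\<close> in the invariant class absorbs the factors
  \<open>a\<close> that the chain rule produces.\<close>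

lemma smooth_compose_affine: "smooth f \<Longrightarrow> smooth (\<lambda>x. f (a * x + b))"
proof (rule smooth_class[where P = "\<lambda>g. \<exists>c f. smooth f \<and> g = (\<lambda>x. c * f (a * x + b))"])
  assume "smooth f"
  then show "\<exists>c f'. smooth f' \<and> (\<lambda>x. f (a * x + b)) = (\<lambda>x. c * f' (a * x + b))"
    by (intro exI[of _ 1] exI[of _ f]) auto
next
  fix g assume "\<exists>c f. smooth f \<and> g = (\<lambda>x. c * f (a * x + b))"
  then obtain c f where f: "smooth f" and g: "g = (\<lambda>x. c * f (a * x + b))" by blast
  have "((\<lambda>x. f (a * x + b)) has_real_derivative deriv f (a * x + b) * a) (at x)" for x
    by (rule DERIV_chain'[where g = f])
      (auto intro!: derivative_eq_intros smooth_has_derivative f)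
  then have "\<forall>x. (g has_real_derivative (c * a) * deriv f (a * x + b)) (at x)"
    unfolding g by (auto intro!: derivative_eq_intros)
  with smooth_deriv[OF f] show "\<exists>g'. (\<exists>c f. smooth f \<and> g' = (\<lambda>x. c * f (a * x + b))) \<and>
      (\<forall>x. (g has_real_derivative g' x) (at x))"
    by (intro exI[of _ "\<lambda>x. (c * a) * deriv f (a * x + b)"]) auto
qed

lemma smooth_real_polynomial_function:
  fixes p :: "real \<Rightarrow> real"
  shows "real_polynomial_function p \<Longrightarrow> smooth p"
proof (induction rule: real_polynomial_function.induct)
  case (linear f)
  then obtain c where "f = (\<lambda>x. x * c)" by (metis real_bounded_linear)
  then show ?case using smooth_affine[of c 0] by (simp add: mult.commute)
qed (auto intro: smooth_const smooth_add smooth_mult)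

section \<open>A smooth function that is flat at the origin\<close>

definition bump_exp :: "real \<Rightarrow> real" where
  "bump_exp x = (if x > 0 then exp (- (1 / x)) else 0)"

lemma bump_exp_bounds: "0 \<le> bump_exp x" "bump_exp x \<le> 1" "x > 0 \<Longrightarrow> bump_exp x > 0"
  by (auto simp: bump_exp_def)

lemma bump_exp_mono: "x \<le> y \<Longrightarrow> bump_exp x \<le> bump_exp y"
  by (auto simp: bump_exp_def divide_simps)

text \<open>Induction on the coefficients of \<open>p\<close>. The power \<open>y ^ k\<close> is
  kept general because splitting off the constant coefficient raises it by one.\<close>

lemma poly_div_exp_tendsto_0: "((\<lambda>y::real. y ^ k * poly p y * exp (- y)) \<longlongrightarrow> 0) at_top"
proof (induction p arbitrary: k)
  case 0
  then show ?case by simp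
next
  case (pCons a p)
  have "((\<lambda>y::real. a * (y ^ k / exp y) + y ^ Suc k * poly p y * exp (- y)) \<longlongrightarrow> a * 0 + 0) at_top"
    by (intro tendsto_intros pCons tendsto_power_div_exp_0)
  then show ?case
    by (simp add: algebra_simps exp_minus divide_inverse)
qed

text \<open>The invariant class consists of the functions
  \<open>poly p (1 / x) * bump_exp x\<close>. Away from 0 this is calculus; at 0 every member has
  derivative 0, because the exponential beats any power of \<open>1 / x\<close>.\<close>

lemma smooth_bump_exp: "smooth bump_exp"
proof (rule smooth_class[where P = "\<lambda>g. \<exists>p. g = (\<lambda>x. poly p (1 / x) * bump_exp x)"])
  show "\<exists>p. bump_exp = (\<lambda>x. poly p (1 / x) * bump_exp x)"
    by (rule exI[of _ 1]) simp
next
  fix g assume "\<exists>p. g = (\<lambda>x. poly p (1 / x) * bump_exp x)"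
  then obtain p where g: "g = (\<lambda>x. poly p (1 / x) * bump_exp x)" by blast
  \<comment> \<open>With \<open>y = 1 / x\<close> one has \<open>y' = - y^2\<close>, and
    \<open>exp (- y)\<close> has derivative \<open>y^2 * exp (- y)\<close>; together they give the
    polynomial \<open>y^2 * (p - p')\<close>.\<close>
  define q where "q = monom 1 2 * (p - pderiv p)"
  have "(g has_real_derivative poly q (1 / x) * bump_exp x) (at x)" for x
  proof (cases x "0::real" rule: linorder_cases)
    case less
    have "(g has_real_derivative 0) (at x)"
      by (rule has_field_derivative_transform_within_open[where S = "{..<0}" and f = "\<lambda>_. 0"])
        (use less in \<open>auto simp: g bump_exp_def\<close>)
    with less show ?thesis by (simp add: bump_exp_def)
  next
    case greater
    have "((\<lambda>x. poly p (1 / x) * exp (- (1 / x))) has_real_derivative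
        poly q (1 / x) * bump_exp x) (at x)"
      using greater
      by (auto intro!: derivative_eq_intros DERIV_chain'[OF _ poly_DERIV]
          simp: q_def bump_exp_def poly_monom field_simps power2_eq_square)
    then show ?thesis
      by (rule has_field_derivative_transform_within_open[where S = "{0<..}"])
        (use greater in \<open>auto simp: g bump_exp_def\<close>)
  next
    case equal
    \<comment> \<open>The difference quotient of \<open>g\<close> at 0 contributes one more factor
      \<open>1 / y\<close>, hence the exponent 1.\<close>
    have "((\<lambda>y. (inverse y) ^ 1 * poly p (inverse y) * exp (- inverse y)) \<longlongrightarrow> 0) (at_right 0)"
      by (rule filterlim_compose[OF poly_div_exp_tendsto_0 filterlim_inverse_at_top_right])
    then have "((\<lambda>y. (g y - g 0) / (y - 0)) \<longlongrightarrow> 0) (at_right 0)"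
      by (rule Lim_transform_eventually)
        (simp add: eventually_at_filter g bump_exp_def field_simps)
    moreover have "((\<lambda>y. (g y - g 0) / (y - 0)) \<longlongrightarrow> 0) (at_left 0)"
      by (rule tendsto_eventually)
        (auto simp: eventually_at_filter g bump_exp_def)
    ultimately have "((\<lambda>y. (g y - g 0) / (y - 0)) \<longlongrightarrow> 0) (at 0)"
      by (simp add: filterlim_at_split)
    then show ?thesis using equal
      by (simp add: has_field_derivative_iff bump_exp_def)
  qed
  then show "\<exists>g'. (\<exists>p. g' = (\<lambda>x. poly p (1 / x) * bump_exp x)) \<and>
      (\<forall>x. (g has_real_derivative g' x) (at x))" by blast
qed

section \<open>Test functions: closure properties, primitives and cutoffs\<close>

lemma test_function_add:
  assumes "test_function_on \<Omega> f" "test_function_on \<Omega> g"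
  shows "test_function_on \<Omega> (\<lambda>x. f x + g x)"
proof -
  obtain K K' where "compact K" "K \<subseteq> \<Omega>" "\<forall>x. x \<notin> K \<longrightarrow> f x = 0"
    "compact K'" "K' \<subseteq> \<Omega>" "\<forall>x. x \<notin> K' \<longrightarrow> g x = 0"
    using assms by (auto simp: test_function_on_iff)
  then have "compact (K \<union> K') \<and> K \<union> K' \<subseteq> \<Omega> \<and> (\<forall>x. x \<notin> K \<union> K' \<longrightarrow> f x + g x = 0)"
    by auto
  with assms show ?thesis
    by (auto simp: test_function_on_iff intro!: smooth_add)
qed

lemma test_function_mult:
  assumes "smooth f" "test_function_on \<Omega> g"
  shows "test_function_on \<Omega> (\<lambda>x. f x * g x)"
  using assms by (auto simp: test_function_on_iff intro!: smooth_mult)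

lemma test_function_cmult: "test_function_on \<Omega> g \<Longrightarrow> test_function_on \<Omega> (\<lambda>x. c * g x)"
  by (rule test_function_mult[OF smooth_const])

lemma test_function_deriv:
  assumes "test_function_on \<Omega> f"
  shows "test_function_on \<Omega> (deriv f)"
proof -
  obtain K where K: "compact K" "K \<subseteq> \<Omega>" "\<And>x. x \<notin> K \<Longrightarrow> f x = 0"
    using assms by (auto simp: test_function_on_iff)
  have "deriv f x = 0" if "x \<notin> K" for x
  proof (rule DERIV_imp_deriv)
    show "(f has_real_derivative 0) (at x)"
      by (rule has_field_derivative_transform_within_open[where S = "- K" and f = "\<lambda>_. 0"])
        (use K that in \<open>auto intro: compact_imp_closed\<close>)
  qed
  with K assms show ?thesis by (auto simp: test_function_on_iff smooth_deriv)
qed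

lemma test_function_support_Icc:
  fixes a b :: real
  assumes "test_function_on {a<..<b} \<phi>" "a < b"
  obtains c d where "a < c" "c < d" "d < b" "\<And>x. x \<notin> {c..d} \<Longrightarrow> \<phi> x = 0"
proof -
  obtain K where K: "compact K" "K \<subseteq> {a<..<b}" "\<And>x. x \<notin> K \<Longrightarrow> \<phi> x = 0"
    using assms by (auto simp: test_function_on_iff)
  show ?thesis
  proof (cases "K = {}")
    case True
    show ?thesis using K True assms(2)
      by (intro that[of "(2 * a + b) / 3" "(a + 2 * b) / 3"]) (auto simp: field_simps)
  next
    case False
    obtain s where s: "s \<in> K" "\<And>t. t \<in> K \<Longrightarrow> s \<le> t"
      using compact_attains_inf[OF K(1) False] by blast
    obtain u where u: "u \<in> K" "\<And>t. t \<in> K \<Longrightarrow> t \<le> u"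
      using compact_attains_sup[OF K(1) False] by blast
    have "a < s" "u < b" "s \<le> u" using s u K(2) by auto
    \<comment> \<open>The right end is moved to the midpoint between \<open>u\<close> and
      \<open>b\<close>, so that the interval is nondegenerate even if \<open>K\<close> is a single
      point.\<close>
    moreover have "\<phi> x = 0" if "x \<notin> {s..(u + b) / 2}" for x
    proof (rule K(3))
      show "x \<notin> K" using s(2)[of x] u(2)[of x] that \<open>u < b\<close> by auto
    qed
    ultimately show ?thesis
      by (intro that[of s "(u + b) / 2"]) auto
  qed
qed

text \<open>To the right of the support of \<open>\<kappa>\<close> the primitive starting at
  \<open>a\<close> is constantly the integral of \<open>\<kappa>\<close>. Zero mean is therefore
  exactly what makes the primitive compactly supported.\<close>

lemma smooth_antiderivative_test_function:
  fixes a b :: real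
  assumes ab: "a < b" and t: "test_function_on {a<..<b} \<kappa>" and 0: "integral {a..b} \<kappa> = 0"
  obtains \<Phi> where "test_function_on {a<..<b} \<Phi>" "deriv \<Phi> = \<kappa>"
proof -
  obtain c d where cd: "a < c" "c < d" "d < b" "\<And>x. x \<notin> {c..d} \<Longrightarrow> \<kappa> x = 0"
    using test_function_support_Icc[OF t ab] by blast
  have sm: "smooth \<kappa>" using t by (simp add: test_function_on_iff)
  have cont: "continuous_on S \<kappa>" for S
    using sm smooth_has_derivative by (meson DERIV_continuous_on has_field_derivative_at_within)
  define \<Phi> where "\<Phi> x = (if x < a then 0 else integral {a..x} \<kappa>)" for x
  have z: "\<Phi> x = 0" if "x < c" for x
  proof (cases "x < a")
    case False
    have "integral {a..x} \<kappa> = integral {a..x} (\<lambda>x. 0)"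
      by (rule integral_cong) (use cd that in auto)
    then show ?thesis by (simp add: \<Phi>_def)
  qed (simp add: \<Phi>_def)
  have z2: "\<Phi> x = 0" if "x > d" for x
  proof -
    have *: "\<Phi> x = integral {a..d} \<kappa>" if "x \<ge> d" for x
    proof -
      have "integral {a..x} \<kappa> = integral {a..d} \<kappa> + integral {d..x} \<kappa>"
        by (rule Henstock_Kurzweil_Integration.integral_combine[symmetric])
          (use cd that in \<open>auto intro!: integrable_continuous_real cont\<close>)
      also have "integral {d..x} \<kappa> = integral {d..x} (\<lambda>x. 0)"
        by (rule integral_spike[of "{d}"]) (use cd in auto)
      finally show ?thesis using cd that by (simp add: \<Phi>_def)
    qed
    show ?thesis using *[of b] *[of x] 0 that cd by (simp add: \<Phi>_def)
  qed
  have d\<Phi>: "(\<Phi> has_real_derivative \<kappa> x) (at x)" for x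
  proof -
    consider "x < c" | "x > a" by (use cd in linarith)
    then show ?thesis
    proof cases
      case 1
      have "(\<Phi> has_real_derivative 0) (at x)"
        by (rule has_field_derivative_transform_within_open[where S = "{..<c}" and f = "\<lambda>_. 0"])
          (use 1 z in auto)
      then show ?thesis using cd(4)[of x] 1 by auto
    next
      case 2
      have "((\<lambda>u. integral {a..u} \<kappa>) has_vector_derivative \<kappa> x) (at x within {a..x+1})"
        by (rule integral_has_vector_derivative) (use 2 cont in auto)
      then have "((\<lambda>u. integral {a..u} \<kappa>) has_real_derivative \<kappa> x) (at x within {a..x+1})"
        by (simp add: has_real_derivative_iff_has_vector_derivative)
      then have "((\<lambda>u. integral {a..u} \<kappa>) has_real_derivative \<kappa> x) (at x)"
        using 2 by (metis at_within_Icc_at less_add_one)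
      then show ?thesis
        by (rule has_field_derivative_transform_within_open[where S = "{a<..}"])
          (use 2 in \<open>auto simp: \<Phi>_def\<close>)
    qed
  qed
  then have "deriv \<Phi> = \<kappa>" by (intro ext DERIV_imp_deriv)
  moreover have "smooth \<Phi>"
    by (rule smooth_class[where P = "\<lambda>g. g = \<Phi> \<or> smooth g"])
      (use d\<Phi> sm smooth_has_derivative smooth_deriv in blast)+
  moreover have "compact {c..d}" "{c..d} \<subseteq> {a<..<b}" "\<forall>x. x \<notin> {c..d} \<longrightarrow> \<Phi> x = 0"
    using cd z z2 by (auto simp: not_le)
  ultimately show ?thesis using that unfolding test_function_on_iff by blast
qed

text \<open>\<open>\<beta> n\<close> is a bump living on the interval shrunk by \<open>e n\<close>.
  At a fixed interior point it becomes positive for some \<open>m\<close> and only grows afterwards,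
  so \<open>(1 - \<beta> n x) ^ n\<close> is eventually below a geometric sequence. The power thus
  pushes \<open>\<kappa> n\<close> to 1 without the construction of a plateau.\<close>

lemma smooth_cutoff:
  fixes a b :: real
  assumes "a < b"
  obtains \<kappa> :: "nat \<Rightarrow> real \<Rightarrow> real" where
    "\<And>n. test_function_on {a<..<b} (\<kappa> n)" "\<And>n x. 0 \<le> \<kappa> n x" "\<And>n x. \<kappa> n x \<le> 1"
    "\<And>x. x \<in> {a<..<b} \<Longrightarrow> (\<lambda>n. \<kappa> n x) \<longlonglongrightarrow> 1"
proof -
  define e where "e n = (b - a) / (real n + 3)" for n :: nat
  have e: "0 < e n" "e n < (b - a) / 2" for n
  proof -
    show "0 < e n" using assms by (simp add: e_def add_nonneg_pos)
    show "e n < (b - a) / 2"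
      unfolding e_def by (rule divide_strict_left_mono) (use assms in auto)
  qed
  define \<beta> where "\<beta> n x = bump_exp (1 * x + - (a + e n)) * bump_exp (-1 * x + (b - e n))" for n x
  have \<beta>: "0 \<le> \<beta> n x" "\<beta> n x \<le> 1" for n x
    unfolding \<beta>_def by (auto intro!: mult_nonneg_nonneg mult_le_one bump_exp_bounds)
  define \<kappa> where "\<kappa> n x = 1 - (1 - \<beta> n x) ^ n" for n x
  have sm: "smooth (\<kappa> n)" for n
    unfolding \<kappa>_def \<beta>_def
    by (intro smooth_diff smooth_const smooth_power smooth_mult smooth_compose_affine smooth_bump_exp)
  have "\<kappa> n x = 0" if "x \<notin> {a + e n..b - e n}" for n x
    using that by (auto simp: \<kappa>_def \<beta>_def bump_exp_def)
  then have tf: "test_function_on {a<..<b} (\<kappa> n)" for n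
    unfolding test_function_on_iff using sm e[of n]
    by (auto intro!: exI[of _ "{a + e n..b - e n}"])
  have lim: "(\<lambda>n. \<kappa> n x) \<longlonglongrightarrow> 1" if x: "x \<in> {a<..<b}" for x
  proof -
    have "e \<longlonglongrightarrow> 0"
      unfolding e_def
      by (subst add.commute, rule real_tendsto_divide_at_top[OF tendsto_const])
        (rule filterlim_tendsto_add_at_top[OF tendsto_const filterlim_real_sequentially])
    then have "\<forall>\<^sub>F n in sequentially. e n < min (x - a) (b - x)"
      using x by (intro order_tendstoD) auto
    then obtain m where m: "e m < min (x - a) (b - x)"
      by (auto simp: eventually_sequentially)
    have "\<beta> m x > 0" using m by (auto simp: \<beta>_def bump_exp_bounds)
    then have r: "0 \<le> 1 - \<beta> m x" "1 - \<beta> m x < 1" using \<beta>[of m x] by auto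
    have mono: "\<beta> m x \<le> \<beta> n x" if "m \<le> n" for n
    proof -
      have "e n \<le> e m" using that assms by (auto simp: e_def intro!: divide_left_mono mult_pos_pos)
      then show ?thesis unfolding \<beta>_def
        by (intro mult_mono bump_exp_mono bump_exp_bounds) auto
    qed
    have "(\<lambda>n. (1 - \<beta> n x) ^ n) \<longlonglongrightarrow> 0"
    proof (rule tendsto_sandwich[OF _ _ tendsto_const LIMSEQ_realpow_zero[OF r]])
      show "\<forall>\<^sub>F n in sequentially. 0 \<le> (1 - \<beta> n x) ^ n" using \<beta> by auto
      show "\<forall>\<^sub>F n in sequentially. (1 - \<beta> n x) ^ n \<le> (1 - \<beta> m x) ^ n"
        unfolding eventually_sequentially
        by (intro exI[of _ m] allI impI power_mono) (use mono \<beta> in auto)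
    qed
    from tendsto_diff[OF tendsto_const[of 1] this] show ?thesis by (simp add: \<kappa>_def)
  qed
  show ?thesis
    by (rule that[of \<kappa>]) (use tf lim \<beta> in \<open>auto simp: \<kappa>_def intro!: power_le_one\<close>)
qed

section \<open>Square-integrable functions on an interval\<close>

lemma L2_onI:
  "f \<in> borel_measurable (lebesgue_on \<Omega>) \<Longrightarrow> integrable (lebesgue_on \<Omega>) (\<lambda>x. (f x)\<^sup>2) \<Longrightarrow> f \<in> L2_on \<Omega>"
  by (simp add: L2_on_def)

lemma L2_onD:
  assumes "f \<in> L2_on \<Omega>"
  shows "f \<in> borel_measurable (lebesgue_on \<Omega>)" "integrable (lebesgue_on \<Omega>) (\<lambda>x. (f x)\<^sup>2)"
  using assms by (auto simp: L2_on_def)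

lemma L2_on_mult_integrable:
  assumes "f \<in> L2_on \<Omega>" "g \<in> L2_on \<Omega>"
  shows "integrable (lebesgue_on \<Omega>) (\<lambda>x. f x * g x)"
proof (rule Bochner_Integration.integrable_bound)
  show "integrable (lebesgue_on \<Omega>) (\<lambda>x. (f x)\<^sup>2 + (g x)\<^sup>2)"
    using assms by (intro Bochner_Integration.integrable_add L2_onD)
  show "(\<lambda>x. f x * g x) \<in> borel_measurable (lebesgue_on \<Omega>)"
    using assms by (intro borel_measurable_times L2_onD)
  show "AE x in lebesgue_on \<Omega>. norm (f x * g x) \<le> norm ((f x)\<^sup>2 + (g x)\<^sup>2)"
  proof (rule AE_I2)
    fix x
    have "2 * (\<bar>f x\<bar> * \<bar>g x\<bar>) \<le> (f x)\<^sup>2 + (g x)\<^sup>2"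
      using sum_squares_bound[of "\<bar>f x\<bar>" "\<bar>g x\<bar>"] by simp
    moreover have "0 \<le> \<bar>f x\<bar> * \<bar>g x\<bar>" by simp
    ultimately have "\<bar>f x\<bar> * \<bar>g x\<bar> \<le> (f x)\<^sup>2 + (g x)\<^sup>2" by linarith
    then show "norm (f x * g x) \<le> norm ((f x)\<^sup>2 + (g x)\<^sup>2)"
      by (simp add: abs_mult)
  qed
qed

lemma L2_on_add:
  assumes "f \<in> L2_on \<Omega>" "g \<in> L2_on \<Omega>"
  shows "(\<lambda>x. f x + g x) \<in> L2_on \<Omega>"
proof (rule L2_onI)
  have "integrable (lebesgue_on \<Omega>) (\<lambda>x. (f x)\<^sup>2 + (g x)\<^sup>2 + 2 * (f x * g x))"
    using assms by (intro Bochner_Integration.integrable_add integrable_mult_right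
        L2_onD L2_on_mult_integrable)
  then show "integrable (lebesgue_on \<Omega>) (\<lambda>x. (f x + g x)\<^sup>2)"
    by (simp add: power2_sum mult.assoc)
  show "(\<lambda>x. f x + g x) \<in> borel_measurable (lebesgue_on \<Omega>)"
    by (intro borel_measurable_add L2_onD(1) assms)
qed

lemma L2_on_cmult:
  assumes "f \<in> L2_on \<Omega>"
  shows "(\<lambda>x. c * f x) \<in> L2_on \<Omega>"
proof (rule L2_onI)
  show "(\<lambda>x. c * f x) \<in> borel_measurable (lebesgue_on \<Omega>)"
    by (intro borel_measurable_times borel_measurable_const L2_onD[OF assms])
  show "integrable (lebesgue_on \<Omega>) (\<lambda>x. (c * f x)\<^sup>2)"
    using L2_onD[OF assms] by (simp add: power_mult_distrib)
qed

lemma L2_on_divide: "f \<in> L2_on \<Omega> \<Longrightarrow> (\<lambda>x. f x / c) \<in> L2_on \<Omega>"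
  using L2_on_cmult[of f \<Omega> "1 / c"] by simp

lemma L2_on_diff: "f \<in> L2_on \<Omega> \<Longrightarrow> g \<in> L2_on \<Omega> \<Longrightarrow> (\<lambda>x. f x - g x) \<in> L2_on \<Omega>"
  using L2_on_add[of f \<Omega> "\<lambda>x. -1 * g x"] L2_on_cmult[of g \<Omega> "-1"] by simp

lemmas L2_on_intros = L2_on_add L2_on_cmult L2_on_diff L2_on_divide

lemma L2_norm_nonneg: "0 \<le> L2_norm_on \<Omega> f"
  by (auto simp: L2_norm_on_def intro!: Bochner_Integration.integral_nonneg)

lemma L2_norm_square: "(L2_norm_on \<Omega> f)\<^sup>2 = integral\<^sup>L (lebesgue_on \<Omega>) (\<lambda>x. (f x)\<^sup>2)"
  by (auto simp: L2_norm_on_def intro!: Bochner_Integration.integral_nonneg)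

lemma L2_norm_minus_commute: "L2_norm_on \<Omega> (\<lambda>x. f x - g x) = L2_norm_on \<Omega> (\<lambda>x. g x - f x)"
  by (simp add: L2_norm_on_def power2_commute)

lemma L2_norm_cong: "ae_eq_on \<Omega> f g \<Longrightarrow> f \<in> L2_on \<Omega> \<Longrightarrow> g \<in> L2_on \<Omega> \<Longrightarrow>
    L2_norm_on \<Omega> f = L2_norm_on \<Omega> g"
  unfolding L2_norm_on_def ae_eq_on_def
  by (intro arg_cong[where f = sqrt] Bochner_Integration.integral_cong_AE)
    (auto dest: L2_onD elim: eventually_mono)

lemma L2_norm_eq_0_iff:
  assumes "f \<in> L2_on \<Omega>"
  shows "L2_norm_on \<Omega> f = 0 \<longleftrightarrow> ae_eq_on \<Omega> f (\<lambda>x. 0)"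
  using integral_nonneg_eq_0_iff_AE[OF L2_onD(2)[OF assms]]
  by (simp add: L2_norm_on_def ae_eq_on_def)

lemma L2_Cauchy_Schwarz:
  assumes f: "f \<in> L2_on \<Omega>" and g: "g \<in> L2_on \<Omega>"
  shows "\<bar>integral\<^sup>L (lebesgue_on \<Omega>) (\<lambda>x. f x * g x)\<bar> \<le> L2_norm_on \<Omega> f * L2_norm_on \<Omega> g"
proof -
  define A B I where "A = L2_norm_on \<Omega> f" and "B = L2_norm_on \<Omega> g"
    and "I = integral\<^sup>L (lebesgue_on \<Omega>) (\<lambda>x. f x * g x)"
  have quad: "0 \<le> r\<^sup>2 * A\<^sup>2 - 2 * r * q * I + q\<^sup>2 * B\<^sup>2" for r q
  proof -
    have "0 \<le> integral\<^sup>L (lebesgue_on \<Omega>) (\<lambda>x. (r * f x - q * g x)\<^sup>2)"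
      by (rule Bochner_Integration.integral_nonneg) simp
    also have "(\<lambda>x. (r * f x - q * g x)\<^sup>2) =
        (\<lambda>x. r\<^sup>2 * (f x)\<^sup>2 - 2 * r * q * (f x * g x) + q\<^sup>2 * (g x)\<^sup>2)"
      by (auto simp: power2_eq_square algebra_simps)
    also have "integral\<^sup>L (lebesgue_on \<Omega>) \<dots> = r\<^sup>2 * A\<^sup>2 - 2 * r * q * I + q\<^sup>2 * B\<^sup>2"
      unfolding A_def B_def I_def L2_norm_square
      using L2_onD(2)[OF f] L2_onD(2)[OF g] L2_on_mult_integrable[OF f g] by simp
    finally show ?thesis .
  qed
  have AB: "0 \<le> A" "0 \<le> B" by (auto simp: A_def B_def L2_norm_nonneg)
  have "I\<^sup>2 \<le> (A * B)\<^sup>2"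
  proof (cases "A = 0")
    case True
    have "2 * r * I \<le> B\<^sup>2" for r using quad[of r 1] True by simp
    \<comment> \<open>If \<open>A = 0\<close> the quadratic inequality is linear in
      \<open>r\<close>; unless \<open>I = 0\<close>, this value of \<open>r\<close> would give
      \<open>B^2 + 1 \<le> B^2\<close>.\<close>
    from this[of "(B\<^sup>2 + 1) / (2 * I)"] have "I = 0" by (cases "I = 0") auto
    then show ?thesis by simp
  next
    case False
    \<comment> \<open>The quadratic form is evaluated at its minimizing direction
      \<open>r = I\<close>, \<open>q = A^2\<close>.\<close>
    have "0 \<le> A\<^sup>2 * ((A * B)\<^sup>2 - I\<^sup>2)"
      using quad[of I "A\<^sup>2"] by (simp add: power2_eq_square algebra_simps)
    then show ?thesis using False by (simp add: zero_le_mult_iff)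
  qed
  then have "\<bar>I\<bar> \<le> \<bar>A * B\<bar>" by (simp add: abs_le_square_iff)
  with AB show ?thesis by (simp add: A_def B_def I_def)
qed

lemma L2_norm_triangle:
  assumes f: "f \<in> L2_on \<Omega>" and g: "g \<in> L2_on \<Omega>"
  shows "L2_norm_on \<Omega> (\<lambda>x. f x + g x) \<le> L2_norm_on \<Omega> f + L2_norm_on \<Omega> g"
proof (rule power2_le_imp_le)
  have "(L2_norm_on \<Omega> (\<lambda>x. f x + g x))\<^sup>2 =
      integral\<^sup>L (lebesgue_on \<Omega>) (\<lambda>x. (f x)\<^sup>2 + (g x)\<^sup>2 + 2 * (f x * g x))"
    unfolding L2_norm_square by (simp add: power2_sum mult.assoc)
  also have "\<dots> = (L2_norm_on \<Omega> f)\<^sup>2 + (L2_norm_on \<Omega> g)\<^sup>2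
      + 2 * integral\<^sup>L (lebesgue_on \<Omega>) (\<lambda>x. f x * g x)"
    unfolding L2_norm_square
    using L2_onD(2)[OF f] L2_onD(2)[OF g] L2_on_mult_integrable[OF f g] by simp
  also have "\<dots> \<le> (L2_norm_on \<Omega> f)\<^sup>2 + (L2_norm_on \<Omega> g)\<^sup>2 + 2 * (L2_norm_on \<Omega> f * L2_norm_on \<Omega> g)"
    using L2_Cauchy_Schwarz[OF f g] by auto
  finally show "(L2_norm_on \<Omega> (\<lambda>x. f x + g x))\<^sup>2 \<le> (L2_norm_on \<Omega> f + L2_norm_on \<Omega> g)\<^sup>2"
    by (simp add: power2_sum)
qed (auto intro: add_nonneg_nonneg L2_norm_nonneg)

lemma L2_norm_triangle_diff:
  assumes "f \<in> L2_on \<Omega>" "g \<in> L2_on \<Omega>" "h \<in> L2_on \<Omega>"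
  shows "L2_norm_on \<Omega> (\<lambda>x. f x - h x) \<le> L2_norm_on \<Omega> (\<lambda>x. f x - g x) + L2_norm_on \<Omega> (\<lambda>x. g x - h x)"
  using L2_norm_triangle[OF L2_on_diff[OF assms(1,2)] L2_on_diff[OF assms(2,3)]] by simp

lemma L2_norm_tendsto_unique:
  assumes "F \<noteq> bot" "f \<in> L2_on \<Omega>" "g \<in> L2_on \<Omega>" "\<forall>\<^sub>F n in F. v n \<in> L2_on \<Omega>"
    and "((\<lambda>n. L2_norm_on \<Omega> (\<lambda>x. v n x - f x)) \<longlongrightarrow> 0) F"
    and "((\<lambda>n. L2_norm_on \<Omega> (\<lambda>x. v n x - g x)) \<longlongrightarrow> 0) F"
  shows "ae_eq_on \<Omega> f g"
proof -
  have "L2_norm_on \<Omega> (\<lambda>x. f x - g x) \<le> 0 + 0"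
  proof (rule tendsto_lowerbound[OF tendsto_add[OF assms(5,6)] _ assms(1)])
    show "\<forall>\<^sub>F n in F. L2_norm_on \<Omega> (\<lambda>x. f x - g x)
        \<le> L2_norm_on \<Omega> (\<lambda>x. v n x - f x) + L2_norm_on \<Omega> (\<lambda>x. v n x - g x)"
      using assms(4)
      by eventually_elim
        (metis L2_norm_triangle_diff[OF assms(2) _ assms(3)] L2_norm_minus_commute)
  qed
  then have "L2_norm_on \<Omega> (\<lambda>x. f x - g x) = 0"
    using L2_norm_nonneg[of \<Omega> "\<lambda>x. f x - g x"] by linarith
  then show ?thesis
    using L2_norm_eq_0_iff[OF L2_on_diff[OF assms(2,3)]] by (simp add: ae_eq_on_def)
qed

lemma ae_eq_on_refl: "ae_eq_on \<Omega> f f" by (simp add: ae_eq_on_def)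

lemma ae_eq_on_sym: "ae_eq_on \<Omega> f g \<Longrightarrow> ae_eq_on \<Omega> g f"
  unfolding ae_eq_on_def by (auto elim: eventually_mono)

lemma ae_eq_on_trans: "ae_eq_on \<Omega> f g \<Longrightarrow> ae_eq_on \<Omega> g h \<Longrightarrow> ae_eq_on \<Omega> f h"
  unfolding ae_eq_on_def by (auto elim: eventually_elim2)

lemma ae_eq_onI: "(\<And>x. x \<in> \<Omega> \<Longrightarrow> f x = g x) \<Longrightarrow> ae_eq_on \<Omega> f g"
  unfolding ae_eq_on_def by (rule AE_I2) simp

lemma integrable_lebesgue_on_Ioo:
  fixes f :: "real \<Rightarrow> real"
  assumes "continuous_on {a..b} f"
  shows "integrable (lebesgue_on {a<..<b}) f"
proof -
  have "set_integrable lebesgue {a..b} f"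
    using assms by (rule absolutely_integrable_continuous_real)
  then have "set_integrable lebesgue {a<..<b} f"
    by (rule set_integrable_subset) auto
  then show ?thesis
    by (simp add: integrable_restrict_space set_integrable_def)
qed

lemma integral_lebesgue_on_Ioo:
  fixes f :: "real \<Rightarrow> real"
  assumes "integrable (lebesgue_on {a<..<b}) f"
  shows "(f has_integral integral\<^sup>L (lebesgue_on {a<..<b}) f) {a..b}"
  using has_integral_integral_lebesgue_on[OF assms] by (simp add: has_integral_Icc_iff_Ioo)

lemma continuous_L2_on:
  assumes "continuous_on {a..b} f"
  shows "f \<in> L2_on {a<..<b}"
  by (intro L2_onI integrable_lebesgue_on_Ioo continuous_intros assms
      borel_measurable_integrable[OF integrable_lebesgue_on_Ioo])

lemma L2_norm_continuous:
  assumes "continuous_on {a..b} f"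
  shows "(L2_norm_on {a<..<b} f)\<^sup>2 = integral {a..b} (\<lambda>x. (f x)\<^sup>2)"
  unfolding L2_norm_square
  by (rule integral_unique[symmetric], rule integral_lebesgue_on_Ioo,
      rule integrable_lebesgue_on_Ioo, intro continuous_intros assms)

text \<open>The squared difference is continuous with integral zero. The conclusion includes the end
  points, so boundary values depend only on the L2 class.\<close>

lemma ae_eq_continuous:
  fixes f g :: "real \<Rightarrow> real"
  assumes "a < b" "continuous_on {a..b} f" "continuous_on {a..b} g"
    and "ae_eq_on {a<..<b} f g" and "x \<in> {a..b}"
  shows "f x = g x"
proof -
  let ?h = "\<lambda>x. (f x - g x)\<^sup>2"
  have c: "continuous_on {a..b} ?h" by (intro continuous_intros assms)
  have "integral {a..b} ?h = integral\<^sup>L (lebesgue_on {a<..<b}) ?h"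
    by (rule integral_unique[OF integral_lebesgue_on_Ioo[OF integrable_lebesgue_on_Ioo[OF c]]])
  also have "\<dots> = integral\<^sup>L (lebesgue_on {a<..<b}) (\<lambda>x. 0)"
    using assms(4) c
    by (intro Bochner_Integration.integral_cong_AE)
      (auto simp: ae_eq_on_def elim: eventually_mono
        intro: borel_measurable_integrable integrable_lebesgue_on_Ioo)
  finally have "?h x = 0"
    using integral_eq_0_iff[OF c assms(1)] assms(5) by simp
  then show ?thesis by simp
qed

text \<open>Evaluates the definite description in \<open>trace_on\<close>: uniqueness of the value
  at \<open>p\<close> is \<open>ae_eq_continuous\<close>.\<close>

lemma trace_on_continuous:
  assumes "a < b" "continuous_on {a..b} g" "ae_eq_on {a<..<b} f g" "p \<in> {a..b}"
  shows "trace_on {a<..<b} f p = g p"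
proof -
  have cl: "closure {a<..<b} = {a..b}" using assms(1) by simp
  show ?thesis unfolding trace_on_def cl
  proof (rule the_equality)
    show "\<exists>h. continuous_on {a..b} h \<and> ae_eq_on {a<..<b} f h \<and> g p = h p"
      using assms by blast
    fix y assume "\<exists>h. continuous_on {a..b} h \<and> ae_eq_on {a<..<b} f h \<and> y = h p"
    then obtain h where "continuous_on {a..b} h" "ae_eq_on {a<..<b} f h" "y = h p" by blast
    then show "y = g p"
      using ae_eq_continuous[OF assms(1) _ assms(2) ae_eq_on_trans[OF ae_eq_on_sym assms(3)] assms(4)]
      by auto
  qed
qed

lemma test_function_continuous: "test_function_on \<Omega> \<phi> \<Longrightarrow> continuous_on S \<phi>"
  unfolding test_function_on_iff
  by (meson DERIV_continuous_on has_field_derivative_at_within smooth_has_derivative)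

lemma test_function_L2_on: "test_function_on {a<..<b} \<phi> \<Longrightarrow> \<phi> \<in> L2_on {a<..<b}"
  by (intro continuous_L2_on test_function_continuous)

section \<open>Density of test functions in L2\<close>

lemma L2_norm_less_iff: "0 < e \<Longrightarrow>
  L2_norm_on \<Omega> f < e \<longleftrightarrow> integral\<^sup>L (lebesgue_on \<Omega>) (\<lambda>x. (f x)\<^sup>2) < e\<^sup>2"
  using L2_norm_square[of \<Omega> f] L2_norm_nonneg[of \<Omega> f]
    power_strict_mono[of "L2_norm_on \<Omega> f" e 2] power_mono[of e "L2_norm_on \<Omega> f" 2]
  by (cases "L2_norm_on \<Omega> f < e") auto

text \<open>Dominated convergence in the form shared by three approximation steps: truncation,
  continuous approximation and cutoff.\<close>

lemma L2_dominated_approx: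
  fixes f :: "real \<Rightarrow> real" and v :: "nat \<Rightarrow> real \<Rightarrow> real"
  assumes f: "f \<in> L2_on \<Omega>" and v: "\<And>n. v n \<in> borel_measurable (lebesgue_on \<Omega>)"
    and w: "integrable (lebesgue_on \<Omega>) w"
    and bd: "\<And>n x. x \<in> \<Omega> \<Longrightarrow> (f x - v n x)\<^sup>2 \<le> w x"
    and lim: "AE x in lebesgue_on \<Omega>. (\<lambda>n. v n x) \<longlonglongrightarrow> f x"
    and "0 < e"
  shows "\<exists>n. L2_norm_on \<Omega> (\<lambda>x. f x - v n x) < e"
proof -
  have "(\<lambda>n. integral\<^sup>L (lebesgue_on \<Omega>) (\<lambda>x. (f x - v n x)\<^sup>2)) \<longlonglongrightarrow>
      integral\<^sup>L (lebesgue_on \<Omega>) (\<lambda>x. 0)"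
  proof (rule integral_dominated_convergence[OF _ _ w])
    show "AE x in lebesgue_on \<Omega>. (\<lambda>n. (f x - v n x)\<^sup>2) \<longlonglongrightarrow> 0"
      using lim
    proof eventually_elim
      case (elim x)
      have "(\<lambda>n. (f x - v n x)\<^sup>2) \<longlonglongrightarrow> (f x - f x)\<^sup>2" by (intro tendsto_intros elim)
      then show ?case by simp
    qed
    show "(\<lambda>x. (f x - v n x)\<^sup>2) \<in> borel_measurable (lebesgue_on \<Omega>)" for n
      using v L2_onD(1)[OF f] by (intro borel_measurable_power borel_measurable_diff)
    show "AE x in lebesgue_on \<Omega>. norm ((f x - v n x)\<^sup>2) \<le> w x" for n
      by (rule AE_I2) (simp add: bd)
  qed simp
  then have "(\<lambda>n. integral\<^sup>L (lebesgue_on \<Omega>) (\<lambda>x. (f x - v n x)\<^sup>2)) \<longlonglongrightarrow> 0" by simp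
  then have "\<forall>\<^sub>F n in sequentially. integral\<^sup>L (lebesgue_on \<Omega>) (\<lambda>x. (f x - v n x)\<^sup>2) < e\<^sup>2"
    using \<open>0 < e\<close> by (intro order_tendstoD) auto
  then show ?thesis using \<open>0 < e\<close> by (auto simp: eventually_sequentially L2_norm_less_iff)
qed

lemma L2_on_bounded:
  assumes "f \<in> borel_measurable (lebesgue_on {a<..<b})" "\<And>x. x \<in> {a<..<b} \<Longrightarrow> \<bar>f x\<bar> \<le> M"
  shows "f \<in> L2_on {a<..<b::real}"
proof (rule L2_onI[OF assms(1)])
  show "integrable (lebesgue_on {a<..<b}) (\<lambda>x. (f x)\<^sup>2)"
  proof (rule Bochner_Integration.integrable_bound)
    show "integrable (lebesgue_on {a<..<b}) (\<lambda>x. M\<^sup>2)"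
      by (rule integrable_lebesgue_on_Ioo) simp
    show "AE x in lebesgue_on {a<..<b}. norm ((f x)\<^sup>2) \<le> norm (M\<^sup>2)"
      by (rule AE_I2) (use assms(2) in \<open>auto simp: abs_le_square_iff[symmetric] intro!: order_trans[OF _ abs_ge_self]\<close>)
  qed (use assms in auto)
qed

definition truncate_at :: "real \<Rightarrow> real \<Rightarrow> real" where
  "truncate_at M y = max (- M) (min M y)"

lemma truncate_at_bound: "0 \<le> M \<Longrightarrow> \<bar>truncate_at M y\<bar> \<le> M"
  by (auto simp: truncate_at_def)

lemma L2_approx_bounded:
  assumes f: "f \<in> L2_on {a<..<b::real}" and e: "0 < e"
  shows "\<exists>n::nat. (\<lambda>x. truncate_at n (f x)) \<in> L2_on {a<..<b} \<and>
    L2_norm_on {a<..<b} (\<lambda>x. f x - truncate_at n (f x)) < e"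
proof -
  have m: "(\<lambda>x. truncate_at M (f x)) \<in> borel_measurable (lebesgue_on {a<..<b})" for M
    unfolding truncate_at_def using L2_onD(1)[OF f] by (intro borel_measurable_max borel_measurable_min) auto
  have "\<exists>n::nat. L2_norm_on {a<..<b} (\<lambda>x. f x - truncate_at n (f x)) < e"
  proof (rule L2_dominated_approx[OF f m L2_onD(2)[OF f]])
    show "(f x - truncate_at (real n) (f x))\<^sup>2 \<le> (f x)\<^sup>2" for n x
      unfolding abs_le_square_iff[symmetric] by (auto simp: truncate_at_def)
    show "AE x in lebesgue_on {a<..<b}. (\<lambda>n. truncate_at (real n) (f x)) \<longlonglongrightarrow> f x"
    proof (rule AE_I2)
      fix x
      obtain N :: nat where "\<bar>f x\<bar> \<le> N" using real_arch_simple by blast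
      then show "(\<lambda>n. truncate_at (real n) (f x)) \<longlonglongrightarrow> f x"
        by (intro tendsto_eventually) (auto simp: eventually_sequentially truncate_at_def intro!: exI[of _ N])
    qed
  qed (rule e)
  moreover have "(\<lambda>x. truncate_at n (f x)) \<in> L2_on {a<..<b}" for n :: nat
    by (rule L2_on_bounded[OF m, where M = n]) (simp add: truncate_at_bound)
  ultimately show ?thesis by blast
qed

text \<open>A measurable function is a limit of continuous ones off a negligible set. Clipping these
  at \<open>M\<close> does not change the limit, because \<open>f\<close> is bounded by
  \<open>M\<close>, and it supplies a constant dominating function.\<close>

lemma L2_approx_continuous:
  assumes f: "f \<in> borel_measurable (lebesgue_on {a<..<b::real})"
    and bd: "\<And>x. x \<in> {a<..<b} \<Longrightarrow> \<bar>f x\<bar> \<le> M" and M: "0 \<le> M" and e: "0 < e"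
  shows "\<exists>g. continuous_on UNIV g \<and> L2_norm_on {a<..<b} (\<lambda>x. f x - g x) < e"
proof -
  let ?F = "\<lambda>x. if x \<in> {a<..<b} then f x else 0"
  have "?F \<in> borel_measurable lebesgue"
    using borel_measurable_if[of "{a<..<b}" f] f by simp
  then have "?F measurable_on {a<..<b}"
    by (rule lebesgue_measurable_imp_measurable_on_real) simp
  then obtain N g where N: "negligible N" and g: "\<And>n. continuous_on UNIV (g n)"
    and lim: "\<And>x. x \<notin> N \<Longrightarrow> (\<lambda>n. g n x) \<longlonglongrightarrow> (if x \<in> {a<..<b} then ?F x else 0)"
    unfolding measurable_on_def by blast
  define v where "v n x = truncate_at M (g n x)" for n :: nat and x
  have v: "continuous_on UNIV (v n)" for n
    unfolding v_def truncate_at_def by (intro continuous_intros g)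
  have "\<exists>n. L2_norm_on {a<..<b} (\<lambda>x. f x - v n x) < e"
  proof (rule L2_dominated_approx[where w = "\<lambda>_. (2 * M)\<^sup>2"])
    show "f \<in> L2_on {a<..<b}" by (rule L2_on_bounded[OF f bd])
    show "v n \<in> borel_measurable (lebesgue_on {a<..<b})" for n
      by (rule L2_onD(1)[OF continuous_L2_on[OF continuous_on_subset[OF v]]]) simp
    show "(f x - v n x)\<^sup>2 \<le> (2 * M)\<^sup>2" if "x \<in> {a<..<b}" for n x
      unfolding abs_le_square_iff[symmetric]
      using bd[OF that] truncate_at_bound[OF M, of "g n x"] by (simp add: v_def)
    have "AE x in lebesgue. x \<notin> N"
      using N by (simp add: negligible_iff_null_sets AE_not_in)
    then have "AE x in lebesgue. x \<in> {a<..<b} \<longrightarrow> (\<lambda>n. v n x) \<longlonglongrightarrow> f x"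
    proof eventually_elim
      case (elim x)
      show ?case
      proof
        assume x: "x \<in> {a<..<b}"
        with lim[OF elim] have "(\<lambda>n. g n x) \<longlonglongrightarrow> f x" by simp
        then have "(\<lambda>n. v n x) \<longlonglongrightarrow> truncate_at M (f x)"
          unfolding v_def truncate_at_def by (intro tendsto_intros)
        moreover have "truncate_at M (f x) = f x" using bd[OF x] by (auto simp: truncate_at_def)
        ultimately show "(\<lambda>n. v n x) \<longlonglongrightarrow> f x" by simp
      qed
    qed
    then show "AE x in lebesgue_on {a<..<b}. (\<lambda>n. v n x) \<longlonglongrightarrow> f x"
      by (simp add: AE_restrict_space_iff)
  qed (use e in \<open>auto intro: integrable_lebesgue_on_Ioo\<close>)
  with v show ?thesis by blast
qed

lemma L2_norm_uniform_bound:
  assumes "a \<le> b" "f \<in> borel_measurable (lebesgue_on {a<..<b})"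
    and "\<And>x. x \<in> {a<..<b} \<Longrightarrow> \<bar>f x\<bar> \<le> M" "0 \<le> M"
  shows "L2_norm_on {a<..<b::real} f \<le> M * sqrt (b - a)"
proof -
  have "integral\<^sup>L (lebesgue_on {a<..<b}) (\<lambda>x. (f x)\<^sup>2) \<le> integral\<^sup>L (lebesgue_on {a<..<b}) (\<lambda>x. M\<^sup>2)"
  proof (rule integral_mono_AE)
    show "integrable (lebesgue_on {a<..<b}) (\<lambda>x. (f x)\<^sup>2)"
      by (rule L2_onD(2)[OF L2_on_bounded[OF assms(2,3)]])
    show "AE x in lebesgue_on {a<..<b}. (f x)\<^sup>2 \<le> M\<^sup>2"
      by (rule AE_I2) (use assms(3) in \<open>auto simp: abs_le_square_iff[symmetric] intro!: order_trans[OF _ abs_ge_self]\<close>)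
  qed (auto intro: integrable_lebesgue_on_Ioo)
  also have "\<dots> = M\<^sup>2 * (b - a)"
    using integral_unique[OF integral_lebesgue_on_Ioo[OF integrable_lebesgue_on_Ioo[of a b "\<lambda>_. M\<^sup>2"]]] assms(1)
    by (simp del: lebesgue_integral_const add: mult.commute)
  finally have "sqrt (integral\<^sup>L (lebesgue_on {a<..<b}) (\<lambda>x. (f x)\<^sup>2)) \<le> sqrt (M\<^sup>2 * (b - a))"
    by (rule real_sqrt_le_mono)
  then show ?thesis
    unfolding L2_norm_on_def using assms(4) by (simp add: real_sqrt_mult)
qed

text \<open>Truncation, continuous approximation, Weierstrass polynomials and cutoffs cost less than
  \<open>e / 4\<close> each. Polynomials are already smooth, so multiplying by a smooth cutoff ends
  the argument and no mollification is involved.\<close>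

lemma test_functions_dense_L2:
  fixes a b :: real
  assumes ab: "a < b" and f: "f \<in> L2_on {a<..<b}" and e: "0 < e"
  obtains \<phi> where "test_function_on {a<..<b} \<phi>" "L2_norm_on {a<..<b} (\<lambda>x. f x - \<phi> x) < e"
proof -
  let ?N = "L2_norm_on {a<..<b}"
  have e4: "0 < e / 4" using e by simp
  obtain n :: nat where n: "(\<lambda>x. truncate_at n (f x)) \<in> L2_on {a<..<b}"
    "?N (\<lambda>x. f x - truncate_at n (f x)) < e / 4"
    using L2_approx_bounded[OF f e4] by blast
  define f1 where "f1 = (\<lambda>x. truncate_at n (f x))"
  obtain g where g: "continuous_on UNIV g" "?N (\<lambda>x. f1 x - g x) < e / 4"
    using L2_approx_continuous[OF L2_onD(1)[OF n(1)] truncate_at_bound _ e4] unfolding f1_def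
    by (metis of_nat_0_le_iff)
  have gL: "g \<in> L2_on {a<..<b}" by (rule continuous_L2_on[OF continuous_on_subset[OF g(1)]]) simp
  \<comment> \<open>A uniform error \<open>\<delta>\<close> costs at most
    \<open>\<delta> * sqrt (b - a) = e / 8\<close> in the L2 norm.\<close>
  define \<delta> where "\<delta> = e / (8 * sqrt (b - a))"
  have \<delta>: "0 < \<delta>" "\<delta> * sqrt (b - a) < e / 4" using ab e by (auto simp: \<delta>_def)
  obtain p where p: "real_polynomial_function p" "\<And>x. x \<in> {a..b} \<Longrightarrow> \<bar>g x - p x\<bar> < \<delta>"
    using Stone_Weierstrass_real_polynomial_function[OF compact_Icc continuous_on_subset[OF g(1)] \<delta>(1)]
    by (metis subset_UNIV)
  have smp: "smooth p" by (rule smooth_real_polynomial_function[OF p(1)])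
  have cp: "continuous_on {a..b} p"
    using smp smooth_has_derivative by (meson DERIV_continuous_on has_field_derivative_at_within)
  have pL: "p \<in> L2_on {a<..<b}" by (rule continuous_L2_on[OF cp])
  have gp: "?N (\<lambda>x. g x - p x) < e / 4"
  proof (rule le_less_trans[OF L2_norm_uniform_bound \<delta>(2)])
    show "(\<lambda>x. g x - p x) \<in> borel_measurable (lebesgue_on {a<..<b})"
      by (rule L2_onD[OF L2_on_diff[OF gL pL]])
  qed (use ab p(2) \<delta>(1) in \<open>auto intro: less_imp_le\<close>)
  obtain \<kappa> :: "nat \<Rightarrow> real \<Rightarrow> real" where \<kappa>: "\<And>n. test_function_on {a<..<b} (\<kappa> n)"
    "\<And>n x. 0 \<le> \<kappa> n x" "\<And>n x. \<kappa> n x \<le> 1"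
    "\<And>x. x \<in> {a<..<b} \<Longrightarrow> (\<lambda>n. \<kappa> n x) \<longlonglongrightarrow> 1"
    using smooth_cutoff[OF ab] by blast
  have tf: "test_function_on {a<..<b} (\<lambda>x. p x * \<kappa> m x)" for m
    by (rule test_function_mult[OF smp \<kappa>(1)])
  have "\<exists>m. ?N (\<lambda>x. p x - p x * \<kappa> m x) < e / 4"
  proof (rule L2_dominated_approx[OF pL _ L2_onD(2)[OF pL] _ _ e4])
    show "(\<lambda>x. p x * \<kappa> m x) \<in> borel_measurable (lebesgue_on {a<..<b})" for m
      by (rule L2_onD(1)[OF test_function_L2_on[OF tf]])
    show "(p x - p x * \<kappa> m x)\<^sup>2 \<le> (p x)\<^sup>2" for m x
    proof -
      have "(p x - p x * \<kappa> m x)\<^sup>2 = (p x)\<^sup>2 * (1 - \<kappa> m x)\<^sup>2"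
        by (simp add: power2_eq_square algebra_simps)
      also have "\<dots> \<le> (p x)\<^sup>2 * 1"
        using \<kappa>(2)[of m x] \<kappa>(3)[of m x] by (intro mult_left_mono power_le_one) auto
      finally show ?thesis by simp
    qed
    show "AE x in lebesgue_on {a<..<b}. (\<lambda>m. p x * \<kappa> m x) \<longlonglongrightarrow> p x"
    proof (rule AE_I2)
      fix x assume "x \<in> space (lebesgue_on {a<..<b})"
      then have "(\<lambda>m. p x * \<kappa> m x) \<longlonglongrightarrow> p x * 1" by (intro tendsto_intros \<kappa>) simp
      then show "(\<lambda>m. p x * \<kappa> m x) \<longlonglongrightarrow> p x" by simp
    qed
  qed
  then obtain m where m: "?N (\<lambda>x. p x - p x * \<kappa> m x) < e / 4" by blast
  have f1L: "f1 \<in> L2_on {a<..<b}" using n(1) by (simp add: f1_def)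
  have "?N (\<lambda>x. f x - p x * \<kappa> m x) < e"
    using L2_norm_triangle_diff[OF f f1L test_function_L2_on[OF tf[of m]]]
      L2_norm_triangle_diff[OF f1L gL test_function_L2_on[OF tf[of m]]]
      L2_norm_triangle_diff[OF gL pL test_function_L2_on[OF tf[of m]]]
      n(2) g(2) gp m
    unfolding f1_def by linarith
  with tf that show ?thesis by blast
qed

section \<open>Weak derivatives on an interval\<close>

lemma L2_on_const: "(\<lambda>x. c) \<in> L2_on {a<..<b::real}"
  by (rule continuous_L2_on) simp

lemma L2_on_integrable: "f \<in> L2_on {a<..<b::real} \<Longrightarrow> integrable (lebesgue_on {a<..<b}) f"
  using L2_on_mult_integrable[OF _ L2_on_const[of 1]] by simp

lemma L2_on_integrable_on: "f \<in> L2_on {a<..<b::real} \<Longrightarrow> f integrable_on {a..b}"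
  using integral_lebesgue_on_Ioo[OF L2_on_integrable] by blast

lemma LINT_continuous:
  fixes f :: "real \<Rightarrow> real"
  shows "continuous_on {a..b} f \<Longrightarrow> integral\<^sup>L (lebesgue_on {a<..<b}) f = integral {a..b} f"
  by (rule integral_unique[symmetric, OF integral_lebesgue_on_Ioo[OF integrable_lebesgue_on_Ioo]])

lemma LINT_cong_ae:
  assumes "ae_eq_on \<Omega> f g" "f \<in> L2_on \<Omega>" "g \<in> L2_on \<Omega>" "\<phi> \<in> L2_on \<Omega>"
  shows "integral\<^sup>L (lebesgue_on \<Omega>) (\<lambda>x. f x * \<phi> x) = integral\<^sup>L (lebesgue_on \<Omega>) (\<lambda>x. g x * \<phi> x)"
  using assms by (intro Bochner_Integration.integral_cong_AE borel_measurable_times L2_onD(1))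
    (auto simp: ae_eq_on_def elim: eventually_mono)

lemma test_function_derivs: "test_function_on \<Omega> \<phi> \<Longrightarrow> test_function_on \<Omega> ((deriv ^^ k) \<phi>)"
  by (induction k) (auto intro: test_function_deriv)

text \<open>For a test function \<open>\<phi>\<close> within \<open>e\<close> of \<open>h\<close>,
  orthogonality gives \<open>|h|^2 = <h, h - \<phi>> \<le> |h| e\<close>.\<close>

lemma orthogonal_test_functions_ae_zero:
  assumes ab: "a < b" and h: "h \<in> L2_on {a<..<b::real}"
    and 0: "\<And>\<phi>. test_function_on {a<..<b} \<phi> \<Longrightarrow>
      integral\<^sup>L (lebesgue_on {a<..<b}) (\<lambda>x. h x * \<phi> x) = 0"
  shows "ae_eq_on {a<..<b} h (\<lambda>x. 0)"
proof -
  let ?N = "L2_norm_on {a<..<b}"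
  have "?N h \<le> e" if e: "0 < e" for e
  proof -
    obtain \<phi> where \<phi>: "test_function_on {a<..<b} \<phi>" "?N (\<lambda>x. h x - \<phi> x) < e"
      using test_functions_dense_L2[OF ab h e] by blast
    note \<phi>L = test_function_L2_on[OF \<phi>(1)]
    have "(?N h)\<^sup>2 = integral\<^sup>L (lebesgue_on {a<..<b}) (\<lambda>x. h x * (h x - \<phi> x) + h x * \<phi> x)"
      unfolding L2_norm_square by (simp add: power2_eq_square algebra_simps)
    also have "\<dots> = integral\<^sup>L (lebesgue_on {a<..<b}) (\<lambda>x. h x * (h x - \<phi> x))"
      using L2_on_mult_integrable[OF h L2_on_diff[OF h \<phi>L]] L2_on_mult_integrable[OF h \<phi>L] 0[OF \<phi>(1)]
      by (subst Bochner_Integration.integral_add) auto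
    also have "\<dots> \<le> ?N h * ?N (\<lambda>x. h x - \<phi> x)"
      using L2_Cauchy_Schwarz[OF h L2_on_diff[OF h \<phi>L]] by linarith
    also have "\<dots> \<le> ?N h * e"
      using \<phi>(2) by (intro mult_left_mono L2_norm_nonneg) auto
    finally have "?N h * ?N h \<le> ?N h * e" by (simp only: power2_eq_square)
    then show ?thesis
      using L2_norm_nonneg[of "{a<..<b}" h] e mult_le_cancel_left_pos[of "?N h" "?N h" e]
      by (cases "?N h = 0") simp_all
  qed
  then have "?N h \<le> 0" by (rule field_le_epsilon) auto
  then have "?N h = 0" using L2_norm_nonneg[of "{a<..<b}" h] by linarith
  then show ?thesis using L2_norm_eq_0_iff[OF h] by simp
qed

lemma has_weak_deriv_onD:
  assumes "has_weak_deriv_on \<Omega> k f g"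
  shows "f \<in> L2_on \<Omega>" "g \<in> L2_on \<Omega>"
    "\<And>\<phi>. test_function_on \<Omega> \<phi> \<Longrightarrow>
        integral\<^sup>L (lebesgue_on \<Omega>) (\<lambda>x. f x * (deriv ^^ k) \<phi> x) =
        (-1) ^ k * integral\<^sup>L (lebesgue_on \<Omega>) (\<lambda>x. g x * \<phi> x)"
  using assms by (auto simp: has_weak_deriv_on_def)

lemma has_weak_deriv_unique:
  assumes ab: "a < b" and g: "has_weak_deriv_on {a<..<b} k f g" and h: "has_weak_deriv_on {a<..<b} k f h"
  shows "ae_eq_on {a<..<b} g h"
proof -
  note gh = has_weak_deriv_onD[OF g] has_weak_deriv_onD[OF h]
  have "ae_eq_on {a<..<b} (\<lambda>x. g x - h x) (\<lambda>x. 0)"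
  proof (rule orthogonal_test_functions_ae_zero[OF ab L2_on_diff])
    fix \<phi> assume \<phi>: "test_function_on {a<..<b} \<phi>"
    show "integral\<^sup>L (lebesgue_on {a<..<b}) (\<lambda>x. (g x - h x) * \<phi> x) = 0"
      using gh(3)[OF \<phi>] gh(6)[OF \<phi>] L2_on_mult_integrable[OF gh(2) test_function_L2_on[OF \<phi>]]
        L2_on_mult_integrable[OF gh(5) test_function_L2_on[OF \<phi>]]
      by (simp add: left_diff_distrib)
  qed (use gh in auto)
  then show ?thesis by (simp add: ae_eq_on_def)
qed

lemma has_weak_deriv_cong:
  assumes w: "has_weak_deriv_on {a<..<b} k f g" and f': "f' \<in> L2_on {a<..<b}" "ae_eq_on {a<..<b} f f'"
    and g': "g' \<in> L2_on {a<..<b}" "ae_eq_on {a<..<b} g g'"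
  shows "has_weak_deriv_on {a<..<b::real} k f' g'"
  unfolding has_weak_deriv_on_def
proof (intro conjI allI impI f' g')
  fix \<phi> assume \<phi>: "test_function_on {a<..<b} \<phi>"
  note w = has_weak_deriv_onD[OF w]
  show "integral\<^sup>L (lebesgue_on {a<..<b}) (\<lambda>x. f' x * (deriv ^^ k) \<phi> x) =
        (-1) ^ k * integral\<^sup>L (lebesgue_on {a<..<b}) (\<lambda>x. g' x * \<phi> x)"
    using LINT_cong_ae[OF f'(2) w(1) f'(1) test_function_L2_on[OF test_function_derivs[OF \<phi>]]]
      LINT_cong_ae[OF g'(2) w(2) g'(1) test_function_L2_on[OF \<phi>]] w(3)[OF \<phi>] by simp
qed

lemma weak_deriv_on_ae:
  assumes "a < b" "has_weak_deriv_on {a<..<b} k f g"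
  shows "ae_eq_on {a<..<b} (weak_deriv_on {a<..<b} k f) g"
proof -
  have "has_weak_deriv_on {a<..<b} k f (weak_deriv_on {a<..<b} k f)"
    unfolding weak_deriv_on_def using assms(2) by (rule someI[of "has_weak_deriv_on {a<..<b} k f"])
  from has_weak_deriv_unique[OF assms(1) this assms(2)] show ?thesis .
qed

lemma has_weak_deriv_Suc:
  assumes f: "has_weak_deriv_on {a<..<b::real} 1 f f1" and f1: "has_weak_deriv_on {a<..<b} k f1 g"
  shows "has_weak_deriv_on {a<..<b} (Suc k) f g"
  unfolding has_weak_deriv_on_def
proof (intro conjI allI impI has_weak_deriv_onD[OF f] has_weak_deriv_onD[OF f1])
  fix \<phi> assume \<phi>: "test_function_on {a<..<b} \<phi>"
  show "integral\<^sup>L (lebesgue_on {a<..<b}) (\<lambda>x. f x * (deriv ^^ Suc k) \<phi> x) =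
    (-1) ^ Suc k * integral\<^sup>L (lebesgue_on {a<..<b}) (\<lambda>x. g x * \<phi> x)"
    using has_weak_deriv_onD(3)[OF f test_function_derivs[OF \<phi>, of k]]
      has_weak_deriv_onD(3)[OF f1 \<phi>] by simp
qed

text \<open>In \<open>sobolev_H\<close> the weak derivatives of different orders are given
  independently of each other. Testing the identity of order \<open>k\<close> with
  \<open>deriv \<phi>\<close> shows that they form a chain of first-order derivatives.\<close>

lemma has_weak_deriv_step:
  assumes f: "has_weak_deriv_on {a<..<b::real} k f g" and h: "has_weak_deriv_on {a<..<b} (Suc k) f h"
  shows "has_weak_deriv_on {a<..<b} 1 g h"
  unfolding has_weak_deriv_on_def
proof (intro conjI allI impI has_weak_deriv_onD[OF f] has_weak_deriv_onD[OF h])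
  fix \<phi> assume \<phi>: "test_function_on {a<..<b} \<phi>"
  have "(-1) ^ k * (integral\<^sup>L (lebesgue_on {a<..<b}) (\<lambda>x. g x * deriv \<phi> x)
      + integral\<^sup>L (lebesgue_on {a<..<b}) (\<lambda>x. h x * \<phi> x)) = 0"
    using has_weak_deriv_onD(3)[OF f test_function_deriv[OF \<phi>]]
      has_weak_deriv_onD(3)[OF h \<phi>]
    by (simp add: funpow_Suc_right distrib_left del: funpow.simps)
  then show "integral\<^sup>L (lebesgue_on {a<..<b}) (\<lambda>x. g x * (deriv ^^ 1) \<phi> x) =
    (-1) ^ 1 * integral\<^sup>L (lebesgue_on {a<..<b}) (\<lambda>x. h x * \<phi> x)"
    by simp
qed

lemma test_function_zero_ends:
  "test_function_on {a<..<b} \<phi> \<Longrightarrow> \<phi> a = 0 \<and> \<phi> b = 0"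
  unfolding test_function_on_iff by auto

lemma has_weak_deriv_C1:
  assumes ab: "a < b" and f: "\<And>x. x \<in> {a..b} \<Longrightarrow> (f has_real_derivative f1 x) (at x within {a..b})"
    and c: "continuous_on {a..b} f1"
  shows "has_weak_deriv_on {a<..<b} 1 f f1"
  unfolding has_weak_deriv_on_def
proof (intro conjI allI impI)
  have cf: "continuous_on {a..b} f" using f by (rule DERIV_continuous_on)
  show "f \<in> L2_on {a<..<b}" "f1 \<in> L2_on {a<..<b}" by (intro continuous_L2_on cf c)+
  fix \<phi> assume \<phi>: "test_function_on {a<..<b} \<phi>"
  have c1: "continuous_on {a..b} \<phi>" "continuous_on {a..b} (deriv \<phi>)"
    by (rule test_function_continuous[OF \<phi>],
        rule test_function_continuous[OF test_function_deriv[OF \<phi>]])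
  have d\<phi>: "(\<phi> has_real_derivative deriv \<phi> x) (at x within {a..b})" for x
    using \<phi> smooth_has_derivative by (auto simp: test_function_on_iff intro: has_field_derivative_at_within)
  have "((\<lambda>x. f x * deriv \<phi> x + f1 x * \<phi> x) has_integral (f b * \<phi> b - f a * \<phi> a)) {a..b}"
    using ab by (intro fundamental_theorem_of_calculus)
      (auto simp flip: has_real_derivative_iff_has_vector_derivative
        intro!: derivative_eq_intros f d\<phi>)
  then have "integral {a..b} (\<lambda>x. f x * deriv \<phi> x + f1 x * \<phi> x) = 0"
    using test_function_zero_ends[OF \<phi>] by (simp add: integral_unique)
  moreover have "integral {a..b} (\<lambda>x. f x * deriv \<phi> x + f1 x * \<phi> x) =
      integral {a..b} (\<lambda>x. f x * deriv \<phi> x) + integral {a..b} (\<lambda>x. f1 x * \<phi> x)"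
    by (intro Henstock_Kurzweil_Integration.integral_add integrable_continuous_real continuous_intros cf c c1)
  ultimately show "integral\<^sup>L (lebesgue_on {a<..<b}) (\<lambda>x. f x * (deriv ^^ 1) \<phi> x) =
      (-1) ^ 1 * integral\<^sup>L (lebesgue_on {a<..<b}) (\<lambda>x. f1 x * \<phi> x)"
    by (simp add: LINT_continuous cf c c1 continuous_on_mult)
qed

lemma test_function_unit_mass:
  assumes ab: "a < b"
  obtains \<eta> where "test_function_on {a<..<b} \<eta>" "integral {a..b} \<eta> = (1::real)"
proof -
  obtain \<kappa> :: "nat \<Rightarrow> real \<Rightarrow> real" where \<kappa>: "\<And>n. test_function_on {a<..<b} (\<kappa> n)"
    "\<And>n x. 0 \<le> \<kappa> n x" "\<And>x. x \<in> {a<..<b} \<Longrightarrow> (\<lambda>n. \<kappa> n x) \<longlonglongrightarrow> 1"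
    using smooth_cutoff[OF ab] by metis
  define m where "m = (a + b) / 2"
  have m: "m \<in> {a<..<b}" using ab by (auto simp: m_def)
  have "\<forall>\<^sub>F n in sequentially. 0 < \<kappa> n m"
    using \<kappa>(3)[OF m] by (rule order_tendstoD) simp
  then obtain n where n: "0 < \<kappa> n m" by (auto simp: eventually_sequentially)
  have c: "continuous_on {a..b} (\<kappa> n)" by (rule test_function_continuous[OF \<kappa>(1)])
  define I where "I = integral {a..b} (\<kappa> n)"
  have "I \<noteq> 0"
    unfolding I_def using integral_eq_0_iff[OF c ab] \<kappa>(2) n m by (auto simp: less_le)
  have "integral {a..b} (\<lambda>x. (1 / I) * \<kappa> n x) = 1"
    using \<open>I \<noteq> 0\<close> by (simp only: Henstock_Kurzweil_Integration.integral_mult_right I_def[symmetric]) simp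
  then show ?thesis using test_function_cmult[OF \<kappa>(1)] that by blast
qed

text \<open>Du Bois-Reymond: removing from \<open>\<phi>\<close> the multiple of
  \<open>\<eta>\<close> with the same integral leaves the derivative of a test function. So
  \<open>h - c\<close>, where \<open>c\<close> is the integral of \<open>h * \<eta>\<close>, is
  orthogonal to all test functions.\<close>

lemma weak_deriv_zero_imp_const:
  assumes ab: "a < b" and h: "h \<in> L2_on {a<..<b::real}"
    and 0: "\<And>\<phi>. test_function_on {a<..<b} \<phi> \<Longrightarrow>
      integral\<^sup>L (lebesgue_on {a<..<b}) (\<lambda>x. h x * deriv \<phi> x) = 0"
  shows "\<exists>c. ae_eq_on {a<..<b} h (\<lambda>x. c)"
proof -
  let ?I = "integral\<^sup>L (lebesgue_on {a<..<b})"
  obtain \<eta> where \<eta>: "test_function_on {a<..<b} \<eta>" "integral {a..b} \<eta> = 1"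
    using test_function_unit_mass[OF ab] by blast
  define c where "c = ?I (\<lambda>x. h x * \<eta> x)"
  have "ae_eq_on {a<..<b} (\<lambda>x. h x - c) (\<lambda>x. 0)"
  proof (rule orthogonal_test_functions_ae_zero[OF ab])
    show "(\<lambda>x. h x - c) \<in> L2_on {a<..<b}" by (intro L2_on_intros h L2_on_const)
    fix \<phi> assume \<phi>: "test_function_on {a<..<b} \<phi>"
    define m where "m = integral {a..b} \<phi>"
    have t: "test_function_on {a<..<b} (\<lambda>x. \<phi> x + (- m) * \<eta> x)"
      by (intro test_function_add \<phi> test_function_cmult \<eta>)
    have cont: "continuous_on {a..b} \<phi>" "continuous_on {a..b} \<eta>"
      by (rule test_function_continuous[OF \<phi>], rule test_function_continuous[OF \<eta>(1)])
    have "integral {a..b} (\<lambda>x. \<phi> x + (- m) * \<eta> x) = m + (- m) * 1"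
      unfolding m_def \<eta>(2)[symmetric]
      by (subst Henstock_Kurzweil_Integration.integral_add)
        (auto intro!: integrable_continuous_real continuous_intros cont)
    then have "integral {a..b} (\<lambda>x. \<phi> x + (- m) * \<eta> x) = 0" by simp
    from smooth_antiderivative_test_function[OF ab t this] obtain \<Phi> where
      \<Phi>: "test_function_on {a<..<b} \<Phi>" "deriv \<Phi> = (\<lambda>x. \<phi> x + (- m) * \<eta> x)" by blast
    note i1 = L2_on_mult_integrable[OF h test_function_L2_on[OF \<phi>]]
      and i2 = L2_on_mult_integrable[OF h test_function_L2_on[OF \<eta>(1)]]
      and i3 = integrable_lebesgue_on_Ioo[OF cont(1)]
    have "?I (\<lambda>x. h x * \<phi> x - m * (h x * \<eta> x)) = 0"
      using 0[OF \<Phi>(1)] \<Phi>(2) by (simp add: algebra_simps)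
    then have "?I (\<lambda>x. h x * \<phi> x) = m * c"
      using i1 i2 by (simp add: c_def)
    moreover have "?I \<phi> = m" by (simp add: m_def LINT_continuous cont)
    ultimately show "?I (\<lambda>x. (h x - c) * \<phi> x) = 0"
      using i1 i3 by (simp add: left_diff_distrib)
  qed
  then show ?thesis by (auto simp: ae_eq_on_def)
qed

lemma L1_le_L2:
  assumes ab: "a \<le> b" and f: "f \<in> L2_on {a<..<b::real}"
  shows "integral\<^sup>L (lebesgue_on {a<..<b}) (\<lambda>x. \<bar>f x\<bar>) \<le> sqrt (b - a) * L2_norm_on {a<..<b} f"
proof -
  have f': "(\<lambda>x. \<bar>f x\<bar>) \<in> L2_on {a<..<b}"
    using L2_onD[OF f] by (intro L2_onI borel_measurable_abs) auto
  have "integral\<^sup>L (lebesgue_on {a<..<b}) (\<lambda>x. \<bar>f x\<bar>) \<le>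
      L2_norm_on {a<..<b} (\<lambda>x. 1) * L2_norm_on {a<..<b} (\<lambda>x. \<bar>f x\<bar>)"
    using L2_Cauchy_Schwarz[OF L2_on_const[of 1] f'] by simp
  also have "L2_norm_on {a<..<b} (\<lambda>x. \<bar>f x\<bar>) = L2_norm_on {a<..<b} f"
    by (simp add: L2_norm_on_def)
  also have "L2_norm_on {a<..<b} (\<lambda>x. 1) \<le> 1 * sqrt (b - a)"
    using ab by (intro L2_norm_uniform_bound) auto
  finally show ?thesis by (simp add: mult_right_mono L2_norm_nonneg)
qed

lemma integral_Icc_abs_bound:
  assumes f: "f \<in> L2_on {a<..<b::real}" and cd: "a \<le> c" "c \<le> d" "d \<le> b"
  shows "\<bar>integral {c..d} f\<bar> \<le> sqrt (b - a) * L2_norm_on {a<..<b} f"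
proof -
  have f': "(\<lambda>x. \<bar>f x\<bar>) \<in> L2_on {a<..<b}"
    using L2_onD[OF f] by (intro L2_onI borel_measurable_abs) auto
  have sub: "{c..d} \<subseteq> {a..b}" using cd by auto
  have i: "f integrable_on {a..b}" "(\<lambda>x. \<bar>f x\<bar>) integrable_on {a..b}"
    by (intro L2_on_integrable_on f f')+
  have i': "f integrable_on {c..d}" "(\<lambda>x. \<bar>f x\<bar>) integrable_on {c..d}"
    using i sub by (auto intro: integrable_on_subinterval)
  have "\<bar>integral {c..d} f\<bar> \<le> integral {c..d} (\<lambda>x. \<bar>f x\<bar>)"
    using integral_norm_bound_integral[OF i'] by simp
  also have "\<dots> \<le> integral {a..b} (\<lambda>x. \<bar>f x\<bar>)"
    by (rule integral_subset_le[OF sub i'(2) i(2)]) simp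
  also have "\<dots> = integral\<^sup>L (lebesgue_on {a<..<b}) (\<lambda>x. \<bar>f x\<bar>)"
    by (rule integral_unique[OF integral_lebesgue_on_Ioo[OF L2_on_integrable[OF f']]])
  also have "\<dots> \<le> sqrt (b - a) * L2_norm_on {a<..<b} f"
    using cd by (intro L1_le_L2 f) auto
  finally show ?thesis .
qed

text \<open>By density it suffices to integrate by parts against primitives of test functions.\<close>

lemma integral_by_parts_primitive:
  assumes ab: "a < b" and g: "g \<in> L2_on {a<..<b::real}" and \<phi>: "test_function_on {a<..<b} \<phi>"
  shows "integral\<^sup>L (lebesgue_on {a<..<b}) (\<lambda>x. integral {a..x} g * deriv \<phi> x) =
    - integral\<^sup>L (lebesgue_on {a<..<b}) (\<lambda>x. g x * \<phi> x)"
proof -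
  let ?N = "L2_norm_on {a<..<b}" and ?I = "integral\<^sup>L (lebesgue_on {a<..<b})"
  let ?G = "\<lambda>x. integral {a..x} g"
  have cG: "continuous_on {a..b} ?G"
    by (rule indefinite_integral_continuous_1[OF L2_on_integrable_on[OF g]])
  define B where "B = (b - a) * ?N (deriv \<phi>) + ?N \<phi>"
  have bound: "\<bar>?I (\<lambda>x. ?G x * deriv \<phi> x) + ?I (\<lambda>x. g x * \<phi> x)\<bar> \<le> e * B" if e: "0 < e" for e
  proof -
    obtain h where h: "test_function_on {a<..<b} h" "?N (\<lambda>x. g x - h x) < e"
      using test_functions_dense_L2[OF ab g e] by blast
    note hL = test_function_L2_on[OF h(1)]
    note \<phi>L = test_function_L2_on[OF \<phi>] test_function_L2_on[OF test_function_deriv[OF \<phi>]]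
    have ch: "continuous_on {a..b} h" by (rule test_function_continuous[OF h(1)])
    let ?H = "\<lambda>x. integral {a..x} h"
    have cH: "continuous_on {a..b} ?H"
      by (rule indefinite_integral_continuous_1[OF L2_on_integrable_on[OF hL]])
    have "has_weak_deriv_on {a<..<b} 1 ?H h"
      by (rule has_weak_deriv_C1[OF ab integral_has_real_derivative[OF ch] ch])
    from has_weak_deriv_onD(3)[OF this \<phi>]
    have eq: "?I (\<lambda>x. ?H x * deriv \<phi> x) = - ?I (\<lambda>x. h x * \<phi> x)" by simp
    have GHL: "(\<lambda>x. ?G x - ?H x) \<in> L2_on {a<..<b}"
      by (intro continuous_L2_on continuous_intros cG cH)
    have ghL: "(\<lambda>x. g x - h x) \<in> L2_on {a<..<b}" by (intro L2_on_diff g hL)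
    have pt: "\<bar>?G x - ?H x\<bar> \<le> sqrt (b - a) * e" if x: "x \<in> {a<..<b}" for x
    proof -
      have "?G x - ?H x = integral {a..x} (\<lambda>x. g x - h x)"
        by (rule Henstock_Kurzweil_Integration.integral_diff[symmetric])
          (use x in \<open>auto intro: integrable_on_subinterval[OF L2_on_integrable_on[OF g]]
            integrable_on_subinterval[OF L2_on_integrable_on[OF hL]]\<close>)
      also have "\<bar>\<dots>\<bar> \<le> sqrt (b - a) * ?N (\<lambda>x. g x - h x)"
        using x by (intro integral_Icc_abs_bound ghL) auto
      also have "\<dots> \<le> sqrt (b - a) * e"
        using h(2) ab by (intro mult_left_mono) auto
      finally show ?thesis .
    qed
    have NGH: "?N (\<lambda>x. ?G x - ?H x) \<le> (b - a) * e"
      using L2_norm_uniform_bound[OF less_imp_le[OF ab] L2_onD(1)[OF GHL] pt] ab e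
      by (simp add: algebra_simps flip: power2_eq_square)
    have i: "integrable (lebesgue_on {a<..<b}) (\<lambda>x. ?G x * deriv \<phi> x)"
      "integrable (lebesgue_on {a<..<b}) (\<lambda>x. ?H x * deriv \<phi> x)"
      "integrable (lebesgue_on {a<..<b}) (\<lambda>x. g x * \<phi> x)"
      "integrable (lebesgue_on {a<..<b}) (\<lambda>x. h x * \<phi> x)"
      by (rule L2_on_mult_integrable[OF continuous_L2_on[OF cG] \<phi>L(2)]
          L2_on_mult_integrable[OF continuous_L2_on[OF cH] \<phi>L(2)]
          L2_on_mult_integrable[OF g \<phi>L(1)] L2_on_mult_integrable[OF hL \<phi>L(1)])+
    have split: "?I (\<lambda>x. ?G x * deriv \<phi> x) + ?I (\<lambda>x. g x * \<phi> x) =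
        ?I (\<lambda>x. (?G x - ?H x) * deriv \<phi> x) + ?I (\<lambda>x. (g x - h x) * \<phi> x)"
      using i eq by (simp add: left_diff_distrib)
    have "\<bar>?I (\<lambda>x. ?G x * deriv \<phi> x) + ?I (\<lambda>x. g x * \<phi> x)\<bar>
        \<le> ?N (\<lambda>x. ?G x - ?H x) * ?N (deriv \<phi>) + ?N (\<lambda>x. g x - h x) * ?N \<phi>"
      unfolding split
      by (rule order_trans[OF abs_triangle_ineq
          add_mono[OF L2_Cauchy_Schwarz[OF GHL \<phi>L(2)] L2_Cauchy_Schwarz[OF ghL \<phi>L(1)]]])
    also have "\<dots> \<le> (b - a) * e * ?N (deriv \<phi>) + e * ?N \<phi>"
      by (rule add_mono[OF mult_right_mono[OF NGH L2_norm_nonneg]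
          mult_right_mono[OF less_imp_le[OF h(2)] L2_norm_nonneg]])
    also have "\<dots> = e * B" unfolding B_def by (simp only: distrib_left mult_ac)
    finally show ?thesis .
  qed
  have B: "0 \<le> B" unfolding B_def using ab by (auto intro!: add_nonneg_nonneg mult_nonneg_nonneg L2_norm_nonneg)
  have "\<bar>?I (\<lambda>x. ?G x * deriv \<phi> x) + ?I (\<lambda>x. g x * \<phi> x)\<bar> \<le> 0"
  proof (rule field_le_epsilon)
    fix e :: real assume "0 < e"
    then show "\<bar>?I (\<lambda>x. ?G x * deriv \<phi> x) + ?I (\<lambda>x. g x * \<phi> x)\<bar> \<le> 0 + e"
      using bound[of "e / (B + 1)"] B mult_left_mono[of B "B + 1" "e / (B + 1)"] by auto
  qed
  then show ?thesis by simp
qed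

text \<open>The difference of \<open>f\<close> and the primitive of \<open>g\<close> has weak
  derivative zero and is therefore constant. This is the embedding of H^1 into the continuous
  functions on the closed interval.\<close>

lemma has_weak_deriv_1_representative:
  assumes ab: "a < b" and w: "has_weak_deriv_on {a<..<b::real} 1 f g"
  obtains c where "ae_eq_on {a<..<b} f (\<lambda>x. c + integral {a..x} g)"
    "continuous_on {a..b} (\<lambda>x. c + integral {a..x} g)"
proof -
  let ?G = "\<lambda>x. integral {a..x} g"
  note fg = has_weak_deriv_onD[OF w]
  have cG: "continuous_on {a..b} ?G"
    by (rule indefinite_integral_continuous_1[OF L2_on_integrable_on[OF fg(2)]])
  have GL: "?G \<in> L2_on {a<..<b}" by (rule continuous_L2_on[OF cG])
  have "\<exists>c. ae_eq_on {a<..<b} (\<lambda>x. f x - ?G x) (\<lambda>x. c)"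
  proof (rule weak_deriv_zero_imp_const[OF ab])
    fix \<phi> assume \<phi>: "test_function_on {a<..<b} \<phi>"
    note \<phi>L = test_function_L2_on[OF test_function_deriv[OF \<phi>]]
    show "integral\<^sup>L (lebesgue_on {a<..<b}) (\<lambda>x. (f x - ?G x) * deriv \<phi> x) = 0"
      using integral_by_parts_primitive[OF ab fg(2) \<phi>] fg(3)[OF \<phi>]
        L2_on_mult_integrable[OF fg(1) \<phi>L] L2_on_mult_integrable[OF GL \<phi>L]
      by (simp add: left_diff_distrib)
  qed (intro L2_on_diff fg GL)
  then obtain c where "ae_eq_on {a<..<b} (\<lambda>x. f x - ?G x) (\<lambda>x. c)" by blast
  then have "ae_eq_on {a<..<b} f (\<lambda>x. c + ?G x)"
    unfolding ae_eq_on_def by (rule AE_mp) (auto simp: algebra_simps)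
  with that cG show ?thesis by (simp add: continuous_on_add)
qed

section \<open>The domain of the operator\<close>

text \<open>The classical part of the domain of \<open>A\<close>: class C^3 up to the boundary,
  together with the three boundary conditions. The derivatives are carried as explicit functions,
  which keeps choices of representatives out of the calculus.\<close>

definition dom3 :: "real \<Rightarrow> (real \<Rightarrow> real) \<Rightarrow> (real \<Rightarrow> real) \<Rightarrow> (real \<Rightarrow> real) \<Rightarrow> (real \<Rightarrow> real) \<Rightarrow> bool"
  where
  "dom3 L F F1 F2 F3 \<longleftrightarrow>
     (\<forall>x\<in>{-L..L}. (F has_real_derivative F1 x) (at x within {-L..L})) \<and>
     (\<forall>x\<in>{-L..L}. (F1 has_real_derivative F2 x) (at x within {-L..L})) \<and>
     (\<forall>x\<in>{-L..L}. (F2 has_real_derivative F3 x) (at x within {-L..L})) \<and>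
     continuous_on {-L..L} F3 \<and> F (-L) = 0 \<and> F L = 0 \<and> F1 L = 0"

lemma dom3D:
  assumes "dom3 L F F1 F2 F3"
  shows "\<And>x. x \<in> {-L..L} \<Longrightarrow> (F has_real_derivative F1 x) (at x within {-L..L})"
    "\<And>x. x \<in> {-L..L} \<Longrightarrow> (F1 has_real_derivative F2 x) (at x within {-L..L})"
    "\<And>x. x \<in> {-L..L} \<Longrightarrow> (F2 has_real_derivative F3 x) (at x within {-L..L})"
    "continuous_on {-L..L} F" "continuous_on {-L..L} F1" "continuous_on {-L..L} F2"
    "continuous_on {-L..L} F3" "F (-L) = 0" "F L = 0" "F1 L = 0"
proof -
  show d: "\<And>x. x \<in> {-L..L} \<Longrightarrow> (F has_real_derivative F1 x) (at x within {-L..L})"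
    "\<And>x. x \<in> {-L..L} \<Longrightarrow> (F1 has_real_derivative F2 x) (at x within {-L..L})"
    "\<And>x. x \<in> {-L..L} \<Longrightarrow> (F2 has_real_derivative F3 x) (at x within {-L..L})"
    "continuous_on {-L..L} F3" "F (-L) = 0" "F L = 0" "F1 L = 0"
    using assms by (auto simp: dom3_def)
  show "continuous_on {-L..L} F" "continuous_on {-L..L} F1" "continuous_on {-L..L} F2"
    by (rule DERIV_continuous_on[OF d(1)] DERIV_continuous_on[OF d(2)] DERIV_continuous_on[OF d(3)]; simp)+
qed

lemma dom3_lincomb:
  assumes F: "dom3 L F F1 F2 F3" and G: "dom3 L G G1 G2 G3"
  shows "dom3 L (\<lambda>x. c * F x + d * G x) (\<lambda>x. c * F1 x + d * G1 x)
    (\<lambda>x. c * F2 x + d * G2 x) (\<lambda>x. c * F3 x + d * G3 x)"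
  unfolding dom3_def using dom3D(7-10)[OF F] dom3D(7-10)[OF G]
  by (auto intro!: derivative_eq_intros dom3D(1-3)[OF F] dom3D(1-3)[OF G] continuous_intros)

lemma dom3_continuous_op:
  "dom3 L F F1 F2 F3 \<Longrightarrow> continuous_on {-L..L} (\<lambda>x. F2 x - F3 x)"
  by (intro continuous_intros dom3D(6,7))

lemma dom3_has_weak_derivs:
  assumes L: "0 < L" and F: "dom3 L F F1 F2 F3"
    and f: "f \<in> L2_on {-L<..<L}" "ae_eq_on {-L<..<L} f F"
  shows "has_weak_deriv_on {-L<..<L} 1 f F1" "has_weak_deriv_on {-L<..<L} 2 f F2"
    "has_weak_deriv_on {-L<..<L} 3 f F3"
proof -
  have LL: "-L < L" using L by simp
  note d = dom3D[OF F]
  have w: "has_weak_deriv_on {-L<..<L} 1 F F1" "has_weak_deriv_on {-L<..<L} 1 F1 F2"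
    "has_weak_deriv_on {-L<..<L} 1 F2 F3"
    by (rule has_weak_deriv_C1[OF LL d(1) d(5)] has_weak_deriv_C1[OF LL d(2) d(6)]
        has_weak_deriv_C1[OF LL d(3) d(7)]; simp)+
  have w2: "has_weak_deriv_on {-L<..<L} 2 F F2"
    using has_weak_deriv_Suc[OF w(1,2)] by (simp add: numeral_2_eq_2)
  have w3: "has_weak_deriv_on {-L<..<L} 3 F F3"
    using has_weak_deriv_Suc[OF w(1) has_weak_deriv_Suc[OF w(2,3)]] by (simp add: numeral_3_eq_3)
  show "has_weak_deriv_on {-L<..<L} 1 f F1" "has_weak_deriv_on {-L<..<L} 2 f F2"
    "has_weak_deriv_on {-L<..<L} 3 f F3"
    by (rule has_weak_deriv_cong[OF w(1) f(1) ae_eq_on_sym[OF f(2)] _ ae_eq_on_refl]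
        has_weak_deriv_cong[OF w2 f(1) ae_eq_on_sym[OF f(2)] _ ae_eq_on_refl]
        has_weak_deriv_cong[OF w3 f(1) ae_eq_on_sym[OF f(2)] _ ae_eq_on_refl];
        rule continuous_L2_on[OF d(5)] continuous_L2_on[OF d(6)] continuous_L2_on[OF d(7)])+
qed

lemma dom3_weak_derivs_ae:
  assumes L: "0 < L" and F: "dom3 L F F1 F2 F3"
    and f: "f \<in> L2_on {-L<..<L}" "ae_eq_on {-L<..<L} f F"
  shows "ae_eq_on {-L<..<L} (weak_deriv_on {-L<..<L} 1 f) F1"
    "ae_eq_on {-L<..<L} (weak_deriv_on {-L<..<L} 2 f) F2"
    "ae_eq_on {-L<..<L} (weak_deriv_on {-L<..<L} 3 f) F3"
proof -
  have LL: "-L < L" using L by simp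
  show "ae_eq_on {-L<..<L} (weak_deriv_on {-L<..<L} 1 f) F1"
    "ae_eq_on {-L<..<L} (weak_deriv_on {-L<..<L} 2 f) F2"
    "ae_eq_on {-L<..<L} (weak_deriv_on {-L<..<L} 3 f) F3"
    by (rule weak_deriv_on_ae[OF LL] dom3_has_weak_derivs[OF assms])+
qed

lemma dom3_in_A_graph:
  assumes L: "0 < L" and F: "dom3 L F F1 F2 F3"
    and f: "f \<in> L2_on {-L<..<L}" "ae_eq_on {-L<..<L} f F"
    and g: "g \<in> L2_on {-L<..<L}" "ae_eq_on {-L<..<L} g (\<lambda>x. F2 x - F3 x)"
  shows "(f, g) \<in> A_graph L"
proof -
  have LL: "-L < L" using L by simp
  note d = dom3D[OF F] and w = dom3_has_weak_derivs[OF L F f] and v = dom3_weak_derivs_ae[OF L F f]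
  have "f \<in> sobolev_H 3 {-L<..<L}"
  proof -
    have "\<exists>g. has_weak_deriv_on {-L<..<L} j f g" if "j \<le> 3" for j
    proof -
      have "has_weak_deriv_on {-L<..<L} 0 f f" using f(1) by (simp add: has_weak_deriv_on_def)
      moreover have "j = 0 \<or> j = 1 \<or> j = 2 \<or> j = 3" using that by linarith
      ultimately show ?thesis using w by blast
    qed
    then show ?thesis using f(1) by (simp add: sobolev_H_def)
  qed
  moreover have "trace_on {-L<..<L} f (-L) = 0" "trace_on {-L<..<L} f L = 0"
    using trace_on_continuous[OF LL d(4) f(2)] d(8,9) L by auto
  moreover have "trace_on {-L<..<L} (weak_deriv_on {-L<..<L} 1 f) L = 0"
    using trace_on_continuous[OF LL d(5) v(1)] d(10) L by auto
  moreover have "ae_eq_on {-L<..<L} g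
      (\<lambda>x. weak_deriv_on {-L<..<L} 2 f x - weak_deriv_on {-L<..<L} 3 f x)"
    using g(2) v(2,3) unfolding ae_eq_on_def by eventually_elim simp
  ultimately show ?thesis using g(1) by (simp add: A_graph_def A_domain_def)
qed

lemma A_graphD:
  assumes L: "0 < L" and A: "(f, g) \<in> A_graph L"
  obtains f1 f2 f3 where "f \<in> L2_on {-L<..<L}" "g \<in> L2_on {-L<..<L}"
    "has_weak_deriv_on {-L<..<L} 1 f f1" "has_weak_deriv_on {-L<..<L} 1 f1 f2"
    "has_weak_deriv_on {-L<..<L} 1 f2 f3" "ae_eq_on {-L<..<L} g (\<lambda>x. f2 x - f3 x)"
    "trace_on {-L<..<L} f (-L) = 0" "trace_on {-L<..<L} f L = 0" "trace_on {-L<..<L} f1 L = 0"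
proof -
  have w: "has_weak_deriv_on {-L<..<L} j f (weak_deriv_on {-L<..<L} j f)" if "j \<le> 3" for j
  proof -
    have "\<exists>h. has_weak_deriv_on {-L<..<L} j f h"
      using A that by (auto simp: A_graph_def A_domain_def sobolev_H_def)
    then show ?thesis
      unfolding weak_deriv_on_def by (rule someI_ex[of "has_weak_deriv_on {-L<..<L} j f"])
  qed
  have "has_weak_deriv_on {-L<..<L} 1 (weak_deriv_on {-L<..<L} 1 f) (weak_deriv_on {-L<..<L} 2 f)"
    using has_weak_deriv_step[OF w[of 1]] w[of 2] by (simp add: numeral_2_eq_2)
  moreover have "has_weak_deriv_on {-L<..<L} 1 (weak_deriv_on {-L<..<L} 2 f) (weak_deriv_on {-L<..<L} 3 f)"
    using has_weak_deriv_step[OF w[of 2]] w[of 3] by (simp add: eval_nat_numeral)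
  ultimately show ?thesis
    using A w[of 1]
    by (intro that[of "weak_deriv_on {-L<..<L} 1 f" "weak_deriv_on {-L<..<L} 2 f"
          "weak_deriv_on {-L<..<L} 3 f"]) (auto simp: A_graph_def A_domain_def sobolev_H_def)
qed

lemma A_graph_continuous_representative:
  assumes L: "0 < L" and A: "(f, g) \<in> A_graph L"
  obtains F where "continuous_on {-L..L} F" "ae_eq_on {-L<..<L} f F"
proof -
  have LL: "-L < L" using L by simp
  from A_graphD[OF L A] obtain f1 where "has_weak_deriv_on {-L<..<L} 1 f f1" by blast
  from has_weak_deriv_1_representative[OF LL this] that show ?thesis by blast
qed

lemma has_weak_deriv_continuous_representative:
  assumes LL: "a < b" and w: "has_weak_deriv_on {a<..<b::real} 1 f g"
    and G: "continuous_on {a..b} G" "ae_eq_on {a<..<b} g G"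
  obtains F where "\<And>x. x \<in> {a..b} \<Longrightarrow> (F has_real_derivative G x) (at x within {a..b})"
    "continuous_on {a..b} F" "ae_eq_on {a<..<b} f F"
proof -
  have "has_weak_deriv_on {a<..<b} 1 f G"
    using has_weak_deriv_cong[OF w has_weak_deriv_onD(1)[OF w] ae_eq_on_refl continuous_L2_on[OF G(1)] G(2)] .
  from has_weak_deriv_1_representative[OF LL this] obtain c where
    c: "ae_eq_on {a<..<b} f (\<lambda>x. c + integral {a..x} G)"
      "continuous_on {a..b} (\<lambda>x. c + integral {a..x} G)" by blast
  show ?thesis
    by (rule that[OF _ c(2,1)])
      (auto intro!: derivative_eq_intros integral_has_real_derivative G(1))
qed

text \<open>Bootstrap: \<open>f2\<close> has a weak derivative and hence a continuous
  representative, so \<open>f3 = f2 - g\<close> has one as well. Then \<open>f2\<close>,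
  \<open>f1\<close> and \<open>f\<close> are successively primitives of continuous
  functions.\<close>

lemma A_graph_dom3:
  assumes L: "0 < L" and A: "(f, g) \<in> A_graph L"
    and G: "continuous_on {-L..L} G" "ae_eq_on {-L<..<L} g G"
  obtains F F1 F2 F3 where "dom3 L F F1 F2 F3" "ae_eq_on {-L<..<L} f F"
    "\<And>x. x \<in> {-L..L} \<Longrightarrow> F2 x - F3 x = G x"
proof -
  have LL: "-L < L" using L by simp
  obtain f1 f2 f3 where f: "f \<in> L2_on {-L<..<L}"
    and w: "has_weak_deriv_on {-L<..<L} 1 f f1" "has_weak_deriv_on {-L<..<L} 1 f1 f2"
    "has_weak_deriv_on {-L<..<L} 1 f2 f3" and gf: "ae_eq_on {-L<..<L} g (\<lambda>x. f2 x - f3 x)"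
    and tr: "trace_on {-L<..<L} f (-L) = 0" "trace_on {-L<..<L} f L = 0" "trace_on {-L<..<L} f1 L = 0"
    by (rule A_graphD[OF L A], rule that; assumption)
  obtain H where H: "continuous_on {-L..L} H" "ae_eq_on {-L<..<L} f2 H"
    using has_weak_deriv_1_representative[OF LL w(3)] by blast
  have f3: "ae_eq_on {-L<..<L} f3 (\<lambda>x. H x - G x)"
    using gf G(2) H(2) unfolding ae_eq_on_def by eventually_elim simp
  have cHG: "continuous_on {-L..L} (\<lambda>x. H x - G x)" by (intro continuous_on_diff H(1) G(1))
  obtain F2 where F2: "\<And>x. x \<in> {-L..L} \<Longrightarrow> (F2 has_real_derivative H x - G x) (at x within {-L..L})"
    "continuous_on {-L..L} F2" "ae_eq_on {-L<..<L} f2 F2"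
    by (rule has_weak_deriv_continuous_representative[OF LL w(3) cHG f3], rule that; simp)
  have HF2: "H x = F2 x" if "x \<in> {-L..L}" for x
    by (rule ae_eq_continuous[OF LL H(1) F2(2) ae_eq_on_trans[OF ae_eq_on_sym[OF H(2)] F2(3)] that])
  obtain F1 where F1: "\<And>x. x \<in> {-L..L} \<Longrightarrow> (F1 has_real_derivative F2 x) (at x within {-L..L})"
    "continuous_on {-L..L} F1" "ae_eq_on {-L<..<L} f1 F1"
    by (rule has_weak_deriv_continuous_representative[OF LL w(2) F2(2,3)], rule that; simp)
  obtain F where F: "\<And>x. x \<in> {-L..L} \<Longrightarrow> (F has_real_derivative F1 x) (at x within {-L..L})"
    "continuous_on {-L..L} F" "ae_eq_on {-L<..<L} f F"
    by (rule has_weak_deriv_continuous_representative[OF LL w(1) F1(2,3)], rule that; simp)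
  have "F (-L) = 0" "F L = 0" "F1 L = 0"
    using tr trace_on_continuous[OF LL F(2,3)] trace_on_continuous[OF LL F1(2,3)] L by simp_all
  moreover have "continuous_on {-L..L} (\<lambda>x. F2 x - G x)"
    by (intro continuous_on_diff F2(2) G(1))
  ultimately have "dom3 L F F1 F2 (\<lambda>x. F2 x - G x)"
    unfolding dom3_def using F(1) F1(1) F2(1) HF2 by simp
  then show ?thesis using F(3) by (intro that) auto
qed

lemma test_function_dom3:
  assumes "test_function_on {-L<..<L} \<phi>"
  shows "dom3 L \<phi> (deriv \<phi>) (deriv (deriv \<phi>)) (deriv (deriv (deriv \<phi>)))"
proof -
  note t = assms test_function_deriv[OF assms]
    test_function_deriv[OF test_function_deriv[OF assms]]
  have d: "(\<phi> has_real_derivative deriv \<phi> x) (at x within S)" if "test_function_on {-L<..<L} \<phi>" for \<phi> x S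
    using that smooth_has_derivative by (auto simp: test_function_on_iff intro: has_field_derivative_at_within)
  show ?thesis
    unfolding dom3_def
    using test_function_zero_ends[OF t(1)] test_function_zero_ends[OF t(2)]
      test_function_continuous[OF test_function_deriv[OF t(3)]]
      d[OF t(1)] d[OF t(2)] d[OF t(3)] by simp
qed

lemma real_derivative_bound_Icc:
  fixes f :: "real \<Rightarrow> real"
  assumes "\<And>z. z \<in> {a..b} \<Longrightarrow> (f has_real_derivative f' z) (at z within {a..b})"
    and "\<And>z. z \<in> {a..b} \<Longrightarrow> \<bar>f' z\<bar> \<le> B" and "x \<in> {a..b}" "y \<in> {a..b}"
  shows "\<bar>f x - f y\<bar> \<le> B * (b - a)"
proof -
  have "\<bar>f x - f y\<bar> \<le> B * \<bar>x - y\<bar>"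
    using field_differentiable_bound[of "{a..b}" f f' B x y] assms by auto
  also have "\<dots> \<le> B * (b - a)"
    using assms(2)[OF assms(3)] assms(3,4) by (intro mult_left_mono) auto
  finally show ?thesis .
qed

text \<open>By Rolle's theorem \<open>F2\<close> vanishes somewhere, and \<open>exp (- x) * F2 x\<close> has derivative
  \<open>- exp (- x) * (F2 x - F3 x)\<close>; so the graph norm of \<open>A\<close> controls \<open>F\<close> in \<open>C\<^sup>2\<close>.\<close>

lemma dom3_sup_bound:
  assumes L: "0 < L"
  obtains K where "0 < K" "\<And>F F1 F2 F3 x. dom3 L F F1 F2 F3 \<Longrightarrow> x \<in> {-L..L} \<Longrightarrow>
    \<bar>F x\<bar> \<le> K * L2_norm_on {-L<..<L} (\<lambda>x. F2 x - F3 x) \<and>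
    \<bar>F1 x\<bar> \<le> K * L2_norm_on {-L<..<L} (\<lambda>x. F2 x - F3 x) \<and>
    \<bar>F2 x\<bar> \<le> K * L2_norm_on {-L<..<L} (\<lambda>x. F2 x - F3 x)"
proof -
  let ?N = "L2_norm_on {-L<..<L}"
  \<comment> \<open>\<open>sqrt (2 * L)\<close> comes from comparing the L1 and L2 norms; one factor
    \<open>exp L\<close> bounds the integrating factor \<open>exp (- y)\<close> and the other its
    inverse.\<close>
  define K0 where "K0 = exp L * (sqrt (2 * L) * exp L)"
  have K0: "0 < K0" using L by (simp add: K0_def)
  define K where "K = K0 * (1 + 2 * L) * (1 + 2 * L)"
  have K: "K0 \<le> K" "K0 * (2 * L) \<le> K" "K0 * (2 * L) * (2 * L) \<le> K"
    using L K0 by (auto simp: K_def algebra_simps)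
  have "0 < K" using K0 K(1) by simp
  moreover have "\<bar>F x\<bar> \<le> K * ?N (\<lambda>x. F2 x - F3 x) \<and>
    \<bar>F1 x\<bar> \<le> K * ?N (\<lambda>x. F2 x - F3 x) \<and> \<bar>F2 x\<bar> \<le> K * ?N (\<lambda>x. F2 x - F3 x)"
    if F: "dom3 L F F1 F2 F3" and x: "x \<in> {-L..L}" for F F1 F2 F3 x
  proof -
    note d = dom3D[OF F]
    define n where "n = ?N (\<lambda>x. F2 x - F3 x)"
    have n: "0 \<le> n" by (simp add: n_def L2_norm_nonneg)
    \<comment> \<open>Rolle is used twice: \<open>F\<close> vanishes at both ends, which gives a
      zero \<open>\<xi>\<close> of \<open>F1\<close>, and \<open>F1\<close> also vanishes at
      \<open>L\<close>.\<close>
    have "\<exists>\<xi>\<in>{-L<..<L}. F L - F (-L) = F1 \<xi> * (L - - L)"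
      using mvt_simple[of "-L" L F "\<lambda>x. (*) (F1 x)"] d(1) L by (auto simp: has_field_derivative_def)
    then obtain \<xi> where \<xi>: "\<xi> \<in> {-L<..<L}" "F1 \<xi> = 0" using d(8,9) L by auto
    have d2: "(F1 has_real_derivative F2 y) (at y within {\<xi>..L})" if "y \<in> {\<xi>..L}" for y
      by (rule has_field_derivative_subset[OF d(2)]) (use that \<xi> in auto)
    have "\<exists>z\<in>{\<xi><..<L}. F1 L - F1 \<xi> = F2 z * (L - \<xi>)"
      using mvt_simple[of \<xi> L F1 "\<lambda>x. (*) (F2 x)"] d2 \<xi>(1) by (auto simp: has_field_derivative_def)
    then obtain x0 where "x0 \<in> {\<xi><..<L}" "F2 x0 = 0" using d(10) \<xi> by auto
    then have x0: "x0 \<in> {-L..L}" "F2 x0 = 0" using \<xi>(1) by auto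
    let ?h = "\<lambda>y. exp (- y) * (F2 y - F3 y)"
    have ch: "continuous_on {-L..L} ?h" by (intro continuous_intros d)
    have hL: "?h \<in> L2_on {-L<..<L}" by (rule continuous_L2_on[OF ch])
    have Nh: "?N ?h \<le> exp L * n"
    proof (rule power2_le_imp_le)
      have "(?N ?h)\<^sup>2 = integral {-L..L} (\<lambda>y. (?h y)\<^sup>2)" by (rule L2_norm_continuous[OF ch])
      also have "\<dots> \<le> integral {-L..L} (\<lambda>y. (exp L)\<^sup>2 * (F2 y - F3 y)\<^sup>2)"
        by (rule integral_le)
          (auto intro!: integrable_continuous_real continuous_intros d power_mono mult_right_mono
            simp: power_mult_distrib)
      also have "\<dots> = (exp L * n)\<^sup>2"
        by (simp add: power_mult_distrib n_def L2_norm_continuous[OF dom3_continuous_op[OF F]])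
      finally show "(?N ?h)\<^sup>2 \<le> (exp L * n)\<^sup>2" .
    qed (use n in auto)
    have F2: "\<bar>F2 y\<bar> \<le> K0 * n" if y: "y \<in> {-L..L}" for y
    proof -
      have ftc: "(?h has_integral - exp (- v) * F2 v - - exp (- u) * F2 u) {u..v}"
        if "u \<le> v" "u \<in> {-L..L}" "v \<in> {-L..L}" for u v
      proof (rule fundamental_theorem_of_calculus[OF that(1)])
        fix z assume z: "z \<in> {u..v}"
        have dz: "(F2 has_real_derivative F3 z) (at z within {u..v})"
          by (rule has_field_derivative_subset[OF d(3)]) (use that z in auto)
        show "((\<lambda>v. - exp (- v) * F2 v) has_vector_derivative ?h z) (at z within {u..v})"
          unfolding has_real_derivative_iff_has_vector_derivative[symmetric]
          by (auto intro!: derivative_eq_intros dz simp: algebra_simps)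
      qed
      have "\<bar>exp (- y) * F2 y\<bar> \<le> sqrt (L - - L) * ?N ?h"
      proof (cases "x0 \<le> y")
        case True
        from integral_unique[OF ftc[OF True x0(1) y]] x0(2)
          integral_Icc_abs_bound[OF hL, of x0 y] x0(1) y True
        show ?thesis by auto
      next
        case False
        from integral_unique[OF ftc[OF _ y x0(1)]] x0(2)
          integral_Icc_abs_bound[OF hL, of y x0] x0(1) y False
        show ?thesis by auto
      qed
      also have "\<dots> \<le> sqrt (2 * L) * (exp L * n)"
        using Nh L by (auto intro!: mult_left_mono)
      finally have "exp y * (exp (- y) * \<bar>F2 y\<bar>) \<le> exp y * (sqrt (2 * L) * (exp L * n))"
        by (auto simp: abs_mult)
      also have "exp y * (exp (- y) * \<bar>F2 y\<bar>) = \<bar>F2 y\<bar>"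
        by (simp add: exp_minus field_simps)
      also have "exp y * (sqrt (2 * L) * (exp L * n)) \<le> exp L * (sqrt (2 * L) * (exp L * n))"
        using y n L by (intro mult_right_mono) auto
      finally show ?thesis by (simp add: K0_def mult.assoc)
    qed
    have F1: "\<bar>F1 y\<bar> \<le> K0 * n * (2 * L)" if y: "y \<in> {-L..L}" for y
      using real_derivative_bound_Icc[OF d(2) F2 y, of L] d(10) L by auto
    have F0: "\<bar>F y\<bar> \<le> K0 * n * (2 * L) * (2 * L)" if y: "y \<in> {-L..L}" for y
      using real_derivative_bound_Icc[OF d(1) F1 y, of L] d(9) L by auto
    have "K0 * n \<le> K * n" "K0 * n * (2 * L) \<le> K * n" "K0 * n * (2 * L) * (2 * L) \<le> K * n"
      using mult_right_mono[OF K(1) n] mult_right_mono[OF K(2) n] mult_right_mono[OF K(3) n]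
      by (simp_all only: mult_ac)
    then show ?thesis
      using F2[OF x] F1[OF x] F0[OF x] unfolding n_def[symmetric] by linarith
  qed
  ultimately show ?thesis using that by blast
qed

section \<open>The semigroup\<close>

text \<open>The classical representatives of \<open>f\<close> and of its first three derivatives; meaningful only if
  \<open>Adom L 2 f\<close>, since \<open>f\<close> is of class \<open>C\<^sup>3\<close> once \<open>A f\<close> is continuous.\<close>

definition rep :: "real \<Rightarrow> (real \<Rightarrow> real) \<Rightarrow> nat \<Rightarrow> real \<Rightarrow> real" where
  "rep L f = (SOME R. dom3 L (R 0) (R 1) (R 2) (R 3) \<and> ae_eq_on {-L<..<L} f (R 0))"

text \<open>The domain of the \<open>n\<close>-th power of \<open>A\<close>, on the level of
  representatives.\<close>

primrec Adom :: "real \<Rightarrow> nat \<Rightarrow> (real \<Rightarrow> real) \<Rightarrow> bool" where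
  "Adom L 0 f \<longleftrightarrow> f \<in> L2_on {-L<..<L}"
| "Adom L (Suc n) f \<longleftrightarrow> (\<exists>g. (f, g) \<in> A_graph L \<and> Adom L n g)"

definition Aop :: "real \<Rightarrow> (real \<Rightarrow> real) \<Rightarrow> real \<Rightarrow> real" where
  "Aop L f = (SOME g. (f, g) \<in> A_graph L)"

lemma A_graph_L2: "(f, g) \<in> A_graph L \<Longrightarrow> f \<in> L2_on {-L<..<L} \<and> g \<in> L2_on {-L<..<L}"
  by (simp add: A_graph_def A_domain_def sobolev_H_def)

lemma Adom_L2: "Adom L n f \<Longrightarrow> f \<in> L2_on {-L<..<L}"
  by (cases n) (auto dest: A_graph_L2)

lemma A_graph_unique:
  assumes "(f, g) \<in> A_graph L" "(f, g') \<in> A_graph L"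
  shows "ae_eq_on {-L<..<L} g g'"
proof -
  have "ae_eq_on {-L<..<L} g (\<lambda>x. weak_deriv_on {-L<..<L} 2 f x - weak_deriv_on {-L<..<L} 3 f x)"
    "ae_eq_on {-L<..<L} g' (\<lambda>x. weak_deriv_on {-L<..<L} 2 f x - weak_deriv_on {-L<..<L} 3 f x)"
    using assms by (simp_all add: A_graph_def)
  then show ?thesis by (blast intro: ae_eq_on_trans ae_eq_on_sym)
qed

lemma Aop_graph: "(f, g) \<in> A_graph L \<Longrightarrow> (f, Aop L f) \<in> A_graph L"
  unfolding Aop_def by (rule someI[of "\<lambda>g. (f, g) \<in> A_graph L"])

text \<open>The semigroup laws hold only almost everywhere, so membership in the graph has to
  survive a change of representative. Weak derivatives and traces depend only on the class.\<close>

lemma A_graph_cong_left: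
  assumes L: "0 < L" and A: "(f, g) \<in> A_graph L" and f': "f' \<in> L2_on {-L<..<L}" "ae_eq_on {-L<..<L} f f'"
  shows "(f', g) \<in> A_graph L"
proof -
  have LL: "-L < L" using L by simp
  have w: "has_weak_deriv_on {-L<..<L} j f' (weak_deriv_on {-L<..<L} j f)" if j: "j \<le> 3" for j
  proof -
    have "\<exists>h. has_weak_deriv_on {-L<..<L} j f h"
      using A j by (auto simp: A_graph_def A_domain_def sobolev_H_def)
    then have w: "has_weak_deriv_on {-L<..<L} j f (weak_deriv_on {-L<..<L} j f)"
      unfolding weak_deriv_on_def by (rule someI_ex[of "has_weak_deriv_on {-L<..<L} j f"])
    show ?thesis
      by (rule has_weak_deriv_cong[OF w f' has_weak_deriv_onD(2)[OF w] ae_eq_on_refl])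
  qed
  have ae: "ae_eq_on {-L<..<L} (weak_deriv_on {-L<..<L} j f') (weak_deriv_on {-L<..<L} j f)"
    if "j \<le> 3" for j
    by (rule weak_deriv_on_ae[OF LL w[OF that]])
  have tr: "trace_on {-L<..<L} p = trace_on {-L<..<L} q" if "ae_eq_on {-L<..<L} p q" for p q
  proof -
    have "ae_eq_on {-L<..<L} p h \<longleftrightarrow> ae_eq_on {-L<..<L} q h" for h
      using that by (blast intro: ae_eq_on_sym ae_eq_on_trans)
    then show ?thesis unfolding trace_on_def by simp
  qed
  have "f' \<in> A_domain L"
  proof -
    have "\<forall>j\<le>3. \<exists>g. has_weak_deriv_on {-L<..<L} j f' g" using w by blast
    then show ?thesis
      using A f'(1) tr[OF f'(2)] tr[OF ae[of 1]] by (simp add: A_graph_def A_domain_def sobolev_H_def)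
  qed
  moreover have "ae_eq_on {-L<..<L} g
      (\<lambda>x. weak_deriv_on {-L<..<L} 2 f' x - weak_deriv_on {-L<..<L} 3 f' x)"
  proof -
    have "ae_eq_on {-L<..<L} g (\<lambda>x. weak_deriv_on {-L<..<L} 2 f x - weak_deriv_on {-L<..<L} 3 f x)"
      using A by (simp add: A_graph_def)
    then show ?thesis using ae[of 2] ae[of 3] unfolding ae_eq_on_def by (auto elim: eventually_elim2)
  qed
  ultimately show ?thesis using A by (simp add: A_graph_def)
qed

lemma Adom_mono: "Adom L n f \<Longrightarrow> m \<le> n \<Longrightarrow> Adom L m f"
proof (induction n arbitrary: m f)
  case (Suc n)
  then show ?case by (cases m) (auto dest: A_graph_L2)
qed simp

lemma Adom_cong:
  assumes "0 < L" "Adom L n f" "f' \<in> L2_on {-L<..<L}" "ae_eq_on {-L<..<L} f f'"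
  shows "Adom L n f'"
  using assms by (cases n) (auto intro: A_graph_cong_left)

lemma Adom_Aop:
  assumes "0 < L" "Adom L (Suc n) f"
  shows "(f, Aop L f) \<in> A_graph L" "Adom L n (Aop L f)"
proof -
  obtain g where g: "(f, g) \<in> A_graph L" "Adom L n g" using assms(2) by auto
  show 1: "(f, Aop L f) \<in> A_graph L" by (rule Aop_graph[OF g(1)])
  show "Adom L n (Aop L f)"
    using Adom_cong[OF assms(1) g(2) _ A_graph_unique[OF g(1) 1]] A_graph_L2[OF 1] by simp
qed

lemma rep_dom3:
  assumes L: "0 < L" and f: "Adom L 2 f"
  shows "dom3 L (rep L f 0) (rep L f 1) (rep L f 2) (rep L f 3)" "ae_eq_on {-L<..<L} f (rep L f 0)"
proof -
  obtain g h where A: "(f, g) \<in> A_graph L" "(g, h) \<in> A_graph L"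
    using f by (auto simp: numeral_2_eq_2)
  obtain G where G: "continuous_on {-L..L} G" "ae_eq_on {-L<..<L} g G"
    using A_graph_continuous_representative[OF L A(2)] by blast
  obtain F F1 F2 F3 where F: "dom3 L F F1 F2 F3" "ae_eq_on {-L<..<L} f F"
    by (rule A_graph_dom3[OF L A(1) G], rule that; assumption)
  have "\<exists>R :: nat \<Rightarrow> real \<Rightarrow> real. dom3 L (R 0) (R 1) (R 2) (R 3) \<and> ae_eq_on {-L<..<L} f (R 0)"
    by (rule exI[of _ "\<lambda>n. if n = 0 then F else if n = 1 then F1 else if n = 2 then F2 else F3"])
      (use F in simp)
  from someI_ex[OF this] show "dom3 L (rep L f 0) (rep L f 1) (rep L f 2) (rep L f 3)"
    "ae_eq_on {-L<..<L} f (rep L f 0)" unfolding rep_def by blast+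
qed

text \<open>Both lists of derivatives represent the weak derivatives of one L2 class, and continuous
  representatives agree up to the end points.\<close>

lemma dom3_unique:
  assumes L: "0 < L" and F: "dom3 L F F1 F2 F3" and H: "dom3 L H H1 H2 H3"
    and ae: "ae_eq_on {-L<..<L} F H" and x: "x \<in> {-L..L}"
  shows "F x = H x" "F1 x = H1 x" "F2 x = H2 x" "F3 x = H3 x"
proof -
  have LL: "-L < L" using L by simp
  have FL: "F \<in> L2_on {-L<..<L}" by (rule continuous_L2_on[OF dom3D(4)[OF F]])
  note f = dom3_weak_derivs_ae[OF L F FL ae_eq_on_refl] and h = dom3_weak_derivs_ae[OF L H FL ae]
  show "F x = H x" by (rule ae_eq_continuous[OF LL dom3D(4)[OF F] dom3D(4)[OF H] ae x])
  show "F1 x = H1 x"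
    by (rule ae_eq_continuous[OF LL dom3D(5)[OF F] dom3D(5)[OF H] ae_eq_on_trans[OF ae_eq_on_sym[OF f(1)] h(1)] x])
  show "F2 x = H2 x"
    by (rule ae_eq_continuous[OF LL dom3D(6)[OF F] dom3D(6)[OF H] ae_eq_on_trans[OF ae_eq_on_sym[OF f(2)] h(2)] x])
  show "F3 x = H3 x"
    by (rule ae_eq_continuous[OF LL dom3D(7)[OF F] dom3D(7)[OF H] ae_eq_on_trans[OF ae_eq_on_sym[OF f(3)] h(3)] x])
qed

lemma rep_cong:
  assumes L: "0 < L" and f: "Adom L 2 f" and g: "Adom L 2 g" and ae: "ae_eq_on {-L<..<L} f g"
    and x: "x \<in> {-L..L}" and j: "j \<le> 3"
  shows "rep L f j x = rep L g j x"
proof -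
  have "ae_eq_on {-L<..<L} (rep L f 0) (rep L g 0)"
    by (rule ae_eq_on_trans[OF ae_eq_on_sym[OF rep_dom3(2)[OF L f]] ae_eq_on_trans[OF ae rep_dom3(2)[OF L g]]])
  note u = dom3_unique[OF L rep_dom3(1)[OF L f] rep_dom3(1)[OF L g] this x]
  have "j = 0 \<or> j = 1 \<or> j = 2 \<or> j = 3" using j by linarith
  with u show ?thesis by auto
qed

lemma rep_A:
  assumes L: "0 < L" and f: "Adom L 2 f" and A: "(f, g) \<in> A_graph L"
  shows "ae_eq_on {-L<..<L} g (\<lambda>x. rep L f 2 x - rep L f 3 x)"
proof -
  note w = dom3_weak_derivs_ae[OF L rep_dom3(1)[OF L f] Adom_L2[OF f] rep_dom3(2)[OF L f]]
  have "ae_eq_on {-L<..<L} g (\<lambda>x. weak_deriv_on {-L<..<L} 2 f x - weak_deriv_on {-L<..<L} 3 f x)"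
    using A by (simp add: A_graph_def)
  then show ?thesis using w(2,3) unfolding ae_eq_on_def by (auto elim: eventually_elim2)
qed

lemma rep_A_eq:
  assumes L: "0 < L" and f: "Adom L 2 f" and A: "(f, g) \<in> A_graph L" and g: "Adom L 2 g"
    and x: "x \<in> {-L..L}"
  shows "rep L g 0 x = rep L f 2 x - rep L f 3 x"
  by (rule ae_eq_continuous[OF _ dom3D(4)[OF rep_dom3(1)[OF L g]]
        dom3_continuous_op[OF rep_dom3(1)[OF L f]]
        ae_eq_on_trans[OF ae_eq_on_sym[OF rep_dom3(2)[OF L g]] rep_A[OF L f A]] x])
    (use L in simp)

section \<open>Orbits of the abstract semigroup\<close>

locale kdv_burgers =
  fixes L :: real and S :: "real \<Rightarrow> (real \<Rightarrow> real) \<Rightarrow> real \<Rightarrow> real"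
  assumes L: "0 < L" and S: "is_S_L L S"
begin

abbreviation "\<Omega> \<equiv> {-L<..<L}"
abbreviation "N \<equiv> L2_norm_on \<Omega>"
abbreviation aeq (infix "\<doteq>" 50) where "f \<doteq> g \<equiv> ae_eq_on \<Omega> f g"

lemma S_L2: "0 \<le> t \<Longrightarrow> f \<in> L2_on \<Omega> \<Longrightarrow> S t f \<in> L2_on \<Omega>"
  using S by (simp add: is_S_L_def C0_contraction_semigroup_def)

lemma S_lin: "0 \<le> t \<Longrightarrow> f \<in> L2_on \<Omega> \<Longrightarrow> g \<in> L2_on \<Omega> \<Longrightarrow>
    S t (\<lambda>x. a * f x + b * g x) \<doteq> (\<lambda>x. a * S t f x + b * S t g x)"
  using S by (simp add: is_S_L_def C0_contraction_semigroup_def)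

lemma S_add_time: "0 \<le> r \<Longrightarrow> 0 \<le> t \<Longrightarrow> f \<in> L2_on \<Omega> \<Longrightarrow> S (r + t) f \<doteq> S r (S t f)"
  using S by (simp add: is_S_L_def C0_contraction_semigroup_def)

lemma S_tendsto_0: "f \<in> L2_on \<Omega> \<Longrightarrow> ((\<lambda>t. N (\<lambda>x. S t f x - f x)) \<longlongrightarrow> 0) (at_right 0)"
  using S by (simp add: is_S_L_def C0_contraction_semigroup_def)

lemma S_contraction: "0 \<le> t \<Longrightarrow> f \<in> L2_on \<Omega> \<Longrightarrow> N (S t f) \<le> N f"
  using S by (simp add: is_S_L_def C0_contraction_semigroup_def)

lemma generator_eq: "generator_graph \<Omega> S = A_graph L"
  using S by (simp add: is_S_L_def)

lemma generatorD:
  "(f, g) \<in> A_graph L \<Longrightarrow> ((\<lambda>h. N (\<lambda>x. (S h f x - f x) / h - g x)) \<longlongrightarrow> 0) (at_right 0)"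
  using generator_eq by (auto simp: generator_graph_def)

lemma S_diff:
  assumes "0 \<le> t" "f \<in> L2_on \<Omega>" "g \<in> L2_on \<Omega>"
  shows "S t (\<lambda>x. f x - g x) \<doteq> (\<lambda>x. S t f x - S t g x)"
  using S_lin[OF assms, of 1 "-1"] by simp

lemma S_cmult:
  assumes "0 \<le> t" "f \<in> L2_on \<Omega>"
  shows "S t (\<lambda>x. c * f x) \<doteq> (\<lambda>x. c * S t f x)"
  using S_lin[OF assms assms(2), of c 0] by simp

lemma S_contraction_diff:
  assumes "0 \<le> t" "f \<in> L2_on \<Omega>" "g \<in> L2_on \<Omega>"
  shows "N (\<lambda>x. S t f x - S t g x) \<le> N (\<lambda>x. f x - g x)"
  using S_contraction[OF assms(1) L2_on_diff[OF assms(2,3)]]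
    L2_norm_cong[OF S_diff[OF assms] S_L2[OF assms(1) L2_on_diff[OF assms(2,3)]]
      L2_on_diff[OF S_L2[OF assms(1,2)] S_L2[OF assms(1,3)]]] by simp

text \<open>The left function is the image under the contraction \<open>S t\<close> of the one on
  the right: a difference quotient at time \<open>t\<close> is never worse than the one at time
  0.\<close>

lemma quotient_bound:
  assumes t: "0 \<le> t" and h: "0 < h" and f: "f \<in> L2_on \<Omega>" and g: "g \<in> L2_on \<Omega>"
  shows "N (\<lambda>x. (S (t + h) f x - S t f x) / h - S t g x) \<le> N (\<lambda>x. (S h f x - f x) / h - g x)"
proof -
  have h0: "0 \<le> h" using h by simp
  let ?q = "\<lambda>x. (1 / h) * (S h f x - f x)"
  have L: "S h f \<in> L2_on \<Omega>" "(\<lambda>x. S h f x - f x) \<in> L2_on \<Omega>" "?q \<in> L2_on \<Omega>"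
    by (intro L2_on_cmult L2_on_diff S_L2 h0 f)+
  have "(\<lambda>x. (S (t + h) f x - S t f x) / h - S t g x) \<doteq> (\<lambda>x. S t ?q x - S t g x)"
    using S_add_time[OF t h0 f] S_diff[OF t L(1) f] S_cmult[OF t L(2), of "1 / h"]
    unfolding ae_eq_on_def by eventually_elim simp
  then have "N (\<lambda>x. (S (t + h) f x - S t f x) / h - S t g x) = N (\<lambda>x. S t ?q x - S t g x)"
    by (rule L2_norm_cong; intro L2_on_diff L2_on_divide S_L2 t f g L(3)) (use t h in auto)
  also have "\<dots> \<le> N (\<lambda>x. ?q x - g x)" by (rule S_contraction_diff[OF t L(3) g])
  finally show ?thesis by simp
qed

text \<open>The difference quotients of \<open>S t f\<close> at time 0 are those of \<open>f\<close>
  at time \<open>t\<close>, so the generator commutes with the semigroup.\<close>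

lemma S_graph:
  assumes t: "0 \<le> t" and A: "(f, g) \<in> A_graph L"
  shows "(S t f, S t g) \<in> A_graph L"
proof -
  have fg: "f \<in> L2_on \<Omega>" "g \<in> L2_on \<Omega>" using A_graph_L2[OF A] by auto
  have "((\<lambda>h. N (\<lambda>x. (S h (S t f) x - S t f x) / h - S t g x)) \<longlongrightarrow> 0) (at_right 0)"
  proof (rule tendsto_sandwich[OF _ _ tendsto_const generatorD[OF A]])
    show "\<forall>\<^sub>F h in at_right 0. 0 \<le> N (\<lambda>x. (S h (S t f) x - S t f x) / h - S t g x)"
      by (simp add: L2_norm_nonneg)
    show "\<forall>\<^sub>F h in at_right 0. N (\<lambda>x. (S h (S t f) x - S t f x) / h - S t g x)
        \<le> N (\<lambda>x. (S h f x - f x) / h - g x)"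
    proof (rule eventually_at_right_less[THEN eventually_mono])
      fix h :: real assume h: "0 < h"
      have "(\<lambda>x. (S h (S t f) x - S t f x) / h - S t g x)
          \<doteq> (\<lambda>x. (S (t + h) f x - S t f x) / h - S t g x)"
        using S_add_time[OF less_imp_le[OF h] t fg(1)] unfolding ae_eq_on_def
        by eventually_elim (simp add: add.commute)
      then have "N (\<lambda>x. (S h (S t f) x - S t f x) / h - S t g x)
          = N (\<lambda>x. (S (t + h) f x - S t f x) / h - S t g x)"
        by (rule L2_norm_cong; intro L2_on_diff L2_on_divide S_L2 t fg) (use t h in auto)
      then show "N (\<lambda>x. (S h (S t f) x - S t f x) / h - S t g x)
        \<le> N (\<lambda>x. (S h f x - f x) / h - g x)"
        using quotient_bound[OF t h fg] by simp
    qed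
  qed
  then show ?thesis
    using S_L2[OF t fg(1)] S_L2[OF t fg(2)] unfolding generator_eq[symmetric] by (simp add: generator_graph_def)
qed

lemma S_time_diff:
  assumes r: "0 \<le> r" and t: "0 \<le> t" and f: "f \<in> L2_on \<Omega>"
  shows "N (\<lambda>x. S r f x - S t f x) \<le> N (\<lambda>x. S \<bar>r - t\<bar> f x - f x)"
proof -
  have *: "N (\<lambda>x. S r f x - S t f x) \<le> N (\<lambda>x. S (r - t) f x - f x)" if "t \<le> r" "0 \<le> t" for r t
  proof -
    have rt: "0 \<le> r - t" using that by simp
    have "(\<lambda>x. S r f x - S t f x) \<doteq> (\<lambda>x. S t (S (r - t) f) x - S t f x)"
      using S_add_time[OF that(2) rt f] unfolding ae_eq_on_def by eventually_elim simp
    then have "N (\<lambda>x. S r f x - S t f x) = N (\<lambda>x. S t (S (r - t) f) x - S t f x)"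
      by (rule L2_norm_cong; intro L2_on_diff S_L2 f) (use that in auto)
    also have "\<dots> \<le> N (\<lambda>x. S (r - t) f x - f x)"
      by (rule S_contraction_diff[OF that(2) S_L2[OF rt f] f])
    finally show ?thesis .
  qed
  show ?thesis
    using *[of t r] *[of r t] r t L2_norm_minus_commute[of \<Omega> "S r f" "S t f"]
    by (cases "t \<le> r") (auto simp: abs_if)
qed

text \<open>For \<open>r < t\<close> only \<open>S r\<close> can be factored out of the quotient,
  which yields convergence towards \<open>S r g\<close>; replacing this by \<open>S t g\<close>
  costs the last term.\<close>

lemma S_quotient:
  assumes r: "0 \<le> r" and t: "0 \<le> t" "r \<noteq> t" and f: "f \<in> L2_on \<Omega>" and g: "g \<in> L2_on \<Omega>"
  shows "N (\<lambda>x. (S r f x - S t f x) / (r - t) - S t g x)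
    \<le> N (\<lambda>x. (S \<bar>r - t\<bar> f x - f x) / \<bar>r - t\<bar> - g x) + N (\<lambda>x. S \<bar>r - t\<bar> g x - g x)"
proof (cases "t < r")
  case True
  then show ?thesis
    using quotient_bound[OF t(1) _ f g, of "r - t"] L2_norm_nonneg[of \<Omega> "\<lambda>x. S (r - t) g x - g x"]
    by (simp add: abs_if)
next
  case False
  then have h: "0 < t - r" using t by simp
  have eq: "(\<lambda>x. (S r f x - S t f x) / (r - t) - S t g x) =
      (\<lambda>x. (S (r + (t - r)) f x - S r f x) / (t - r) - S t g x)"
    using h by (auto simp: field_simps)
  have "N (\<lambda>x. (S (r + (t - r)) f x - S r f x) / (t - r) - S t g x)
    \<le> N (\<lambda>x. (S (r + (t - r)) f x - S r f x) / (t - r) - S r g x) + N (\<lambda>x. S r g x - S t g x)"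
    by (rule L2_norm_triangle_diff; intro L2_on_divide L2_on_diff S_L2 f g) (use r t h in auto)
  then show ?thesis
    unfolding eq using quotient_bound[OF r h f g] S_time_diff[OF r t(1) g] h by (simp add: abs_if)
qed

lemma tendsto_abs_diff_at_right: "filterlim (\<lambda>r. \<bar>r - t\<bar>) (at_right 0) (at (t::real))"
proof -
  have "((\<lambda>r. \<bar>r - t\<bar>) \<longlongrightarrow> \<bar>t - t\<bar>) (at t)" by (intro tendsto_intros)
  then show ?thesis
    by (auto simp: filterlim_at eventually_at_filter)
qed

lemma S_quotient_tendsto:
  assumes t: "0 < t" and A: "(f, g) \<in> A_graph L"
  shows "((\<lambda>r. N (\<lambda>x. (S r f x - S t f x) / (r - t) - S t g x)) \<longlongrightarrow> 0) (at t)"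
proof (rule tendsto_sandwich[OF _ _ tendsto_const])
  have fg: "f \<in> L2_on \<Omega>" "g \<in> L2_on \<Omega>" using A_graph_L2[OF A] by auto
  let ?d = "\<lambda>h. N (\<lambda>x. (S h f x - f x) / h - g x) + N (\<lambda>x. S h g x - g x)"
  have "(?d \<longlongrightarrow> 0 + 0) (at_right 0)" by (intro tendsto_add generatorD A S_tendsto_0 fg)
  then show "((\<lambda>r. ?d \<bar>r - t\<bar>) \<longlongrightarrow> 0) (at t)"
    using filterlim_compose[OF _ tendsto_abs_diff_at_right] by fastforce
  have "\<forall>\<^sub>F r in at t. r \<in> {0<..}" using t by (intro eventually_at_in_open') auto
  moreover have "\<forall>\<^sub>F r in at t. r \<noteq> t" by (simp add: eventually_at_filter)
  ultimately show "\<forall>\<^sub>F r in at t. N (\<lambda>x. (S r f x - S t f x) / (r - t) - S t g x) \<le> ?d \<bar>r - t\<bar>"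
    by eventually_elim (use t fg in \<open>auto intro!: S_quotient\<close>)
qed (simp add: L2_norm_nonneg)

lemma S_continuous_tendsto:
  assumes t: "0 < t" and f: "f \<in> L2_on \<Omega>"
  shows "((\<lambda>r. N (\<lambda>x. S r f x - S t f x)) \<longlongrightarrow> 0) (at t)"
proof (rule tendsto_sandwich[OF _ _ tendsto_const])
  show "((\<lambda>r. N (\<lambda>x. S \<bar>r - t\<bar> f x - f x)) \<longlongrightarrow> 0) (at t)"
    by (rule filterlim_compose[OF S_tendsto_0[OF f] tendsto_abs_diff_at_right])
  have "\<forall>\<^sub>F r in at t. r \<in> {0<..}" using t by (intro eventually_at_in_open') auto
  then show "\<forall>\<^sub>F r in at t. N (\<lambda>x. S r f x - S t f x) \<le> N (\<lambda>x. S \<bar>r - t\<bar> f x - f x)"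
    by eventually_elim (use t f in \<open>auto intro!: S_time_diff\<close>)
qed (simp add: L2_norm_nonneg)

lemma Adom_S: "0 \<le> t \<Longrightarrow> Adom L n f \<Longrightarrow> Adom L n (S t f)"
  by (induction n arbitrary: f) (auto intro: S_L2 S_graph)

end

section \<open>Classical solutions\<close>

text \<open>Supplies the joint continuity that differentiation under the integral sign requires; the
  orbit estimates give continuity in time uniformly in space.\<close>

lemma continuous_on_Times_uniform:
  fixes U :: "real \<Rightarrow> real \<Rightarrow> real"
  assumes c: "\<And>t. t \<in> T \<Longrightarrow> continuous_on X (U t)"
    and u: "\<And>t e. t \<in> T \<Longrightarrow> 0 < e \<Longrightarrow> \<forall>\<^sub>F r in at t. \<forall>x\<in>X. \<bar>U r x - U t x\<bar> < e"
  shows "continuous_on (T \<times> X) (\<lambda>(t, x). U t x)"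
  unfolding continuous_on_iff
proof (intro ballI allI impI)
  fix p :: "real \<times> real" and e :: real assume p: "p \<in> T \<times> X" and e: "0 < e"
  obtain t x where tx: "p = (t, x)" "t \<in> T" "x \<in> X" using p by (cases p) auto
  have e2: "0 < e / 2" using e by simp
  obtain d1 where d1: "0 < d1" "\<And>r. r \<noteq> t \<Longrightarrow> dist r t < d1 \<Longrightarrow> \<forall>x\<in>X. \<bar>U r x - U t x\<bar> < e / 2"
    using u[OF tx(2) e2] unfolding eventually_at by blast
  obtain d2 where d2: "0 < d2" "\<And>y. y \<in> X \<Longrightarrow> dist y x < d2 \<Longrightarrow> dist (U t y) (U t x) < e / 2"
    using c[OF tx(2)] tx(3) e2 unfolding continuous_on_iff by metis
  show "\<exists>d>0. \<forall>q\<in>T \<times> X. dist q p < d \<longrightarrow>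
      dist ((\<lambda>(t, x). U t x) q) ((\<lambda>(t, x). U t x) p) < e"
  proof (intro exI[of _ "min d1 d2"] conjI ballI impI)
    show "0 < min d1 d2" using d1 d2 by simp
    fix q :: "real \<times> real" assume q: "q \<in> T \<times> X" "dist q p < min d1 d2"
    obtain r y where ry: "q = (r, y)" "r \<in> T" "y \<in> X" using q(1) by (cases q) auto
    have "dist r t < d1" "dist y x < d2"
      using q(2) dist_fst_le[of q p] dist_snd_le[of q p] by (auto simp: ry tx)
    then have "\<bar>U r y - U t y\<bar> < e / 2" "\<bar>U t y - U t x\<bar> < e / 2"
      using d1(2)[of r] d2(2)[OF ry(3)] ry(3) e by (cases "r = t"; auto simp: dist_real_def)+
    then show "dist ((\<lambda>(t, x). U t x) q) ((\<lambda>(t, x). U t x) p) < e"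
      by (simp add: ry tx dist_real_def abs_if split: if_splits)
  qed
qed

context kdv_burgers
begin

lemma rep_sup_bound:
  obtains K where "0 < K" "\<And>P P1 P2 P3 g x. dom3 L P P1 P2 P3 \<Longrightarrow> g \<in> L2_on \<Omega> \<Longrightarrow>
    g \<doteq> (\<lambda>x. P2 x - P3 x) \<Longrightarrow> x \<in> {-L..L} \<Longrightarrow>
    \<bar>P x\<bar> \<le> K * N g \<and> \<bar>P1 x\<bar> \<le> K * N g \<and> \<bar>P2 x\<bar> \<le> K * N g"
proof -
  obtain K where K: "0 < K" "\<And>F F1 F2 F3 x. dom3 L F F1 F2 F3 \<Longrightarrow> x \<in> {-L..L} \<Longrightarrow>
    \<bar>F x\<bar> \<le> K * N (\<lambda>x. F2 x - F3 x) \<and> \<bar>F1 x\<bar> \<le> K * N (\<lambda>x. F2 x - F3 x) \<and>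
    \<bar>F2 x\<bar> \<le> K * N (\<lambda>x. F2 x - F3 x)"
    by (rule dom3_sup_bound[OF L], rule that; assumption)
  show ?thesis
  proof (rule that[OF K(1)])
    fix P P1 P2 P3 g x
    assume *: "dom3 L P P1 P2 P3" "g \<in> L2_on \<Omega>" "g \<doteq> (\<lambda>x. P2 x - P3 x)" "x \<in> {-L..L}"
    have "N g = N (\<lambda>x. P2 x - P3 x)"
      by (rule L2_norm_cong[OF *(3,2) continuous_L2_on[OF dom3_continuous_op[OF *(1)]]])
    then show "\<bar>P x\<bar> \<le> K * N g \<and> \<bar>P1 x\<bar> \<le> K * N g \<and> \<bar>P2 x\<bar> \<le> K * N g"
      using K(2)[OF *(1,4)] by simp
  qed
qed

lemma Adom_chain:
  assumes "Adom L (Suc (Suc n)) p" "(p, q) \<in> A_graph L"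
  shows "Adom L (Suc n) q"
proof -
  obtain q' where q': "(p, q') \<in> A_graph L" "Adom L (Suc n) q'" using assms(1) by auto
  show ?thesis
    by (rule Adom_cong[OF L q'(2) _ A_graph_unique[OF q'(1) assms(2)]])
      (use A_graph_L2[OF assms(2)] in simp)
qed

text \<open>The difference of two representatives along the orbit is in the classical domain, and
  its image under \<open>A\<close> is \<open>S (r - \<epsilon>) q - S (t - \<epsilon>) q\<close>
  almost everywhere. Strong continuity of the orbit of \<open>q\<close> therefore gives uniform
  convergence of derivatives up to order two. The orbit starts at time \<open>\<epsilon>\<close>
  because a general datum at time 0 is not in the domain; \<open>X\<close> may be any family of
  representatives of it.\<close>

lemma rep_continuous_in_time:
  assumes p: "Adom L 2 p" and A: "(p, q) \<in> A_graph L" and \<epsilon>: "0 \<le> \<epsilon>"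
    and X: "\<And>t. \<epsilon> < t \<Longrightarrow> Adom L 2 (X t) \<and> X t \<doteq> S (t - \<epsilon>) p"
    and t: "\<epsilon> < t" and e: "0 < e"
  shows "\<forall>\<^sub>F r in at t. \<forall>x\<in>{-L..L}. \<forall>j\<in>{0,1,2}. \<bar>rep L (X r) j x - rep L (X t) j x\<bar> < e"
proof -
  obtain K where K: "0 < K" "\<And>P P1 P2 P3 g x. dom3 L P P1 P2 P3 \<Longrightarrow> g \<in> L2_on \<Omega> \<Longrightarrow>
    g \<doteq> (\<lambda>x. P2 x - P3 x) \<Longrightarrow> x \<in> {-L..L} \<Longrightarrow>
    \<bar>P x\<bar> \<le> K * N g \<and> \<bar>P1 x\<bar> \<le> K * N g \<and> \<bar>P2 x\<bar> \<le> K * N g"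
    by (rule rep_sup_bound, rule that; assumption)
  have q: "q \<in> L2_on \<Omega>" using A_graph_L2[OF A] by simp
  define R where "R r j x = rep L (S (r - \<epsilon>) p) j x" for r j x
  have RX: "rep L (X r) j x = R r j x" if "\<epsilon> < r" "x \<in> {-L..L}" "j \<le> 3" for r j x
    unfolding R_def by (rule rep_cong[OF L _ Adom_S]) (use X p that in auto)
  have dR: "dom3 L (R r 0) (R r 1) (R r 2) (R r 3)" "S (r - \<epsilon>) q \<doteq> (\<lambda>x. R r 2 x - R r 3 x)"
    if "\<epsilon> < r" for r
  proof -
    have nn: "0 \<le> r - \<epsilon>" using that by simp
    show "dom3 L (R r 0) (R r 1) (R r 2) (R r 3)" "S (r - \<epsilon>) q \<doteq> (\<lambda>x. R r 2 x - R r 3 x)"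
      unfolding R_def
      by (rule rep_dom3(1)[OF L Adom_S[OF nn p]] rep_A[OF L Adom_S[OF nn p] S_graph[OF nn A]])+
  qed
  have bound: "\<bar>R r j x - R t j x\<bar> \<le> K * N (\<lambda>x. S (r - \<epsilon>) q x - S (t - \<epsilon>) q x)"
    if r: "\<epsilon> < r" and x: "x \<in> {-L..L}" and j: "j \<in> {0,1,2}" for r x j
  proof -
    have gL: "(\<lambda>x. S (r - \<epsilon>) q x - S (t - \<epsilon>) q x) \<in> L2_on \<Omega>"
      by (intro L2_on_diff S_L2 q) (use r t in auto)
    have g: "(\<lambda>x. S (r - \<epsilon>) q x - S (t - \<epsilon>) q x) \<doteq>
        (\<lambda>x. (1 * R r 2 x + -1 * R t 2 x) - (1 * R r 3 x + -1 * R t 3 x))"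
      using dR(2)[OF r] dR(2)[OF t] unfolding ae_eq_on_def by eventually_elim simp
    show ?thesis
      using K(2)[OF dom3_lincomb[OF dR(1)[OF r] dR(1)[OF t]] gL g x] j by auto
  qed
  have "((\<lambda>r. r - \<epsilon>) \<longlongrightarrow> t - \<epsilon>) (at t)" by (intro tendsto_intros)
  then have "filterlim (\<lambda>r. r - \<epsilon>) (at (t - \<epsilon>)) (at t)"
    by (auto simp: filterlim_at eventually_at_filter)
  from filterlim_compose[OF S_continuous_tendsto[OF _ q] this] t
  have "((\<lambda>r. K * N (\<lambda>x. S (r - \<epsilon>) q x - S (t - \<epsilon>) q x)) \<longlongrightarrow> K * 0) (at t)"
    by (intro tendsto_intros) auto
  then have "\<forall>\<^sub>F r in at t. K * N (\<lambda>x. S (r - \<epsilon>) q x - S (t - \<epsilon>) q x) < e"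
    using e by (intro order_tendstoD(2)) auto
  moreover have "\<forall>\<^sub>F r in at t. r \<in> {\<epsilon><..}" using t by (intro eventually_at_in_open') auto
  ultimately show ?thesis
  proof eventually_elim
    case (elim r)
    show ?case
    proof (intro ballI)
      fix x j assume xj: "x \<in> {-L..L}" "j \<in> {0,1,2::nat}"
      then have "j \<le> 3" by auto
      then show "\<bar>rep L (X r) j x - rep L (X t) j x\<bar> < e"
        using bound[OF _ xj, of r] elim RX[of r x j] RX[of t x j] xj t by auto
    qed
  qed
qed

text \<open>As for continuity, now with the difference quotient minus its expected limit. Its image
  under \<open>A\<close> is the corresponding error for the orbit of \<open>q = A p\<close>; one
  more power of \<open>A\<close> makes that orbit differentiable in L2.\<close>

lemma rep_derivative_in_time:
  assumes p: "Adom L 3 p" and A: "(p, q) \<in> A_graph L" and \<epsilon>: "0 \<le> \<epsilon>"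
    and X: "\<And>t. \<epsilon> < t \<Longrightarrow> Adom L 2 (X t) \<and> X t \<doteq> S (t - \<epsilon>) p"
    and Y: "\<And>t. \<epsilon> < t \<Longrightarrow> Adom L 2 (Y t) \<and> Y t \<doteq> S (t - \<epsilon>) q"
    and t: "\<epsilon> < t" and x: "x \<in> {-L..L}" and j: "j \<in> {0,1,2}"
  shows "((\<lambda>r. rep L (X r) j x) has_real_derivative rep L (Y t) j x) (at t)"
proof -
  obtain K where K: "0 < K" "\<And>P P1 P2 P3 g x. dom3 L P P1 P2 P3 \<Longrightarrow> g \<in> L2_on \<Omega> \<Longrightarrow>
    g \<doteq> (\<lambda>x. P2 x - P3 x) \<Longrightarrow> x \<in> {-L..L} \<Longrightarrow>
    \<bar>P x\<bar> \<le> K * N g \<and> \<bar>P1 x\<bar> \<le> K * N g \<and> \<bar>P2 x\<bar> \<le> K * N g"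
    by (rule rep_sup_bound, rule that; assumption)
  have q: "Adom L 2 q" using Adom_chain[of 1 p q] p A by (simp add: eval_nat_numeral)
  have p2: "Adom L 2 p" by (rule Adom_mono[OF p]) simp
  obtain w where B: "(q, w) \<in> A_graph L" using q by (auto simp: numeral_2_eq_2)
  have w: "w \<in> L2_on \<Omega>" using A_graph_L2[OF B] by simp
  have j3: "j \<le> 3" using j by auto
  define R where "R r j x = rep L (S (r - \<epsilon>) p) j x" for r j x
  define Q where "Q j x = rep L (S (t - \<epsilon>) q) j x" for j x
  have RX: "rep L (X r) j x = R r j x" if "\<epsilon> < r" for r
    unfolding R_def by (rule rep_cong[OF L _ Adom_S[OF _ p2]]) (use X that x j3 in auto)
  have QY: "rep L (Y t) j x = Q j x"
    unfolding Q_def by (rule rep_cong[OF L _ Adom_S[OF _ q]]) (use Y t x j3 in auto)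
  have dR: "dom3 L (R r 0) (R r 1) (R r 2) (R r 3)" "S (r - \<epsilon>) q \<doteq> (\<lambda>x. R r 2 x - R r 3 x)"
    if "\<epsilon> < r" for r
  proof -
    have nn: "0 \<le> r - \<epsilon>" using that by simp
    show "dom3 L (R r 0) (R r 1) (R r 2) (R r 3)" "S (r - \<epsilon>) q \<doteq> (\<lambda>x. R r 2 x - R r 3 x)"
      unfolding R_def
      by (rule rep_dom3(1)[OF L Adom_S[OF nn p2]] rep_A[OF L Adom_S[OF nn p2] S_graph[OF nn A]])+
  qed
  have dQ: "dom3 L (Q 0) (Q 1) (Q 2) (Q 3)" "S (t - \<epsilon>) w \<doteq> (\<lambda>x. Q 2 x - Q 3 x)"
  proof -
    have nn: "0 \<le> t - \<epsilon>" using t by simp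
    show "dom3 L (Q 0) (Q 1) (Q 2) (Q 3)" "S (t - \<epsilon>) w \<doteq> (\<lambda>x. Q 2 x - Q 3 x)"
      unfolding Q_def
      by (rule rep_dom3(1)[OF L Adom_S[OF nn q]] rep_A[OF L Adom_S[OF nn q] S_graph[OF nn B]])+
  qed
  have bound: "\<bar>(R r j x - R t j x) / (r - t) - Q j x\<bar>
      \<le> K * N (\<lambda>x. (S (r - \<epsilon>) q x - S (t - \<epsilon>) q x) / (r - t) - S (t - \<epsilon>) w x)"
    if r: "\<epsilon> < r" "r \<noteq> t" for r
  proof -
    define c where "c = 1 / (r - t)"
    let ?g = "\<lambda>x. (S (r - \<epsilon>) q x - S (t - \<epsilon>) q x) / (r - t) - S (t - \<epsilon>) w x"
    have gL: "?g \<in> L2_on \<Omega>"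
      by (intro L2_on_diff L2_on_divide S_L2 Adom_L2[OF q] w) (use r t in auto)
    have g: "?g \<doteq> (\<lambda>x. (1 * (c * R r 2 x + (- c) * R t 2 x) + -1 * Q 2 x)
        - (1 * (c * R r 3 x + (- c) * R t 3 x) + -1 * Q 3 x))"
      using dR(2)[OF r(1)] dR(2)[OF t] dQ(2) unfolding ae_eq_on_def
      by eventually_elim (simp add: c_def diff_divide_distrib)
    have "(R r j x - R t j x) / (r - t) - Q j x = 1 * (c * R r j x + (- c) * R t j x) + -1 * Q j x"
      by (simp add: c_def diff_divide_distrib)
    then show ?thesis
      using K(2)[OF dom3_lincomb[OF dom3_lincomb[OF dR(1)[OF r(1)] dR(1)[OF t]] dQ(1)] gL g x] j by auto
  qed
  have "((\<lambda>r. r - \<epsilon>) \<longlongrightarrow> t - \<epsilon>) (at t)" by (intro tendsto_intros)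
  then have "filterlim (\<lambda>r. r - \<epsilon>) (at (t - \<epsilon>)) (at t)"
    by (auto simp: filterlim_at eventually_at_filter)
  from filterlim_compose[OF S_quotient_tendsto[OF _ B] this] t
  have lim: "((\<lambda>r. K * N (\<lambda>x. (S (r - \<epsilon>) q x - S (t - \<epsilon>) q x) / (r - t) - S (t - \<epsilon>) w x)) \<longlongrightarrow> K * 0) (at t)"
    by (intro tendsto_intros) auto
  have "((\<lambda>r. \<bar>(rep L (X r) j x - rep L (X t) j x) / (r - t) - rep L (Y t) j x\<bar>) \<longlongrightarrow> 0) (at t)"
  proof (rule tendsto_sandwich[OF _ _ tendsto_const])
    have "\<forall>\<^sub>F r in at t. r \<in> {\<epsilon><..}" using t by (intro eventually_at_in_open') auto
    moreover have "\<forall>\<^sub>F r in at t. r \<noteq> t" by (simp add: eventually_at_filter)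
    ultimately show "\<forall>\<^sub>F r in at t. \<bar>(rep L (X r) j x - rep L (X t) j x) / (r - t) - rep L (Y t) j x\<bar>
        \<le> K * N (\<lambda>x. (S (r - \<epsilon>) q x - S (t - \<epsilon>) q x) / (r - t) - S (t - \<epsilon>) w x)"
      by eventually_elim (use bound RX QY t in auto)
  qed (use lim in auto)
  then have "((\<lambda>r. (rep L (X r) j x - rep L (X t) j x) / (r - t) - rep L (Y t) j x) \<longlongrightarrow> 0) (at t)"
    by (simp add: tendsto_rabs_zero_iff)
  then show ?thesis
    unfolding has_field_derivative_iff by (simp add: LIM_zero_iff)
qed

text \<open>\<open>U t\<close> and \<open>V t\<close> are the classical representatives of \<open>S t u0\<close> and of its time derivative
  \<open>A (S t u0)\<close>.\<close>

lemma classical_solution: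
  assumes u0: "u0 \<in> L2_on \<Omega>" and dom: "\<And>t. 0 < t \<Longrightarrow> Adom L 5 (S t u0)"
  obtains U V :: "nat \<Rightarrow> real \<Rightarrow> real \<Rightarrow> real" where
    "\<And>t. 0 < t \<Longrightarrow> dom3 L (U 0 t) (U 1 t) (U 2 t) (U 3 t)"
    "\<And>t. 0 < t \<Longrightarrow> S t u0 \<doteq> U 0 t"
    "\<And>t. 0 < t \<Longrightarrow> dom3 L (V 0 t) (V 1 t) (V 2 t) (V 3 t)"
    "\<And>t x. 0 < t \<Longrightarrow> x \<in> {-L..L} \<Longrightarrow> V 0 t x = U 2 t x - U 3 t x"
    "\<And>t x j. 0 < t \<Longrightarrow> x \<in> {-L..L} \<Longrightarrow> j \<in> {0, 1, 2} \<Longrightarrow>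
      ((\<lambda>r. U j r x) has_real_derivative V j t x) (at t)"
    "\<And>t x. 0 < t \<Longrightarrow> x \<in> {-L..L} \<Longrightarrow>
      ((\<lambda>r. V 0 r x) has_real_derivative V 2 t x - V 3 t x) (at t)"
    "\<And>j. j \<in> {0, 1, 2, 3} \<Longrightarrow> continuous_on ({0<..} \<times> {-L..L}) (\<lambda>(t, x). U j t x)"
    "\<And>j. j \<in> {0, 1, 2, 3} \<Longrightarrow> continuous_on ({0<..} \<times> {-L..L}) (\<lambda>(t, x). V j t x)"
proof -
  \<comment> \<open>The orbit and its first two time derivatives. \<open>Z\<close> is present
    because \<open>Y\<close> itself has to be differentiated in time and because the third space
    derivative of \<open>Y\<close> is recovered from \<open>Z\<close>.\<close>
  define X where "X t = S t u0" for t
  define Y where "Y t = Aop L (X t)" for t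
  define Z where "Z t = Aop L (Y t)" for t
  have X: "Adom L 5 (X t)" if "0 < t" for t using dom[OF that] by (simp add: X_def)
  have Y: "(X t, Y t) \<in> A_graph L" "Adom L 4 (Y t)" if "0 < t" for t
    using Adom_Aop[OF L, of 4 "X t"] X[OF that] by (simp_all add: Y_def eval_nat_numeral)
  have Z: "(Y t, Z t) \<in> A_graph L" "Adom L 3 (Z t)" if "0 < t" for t
    using Adom_Aop[OF L, of 3 "Y t"] Y(2)[OF that] by (simp_all add: Z_def eval_nat_numeral)
  have two: "Adom L 2 (X t)" "Adom L 2 (Y t)" "Adom L 2 (Z t)" if "0 < t" for t
    by (rule Adom_mono[OF X[OF that]] Adom_mono[OF Y(2)[OF that]] Adom_mono[OF Z(2)[OF that]]; simp)+
  have shift: "X r \<doteq> S (r - \<epsilon>) (X \<epsilon>)" "Y r \<doteq> S (r - \<epsilon>) (Y \<epsilon>)" "Z r \<doteq> S (r - \<epsilon>) (Z \<epsilon>)"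
    if "0 < \<epsilon>" "\<epsilon> < r" for \<epsilon> r
  proof -
    have r: "0 < r" "0 \<le> r - \<epsilon>" using that by auto
    show 1: "X r \<doteq> S (r - \<epsilon>) (X \<epsilon>)"
      using S_add_time[OF r(2) less_imp_le[OF that(1)] u0] by (simp add: X_def)
    have L2: "S (r - \<epsilon>) (X \<epsilon>) \<in> L2_on \<Omega>" "S (r - \<epsilon>) (Y \<epsilon>) \<in> L2_on \<Omega>"
      by (intro S_L2 r Adom_L2[OF X[OF that(1)]] Adom_L2[OF Y(2)[OF that(1)]])+
    show 2: "Y r \<doteq> S (r - \<epsilon>) (Y \<epsilon>)"
      by (rule A_graph_unique[OF A_graph_cong_left[OF L Y(1)[OF r(1)] L2(1) 1]
            S_graph[OF r(2) Y(1)[OF that(1)]]])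
    show "Z r \<doteq> S (r - \<epsilon>) (Z \<epsilon>)"
      by (rule A_graph_unique[OF A_graph_cong_left[OF L Z(1)[OF r(1)] L2(2) 2]
            S_graph[OF r(2) Z(1)[OF that(1)]]])
  qed
  \<comment> \<open>Time \<open>t\<close> is reached from the datum at \<open>t / 2\<close>, which
    already lies in the required domain.\<close>
  have half: "0 < t / 2" "t / 2 < t" if "0 < t" for t :: real using that by auto
  have dU: "((\<lambda>r. rep L (X r) j x) has_real_derivative rep L (Y t) j x) (at t)"
    and dV: "((\<lambda>r. rep L (Y r) j x) has_real_derivative rep L (Z t) j x) (at t)"
    if "0 < t" "x \<in> {-L..L}" "j \<in> {0, 1, 2}" for t x j
    by (rule rep_derivative_in_time[OF Adom_mono[OF X[OF half(1)[OF that(1)]]] Y(1)[OF half(1)[OF that(1)]] _ _ _ half(2)[OF that(1)] that(2,3)]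
        rep_derivative_in_time[OF Adom_mono[OF Y(2)[OF half(1)[OF that(1)]]] Z(1)[OF half(1)[OF that(1)]] _ _ _ half(2)[OF that(1)] that(2,3)];
        use that half two shift in auto)+
  have cU: "\<forall>\<^sub>F r in at t. \<forall>x\<in>{-L..L}. \<forall>j\<in>{0,1,2}. \<bar>rep L (X r) j x - rep L (X t) j x\<bar> < e"
    and cV: "\<forall>\<^sub>F r in at t. \<forall>x\<in>{-L..L}. \<forall>j\<in>{0,1,2}. \<bar>rep L (Y r) j x - rep L (Y t) j x\<bar> < e"
    and cW: "\<forall>\<^sub>F r in at t. \<forall>x\<in>{-L..L}. \<forall>j\<in>{0,1,2}. \<bar>rep L (Z r) j x - rep L (Z t) j x\<bar> < e"
    if "0 < t" "0 < e" for t e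
  proof -
    have "(Z (t / 2), Aop L (Z (t / 2))) \<in> A_graph L"
      using Adom_Aop(1)[OF L, of 2 "Z (t / 2)"] Z(2)[OF half(1)[OF that(1)]] by (simp add: eval_nat_numeral)
    note A = Y(1)[OF half(1)[OF that(1)]] Z(1)[OF half(1)[OF that(1)]] this
    show "\<forall>\<^sub>F r in at t. \<forall>x\<in>{-L..L}. \<forall>j\<in>{0,1,2}. \<bar>rep L (X r) j x - rep L (X t) j x\<bar> < e"
      "\<forall>\<^sub>F r in at t. \<forall>x\<in>{-L..L}. \<forall>j\<in>{0,1,2}. \<bar>rep L (Y r) j x - rep L (Y t) j x\<bar> < e"
      "\<forall>\<^sub>F r in at t. \<forall>x\<in>{-L..L}. \<forall>j\<in>{0,1,2}. \<bar>rep L (Z r) j x - rep L (Z t) j x\<bar> < e"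
      by (rule rep_continuous_in_time[OF two(1)[OF half(1)[OF that(1)]] A(1) _ _ half(2)[OF that(1)] that(2)]
          rep_continuous_in_time[OF two(2)[OF half(1)[OF that(1)]] A(2) _ _ half(2)[OF that(1)] that(2)]
          rep_continuous_in_time[OF two(3)[OF half(1)[OF that(1)]] A(3) _ _ half(2)[OF that(1)] that(2)];
          use that half two shift in auto)+
  qed
  note dom = rep_dom3(1)[OF L two(1)] rep_dom3(1)[OF L two(2)] rep_dom3(1)[OF L two(3)]
  have jU: "continuous_on ({0<..} \<times> {-L..L}) (\<lambda>(t, x). rep L (X t) j x)"
    and jV: "continuous_on ({0<..} \<times> {-L..L}) (\<lambda>(t, x). rep L (Y t) j x)"
    and jW: "continuous_on ({0<..} \<times> {-L..L}) (\<lambda>(t, x). rep L (Z t) j x)" if "j \<in> {0, 1, 2}" for j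
  proof -
    have c: "continuous_on {-L..L} (rep L (X t) j)" "continuous_on {-L..L} (rep L (Y t) j)"
      "continuous_on {-L..L} (rep L (Z t) j)" if t: "0 < t" for t
      using dom3D(4-6)[OF dom(1)[OF t]] dom3D(4-6)[OF dom(2)[OF t]] dom3D(4-6)[OF dom(3)[OF t]] \<open>j \<in> _\<close>
      by auto
    have u: "\<forall>\<^sub>F r in at t. \<forall>x\<in>{-L..L}. \<bar>rep L (X r) j x - rep L (X t) j x\<bar> < e"
      "\<forall>\<^sub>F r in at t. \<forall>x\<in>{-L..L}. \<bar>rep L (Y r) j x - rep L (Y t) j x\<bar> < e"
      "\<forall>\<^sub>F r in at t. \<forall>x\<in>{-L..L}. \<bar>rep L (Z r) j x - rep L (Z t) j x\<bar> < e"
      if "t \<in> {0<..}" "0 < e" for t e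
      by (rule eventually_mono[OF cU[OF _ that(2)]] eventually_mono[OF cV[OF _ that(2)]]
          eventually_mono[OF cW[OF _ that(2)]]; use that(1) \<open>j \<in> _\<close> in auto)+
    show "continuous_on ({0<..} \<times> {-L..L}) (\<lambda>(t, x). rep L (X t) j x)"
      "continuous_on ({0<..} \<times> {-L..L}) (\<lambda>(t, x). rep L (Y t) j x)"
      "continuous_on ({0<..} \<times> {-L..L}) (\<lambda>(t, x). rep L (Z t) j x)"
      by (rule continuous_on_Times_uniform[OF c(1) u(1)] continuous_on_Times_uniform[OF c(2) u(2)]
          continuous_on_Times_uniform[OF c(3) u(3)]; simp)+
  qed
  have VU: "rep L (Y t) 0 x = rep L (X t) 2 x - rep L (X t) 3 x"
    and WV: "rep L (Z t) 0 x = rep L (Y t) 2 x - rep L (Y t) 3 x" if "0 < t" "x \<in> {-L..L}" for t x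
    by (rule rep_A_eq[OF L two(1)[OF that(1)] Y(1)[OF that(1)] two(2)[OF that(1)] that(2)]
        rep_A_eq[OF L two(2)[OF that(1)] Z(1)[OF that(1)] two(3)[OF that(1)] that(2)])+
  \<comment> \<open>The graph norm does not control third derivatives uniformly; the equation
    expresses them through second derivatives and the next function of the chain.\<close>
  have j3: "continuous_on ({0<..} \<times> {-L..L}) (\<lambda>(t, x). rep L (X t) 3 x)"
    "continuous_on ({0<..} \<times> {-L..L}) (\<lambda>(t, x). rep L (Y t) 3 x)"
  proof -
    have "continuous_on ({0<..} \<times> {-L..L}) (\<lambda>p. (case p of (t, x) \<Rightarrow> rep L (X t) 2 x) - (case p of (t, x) \<Rightarrow> rep L (Y t) 0 x))"
      by (intro continuous_on_diff jU jV) auto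
    then show "continuous_on ({0<..} \<times> {-L..L}) (\<lambda>(t, x). rep L (X t) 3 x)"
      by (rule continuous_on_eq) (auto simp: VU)
    have "continuous_on ({0<..} \<times> {-L..L}) (\<lambda>p. (case p of (t, x) \<Rightarrow> rep L (Y t) 2 x) - (case p of (t, x) \<Rightarrow> rep L (Z t) 0 x))"
      by (intro continuous_on_diff jV jW) auto
    then show "continuous_on ({0<..} \<times> {-L..L}) (\<lambda>(t, x). rep L (Y t) 3 x)"
      by (rule continuous_on_eq) (auto simp: WV)
  qed
  show ?thesis
  proof (rule that[of "\<lambda>j t. rep L (X t) j" "\<lambda>j t. rep L (Y t) j"])
    show "S t u0 \<doteq> rep L (X t) 0" if "0 < t" for t
      using rep_dom3(2)[OF L two(1)[OF that]] by (simp add: X_def)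
    show "((\<lambda>r. rep L (Y r) 0 x) has_real_derivative rep L (Y t) 2 x - rep L (Y t) 3 x) (at t)"
      if "0 < t" "x \<in> {-L..L}" for t x
      using dV[OF that, of 0] WV[OF that] by simp
    show "continuous_on ({0<..} \<times> {-L..L}) (\<lambda>(t, x). rep L (X t) j x)" if "j \<in> {0, 1, 2, 3}" for j
      using jU[of j] j3(1) that by (cases "j = 3") auto
    show "continuous_on ({0<..} \<times> {-L..L}) (\<lambda>(t, x). rep L (Y t) j x)" if "j \<in> {0, 1, 2, 3}" for j
      using jV[of j] j3(2) that by (cases "j = 3") auto
  qed (fact dom(1) dom(2) VU dU)+
qed

end

section \<open>Parabolic smoothing\<close>

lemma integral_by_parts_Icc:
  fixes f g f1 g1 :: "real \<Rightarrow> real"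
  assumes ab: "a \<le> b"
    and f: "\<And>x. x \<in> {a..b} \<Longrightarrow> (f has_real_derivative f1 x) (at x within {a..b})"
    and g: "\<And>x. x \<in> {a..b} \<Longrightarrow> (g has_real_derivative g1 x) (at x within {a..b})"
    and c: "continuous_on {a..b} f1" "continuous_on {a..b} g1"
  shows "integral {a..b} (\<lambda>x. f x * g1 x) = f b * g b - f a * g a - integral {a..b} (\<lambda>x. f1 x * g x)"
proof -
  have cf: "continuous_on {a..b} f" "continuous_on {a..b} g"
    by (rule DERIV_continuous_on[OF f] DERIV_continuous_on[OF g]; simp)+
  have "((\<lambda>x. f x * g1 x + f1 x * g x) has_integral (f b * g b - f a * g a)) {a..b}"
    by (intro fundamental_theorem_of_calculus ab)
      (auto simp flip: has_real_derivative_iff_has_vector_derivative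
        intro!: derivative_eq_intros f g)
  moreover have "integral {a..b} (\<lambda>x. f x * g1 x + f1 x * g x) =
      integral {a..b} (\<lambda>x. f x * g1 x) + integral {a..b} (\<lambda>x. f1 x * g x)"
    by (intro Henstock_Kurzweil_Integration.integral_add integrable_continuous_real continuous_intros cf c)
  ultimately show ?thesis by (simp add: integral_unique)
qed

lemma Cauchy_Schwarz_Icc:
  assumes "continuous_on {a..b} f" "continuous_on {a..b} g"
  shows "\<bar>integral {a..b} (\<lambda>x. f x * g x)\<bar> \<le> L2_norm_on {a<..<b} f * L2_norm_on {a<..<b} g"
  using L2_Cauchy_Schwarz[OF continuous_L2_on[OF assms(1)] continuous_L2_on[OF assms(2)]]
  by (simp add: LINT_continuous continuous_on_mult assms)

text \<open>The dispersive term contributes only the boundary value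
  \<open>- (F1 (-L))^2 / 2\<close>, since \<open>F1\<close> vanishes at \<open>L\<close>; its sign
  is favourable and it is dropped.\<close>

lemma dom3_dissipative:
  assumes L: "0 < L" and F: "dom3 L F F1 F2 F3"
  shows "integral {-L..L} (\<lambda>x. F x * (F2 x - F3 x)) \<le> - integral {-L..L} (\<lambda>x. (F1 x)\<^sup>2)"
proof -
  note d = dom3D[OF F]
  have LL: "-L \<le> L" using L by simp
  have "integral {-L..L} (\<lambda>x. F x * F2 x) = - integral {-L..L} (\<lambda>x. F1 x * F1 x)"
    using integral_by_parts_Icc[OF LL d(1,2,5,6)] d(8,9) by simp
  moreover have "integral {-L..L} (\<lambda>x. F x * F3 x) = - integral {-L..L} (\<lambda>x. F1 x * F2 x)"
    using integral_by_parts_Icc[OF LL d(1,3,5,7)] d(8,9) by simp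
  moreover have "2 * integral {-L..L} (\<lambda>x. F1 x * F2 x) = - (F1 (-L))\<^sup>2"
    using integral_by_parts_Icc[OF LL d(2,2,6,6)] d(10) by (simp add: power2_eq_square mult.commute)
  moreover have "integral {-L..L} (\<lambda>x. F x * (F2 x - F3 x)) =
      integral {-L..L} (\<lambda>x. F x * F2 x) - integral {-L..L} (\<lambda>x. F x * F3 x)"
    unfolding right_diff_distrib
    by (intro Henstock_Kurzweil_Integration.integral_diff integrable_continuous_real continuous_intros d)
  moreover have "0 \<le> (F1 (-L))\<^sup>2" by simp
  ultimately show ?thesis unfolding power2_eq_square by linarith
qed

text \<open>\<open>X\<close>, \<open>Y\<close>, \<open>Z\<close>, \<open>W\<close> stand for the
  norms of \<open>F1\<close>, \<open>F2\<close>, \<open>A F\<close> and the derivative of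
  \<open>A F\<close>. The task is to eliminate \<open>Y\<close>: the first inequality becomes
  \<open>Y^3 \<le> c^2 X Z^2\<close>, and the cube of \<open>Z^2 \<le> W (M + 1) Y\<close> then
  yields \<open>Z^4 \<le> D W^3 X\<close>. Squaring makes the exponents of \<open>W\<close> and
  \<open>X\<close> even, as for the dissipations.\<close>

lemma interpolation_algebra:
  fixes X Y Z W K M :: real
  assumes nn: "0 \<le> X" "0 \<le> Y" "0 \<le> Z" "0 \<le> W" "0 \<le> K" "0 \<le> M"
    and Y: "Y\<^sup>2 \<le> sqrt (2 * (X * Y)) * (K * Z) + X * Y + X * Z"
    and XY: "X \<le> M * Y" and YZ: "Y \<le> K * Z" and Z: "Z\<^sup>2 \<le> W * (X + Y)"
  shows "Z ^ 8 \<le> (((sqrt 2 * K + (K + 1) * sqrt M)\<^sup>2 * (M + 1) ^ 3))\<^sup>2 * (W ^ 6 * X\<^sup>2)"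
proof -
  define c where "c = sqrt 2 * K + (K + 1) * sqrt M"
  define D where "D = c\<^sup>2 * (M + 1) ^ 3"
  have c: "0 \<le> c" using nn by (simp add: c_def)
  have D: "0 \<le> D" using nn by (simp add: D_def)
  \<comment> \<open>One half of the power of \<open>X\<close> is traded for \<open>Y\<close>, so
    that every term in the bound for \<open>Y^2\<close> carries the same factor
    \<open>sqrt (X * Y) * Z\<close>.\<close>
  have sX: "X \<le> sqrt M * sqrt (X * Y)"
  proof -
    have "X * X \<le> X * (M * Y)" using XY nn(1) by (rule mult_left_mono)
    then have "sqrt (X * X) \<le> sqrt (M * (X * Y))" by (intro real_sqrt_le_mono) (simp add: mult_ac)
    then show ?thesis using nn by (simp add: real_sqrt_mult)
  qed
  have "X * Y + X * Z \<le> X * (K * Z) + X * Z"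
    using mult_left_mono[OF YZ nn(1)] by simp
  also have "\<dots> = X * ((K + 1) * Z)" by (simp add: algebra_simps)
  also have "\<dots> \<le> (sqrt M * sqrt (X * Y)) * ((K + 1) * Z)"
    using nn by (intro mult_right_mono[OF sX]) simp
  finally have "Y\<^sup>2 \<le> sqrt 2 * sqrt (X * Y) * (K * Z) + sqrt M * sqrt (X * Y) * ((K + 1) * Z)"
    using Y by (simp add: real_sqrt_mult)
  also have "\<dots> = c * sqrt (X * Y) * Z" by (simp add: c_def algebra_simps)
  finally have Y2: "Y\<^sup>2 \<le> c * sqrt (X * Y) * Z" .
  have "(Y\<^sup>2)\<^sup>2 \<le> (c * sqrt (X * Y) * Z)\<^sup>2" using Y2 by (rule power_mono) simp
  also have "\<dots> = c\<^sup>2 * (X * Y) * Z\<^sup>2" using nn by (simp add: power_mult_distrib)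
  finally have Y4: "Y * Y ^ 3 \<le> Y * (c\<^sup>2 * (X * Z\<^sup>2))" by (simp add: eval_nat_numeral mult_ac)
  have Y3: "Y ^ 3 \<le> c\<^sup>2 * (X * Z\<^sup>2)"
  proof (cases "Y = 0")
    case False
    then show ?thesis using Y4 nn by (simp add: mult_le_cancel_left)
  qed (use nn in simp)
  have "Z\<^sup>2 \<le> W * ((M + 1) * Y)"
    using Z mult_left_mono[of "X + Y" "(M + 1) * Y" W] XY nn by (simp add: algebra_simps)
  then have "(Z\<^sup>2) ^ 3 \<le> (W * ((M + 1) * Y)) ^ 3" by (rule power_mono) simp
  also have "\<dots> = W ^ 3 * (M + 1) ^ 3 * Y ^ 3" by (simp add: power_mult_distrib)
  also have "\<dots> \<le> W ^ 3 * (M + 1) ^ 3 * (c\<^sup>2 * (X * Z\<^sup>2))"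
    using nn by (intro mult_left_mono[OF Y3]) simp
  finally have Z6: "Z\<^sup>2 * Z ^ 4 \<le> Z\<^sup>2 * (D * (W ^ 3 * X))" by (simp add: D_def eval_nat_numeral mult_ac)
  have "Z ^ 4 \<le> D * (W ^ 3 * X)"
  proof (cases "Z = 0")
    case False
    then show ?thesis using mult_le_cancel_left_pos[of "Z\<^sup>2" "Z ^ 4" "D * (W ^ 3 * X)"] Z6 by simp
  qed (use nn D in simp)
  then have "(Z ^ 4)\<^sup>2 \<le> (D * (W ^ 3 * X))\<^sup>2" by (rule power_mono) simp
  then show ?thesis by (simp add: D_def c_def power_mult_distrib flip: power_mult)
qed

text \<open>Interpolation between \<open>H\<^sup>1\<close> of \<open>F\<close> and \<open>H\<^sup>1\<close> of \<open>A F\<close>; the exponents are not optimal,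
  because of the crude bound for the trace of \<open>F2\<close>.\<close>

lemma dom3_interpolation:
  assumes L: "0 < L"
  obtains C where "0 < C" "\<And>F F1 F2 F3 G G1 G2 G3. dom3 L F F1 F2 F3 \<Longrightarrow> dom3 L G G1 G2 G3 \<Longrightarrow>
    (\<forall>x\<in>{-L..L}. G x = F2 x - F3 x) \<Longrightarrow>
    L2_norm_on {-L<..<L} G ^ 8 \<le> C * (L2_norm_on {-L<..<L} G1 ^ 6 * (L2_norm_on {-L<..<L} F1)\<^sup>2)"
proof -
  let ?N = "L2_norm_on {-L<..<L}" and ?I = "integral {-L..L}"
  have LL: "-L \<le> L" using L by simp
  obtain K0 where K0: "0 < K0" "\<And>F F1 F2 F3 x. dom3 L F F1 F2 F3 \<Longrightarrow> x \<in> {-L..L} \<Longrightarrow>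
    \<bar>F x\<bar> \<le> K0 * ?N (\<lambda>x. F2 x - F3 x) \<and> \<bar>F1 x\<bar> \<le> K0 * ?N (\<lambda>x. F2 x - F3 x) \<and>
    \<bar>F2 x\<bar> \<le> K0 * ?N (\<lambda>x. F2 x - F3 x)"
    by (rule dom3_sup_bound[OF L], rule that; assumption)
  define K where "K = K0 * (1 + sqrt (2 * L))"
  have K: "K0 \<le> K" "K0 * sqrt (2 * L) \<le> K" "0 \<le> K" using K0(1) L by (auto simp: K_def algebra_simps)
  define C where "C = (((sqrt 2 * K + (K + 1) * sqrt (2 * L))\<^sup>2 * (2 * L + 1) ^ 3))\<^sup>2"
  have "0 < sqrt 2 * K + (K + 1) * sqrt (2 * L)"
    using K L by (intro add_nonneg_pos mult_pos_pos) auto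
  then have "0 < C" using L by (simp add: C_def)
  moreover have "?N G ^ 8 \<le> C * (?N G1 ^ 6 * (?N F1)\<^sup>2)"
    if F: "dom3 L F F1 F2 F3" and G: "dom3 L G G1 G2 G3"
      and eq: "\<forall>x\<in>{-L..L}. G x = F2 x - F3 x" for F F1 F2 F3 G G1 G2 G3
    unfolding C_def
  proof (rule interpolation_algebra[where Y = "?N F2"])
    note f = dom3D[OF F] and g = dom3D[OF G]
    have NG: "?N (\<lambda>x. F2 x - F3 x) = ?N G"
      by (rule L2_norm_cong[OF ae_eq_onI continuous_L2_on[OF dom3_continuous_op[OF F]] continuous_L2_on[OF g(4)]])
        (simp add: eq)
    have sup2: "\<bar>F2 x\<bar> \<le> K0 * ?N G" if "x \<in> {-L..L}" for x
      using K0(2)[OF F that] NG by simp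
    show "?N F2 \<le> K * ?N G"
    proof -
      have "?N F2 \<le> (K0 * ?N G) * sqrt (L - - L)"
        by (rule L2_norm_uniform_bound[OF LL L2_onD(1)[OF continuous_L2_on[OF f(6)]]])
          (use sup2 K0 in \<open>auto intro: mult_nonneg_nonneg L2_norm_nonneg\<close>)
      also have "\<dots> = (K0 * sqrt (2 * L)) * ?N G" by simp
      also have "\<dots> \<le> K * ?N G" by (rule mult_right_mono[OF K(2) L2_norm_nonneg])
      finally show ?thesis .
    qed
    show "?N F1 \<le> 2 * L * ?N F2"
    proof -
      have "\<bar>F1 x\<bar> \<le> sqrt (2 * L) * ?N F2" if x: "x \<in> {-L<..<L}" for x
      proof -
        have "(F2 has_integral F1 L - F1 x) {x..L}"
        proof (rule fundamental_theorem_of_calculus)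
          fix z assume "z \<in> {x..L}"
          then show "(F1 has_vector_derivative F2 z) (at z within {x..L})"
            unfolding has_real_derivative_iff_has_vector_derivative[symmetric]
            by (intro has_field_derivative_subset[OF f(2)]) (use x in auto)
        qed (use x in simp)
        then have "\<bar>F1 x\<bar> = \<bar>integral {x..L} F2\<bar>" using f(10) by (simp add: integral_unique)
        also have "\<dots> \<le> sqrt (L - - L) * ?N F2"
          by (rule integral_Icc_abs_bound[OF continuous_L2_on[OF f(6)]]) (use x in auto)
        finally show ?thesis by simp
      qed
      then have "?N F1 \<le> (sqrt (2 * L) * ?N F2) * sqrt (L - - L)"
        by (intro L2_norm_uniform_bound[OF LL L2_onD(1)[OF continuous_L2_on[OF f(5)]]])
          (use L in \<open>auto intro: mult_nonneg_nonneg L2_norm_nonneg\<close>)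
      also have "\<dots> = 2 * L * ?N F2" using L by simp
      finally show ?thesis .
    qed
    \<comment> \<open>One factor \<open>G\<close> is replaced by \<open>F2 - F3\<close> and both
      products are integrated by parts; no boundary term survives because \<open>G\<close> vanishes
      at both ends.\<close>
    show "(?N G)\<^sup>2 \<le> ?N G1 * (?N F1 + ?N F2)"
    proof -
      have "(?N G)\<^sup>2 = ?I (\<lambda>x. (G x)\<^sup>2)" by (rule L2_norm_continuous[OF g(4)])
      also have "\<dots> = ?I (\<lambda>x. G x * F2 x - G x * F3 x)"
        by (rule integral_cong) (simp add: eq power2_eq_square algebra_simps)
      also have "\<dots> = ?I (\<lambda>x. G x * F2 x) - ?I (\<lambda>x. G x * F3 x)"
        by (intro Henstock_Kurzweil_Integration.integral_diff integrable_continuous_real continuous_intros f g)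
      also have "\<dots> = - ?I (\<lambda>x. G1 x * F1 x) + ?I (\<lambda>x. G1 x * F2 x)"
        using integral_by_parts_Icc[OF LL g(1) f(2) g(5) f(6)]
          integral_by_parts_Icc[OF LL g(1) f(3) g(5) f(7)] g(8,9) by simp
      also have "\<dots> \<le> ?N G1 * ?N F1 + ?N G1 * ?N F2"
        using Cauchy_Schwarz_Icc[OF g(5) f(5)] Cauchy_Schwarz_Icc[OF g(5) f(6)] by linarith
      finally show ?thesis by (simp add: distrib_left)
    qed
    \<comment> \<open>Integration by parts leaves the trace \<open>F2 (-L) * F1 (-L)\<close>. The
      first factor is bounded by the supremum estimate, the second through
      \<open>(F1 (-L))^2 = - 2 \<integral> F1 F2\<close>.\<close>
    show "(?N F2)\<^sup>2 \<le> sqrt (2 * (?N F1 * ?N F2)) * (K * ?N G) + ?N F1 * ?N F2 + ?N F1 * ?N G"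
    proof -
      have "(?N F2)\<^sup>2 = ?I (\<lambda>x. F2 x * F2 x)"
        using L2_norm_continuous[OF f(6)] by (simp add: power2_eq_square)
      also have "\<dots> = - (F2 (-L) * F1 (-L)) - ?I (\<lambda>x. F3 x * F1 x)"
        using integral_by_parts_Icc[OF LL f(3,2) f(7,6)] f(10) by simp
      also have "?I (\<lambda>x. F3 x * F1 x) = ?I (\<lambda>x. F1 x * F2 x - F1 x * G x)"
        by (rule integral_cong) (simp add: eq algebra_simps)
      also have "\<dots> = ?I (\<lambda>x. F1 x * F2 x) - ?I (\<lambda>x. F1 x * G x)"
        by (intro Henstock_Kurzweil_Integration.integral_diff integrable_continuous_real continuous_intros f g)
      finally have "(?N F2)\<^sup>2 \<le> \<bar>F2 (-L)\<bar> * \<bar>F1 (-L)\<bar> + ?N F1 * ?N F2 + ?N F1 * ?N G"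
        using Cauchy_Schwarz_Icc[OF f(5) f(6)] Cauchy_Schwarz_Icc[OF f(5) g(4)]
          abs_mult[of "F2 (-L)" "F1 (-L)"] by linarith
      moreover have "\<bar>F2 (-L)\<bar> * \<bar>F1 (-L)\<bar> \<le> (K * ?N G) * sqrt (2 * (?N F1 * ?N F2))"
      proof (rule mult_mono)
        show "\<bar>F2 (-L)\<bar> \<le> K * ?N G"
          using sup2[of "-L"] L mult_right_mono[OF K(1) L2_norm_nonneg[of "{-L<..<L}" G]] by simp
        have "(F1 (-L))\<^sup>2 = - 2 * ?I (\<lambda>x. F1 x * F2 x)"
          using integral_by_parts_Icc[OF LL f(2,2) f(6,6)] f(10) by (simp add: power2_eq_square mult.commute)
        also have "\<dots> \<le> 2 * (?N F1 * ?N F2)"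
          using Cauchy_Schwarz_Icc[OF f(5) f(6)] by linarith
        finally show "\<bar>F1 (-L)\<bar> \<le> sqrt (2 * (?N F1 * ?N F2))"
          by (simp add: real_le_rsqrt)
      qed (use K in \<open>auto intro: mult_nonneg_nonneg L2_norm_nonneg\<close>)
      ultimately show ?thesis by (simp add: mult.commute)
    qed
  qed (use K L in \<open>auto intro: L2_norm_nonneg\<close>)
  ultimately show ?thesis using that by blast
qed

text \<open>If the inequality failed, then \<open>\<tau> W^2 < 2 Z^2\<close> and
  \<open>16 C X^2 < 2 \<tau>^3 Z^2\<close>; the cube of the first times the second contradicts the
  interpolation inequality. The factor 16 is the product \<open>2^3 * 2\<close> of the two
  right-hand constants, and \<open>4 \<tau>^3 Z^2\<close> is what differentiating the weight in
  \<open>\<tau>^4 Z^2\<close> produces.\<close>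

lemma young_from_interpolation:
  fixes Z W X C \<tau> :: real
  assumes "Z ^ 8 \<le> C * (W ^ 6 * X\<^sup>2)" "0 \<le> \<tau>" "0 < C"
  shows "4 * \<tau> ^ 3 * Z\<^sup>2 \<le> 2 * \<tau> ^ 4 * W\<^sup>2 + 2 * (16 * C) * X\<^sup>2"
proof (rule ccontr)
  assume "\<not> ?thesis"
  then have n: "2 * \<tau> ^ 4 * W\<^sup>2 + 2 * (16 * C) * X\<^sup>2 < 4 * \<tau> ^ 3 * Z\<^sup>2" by simp
  have "0 \<le> 2 * (16 * C) * X\<^sup>2" using assms(3) by (intro mult_nonneg_nonneg) auto
  then have \<tau>: "0 < \<tau>" using n assms(2) by (cases "\<tau> = 0") auto
  have nn: "0 \<le> \<tau> ^ 4 * W\<^sup>2" "0 \<le> C * X\<^sup>2" using \<tau> assms by auto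
  have "\<tau> ^ 3 * (\<tau> * W\<^sup>2) < \<tau> ^ 3 * (2 * Z\<^sup>2)"
    using n nn by (simp add: eval_nat_numeral mult_ac)
  then have 1: "\<tau> * W\<^sup>2 < 2 * Z\<^sup>2" using \<tau> by simp
  have 2: "16 * C * X\<^sup>2 < 2 * \<tau> ^ 3 * Z\<^sup>2" using n nn by linarith
  have "(\<tau> * W\<^sup>2) ^ 3 \<le> (2 * Z\<^sup>2) ^ 3" using 1 \<tau> by (intro power_mono) auto
  moreover have "0 < (2 * Z\<^sup>2) ^ 3"
    using 1 \<tau> by (intro zero_less_power) (meson le_less_trans mult_nonneg_nonneg less_imp_le zero_le_power2)
  moreover have "0 \<le> 16 * C * X\<^sup>2" using assms(3) by simp
  ultimately have "(\<tau> * W\<^sup>2) ^ 3 * (16 * C * X\<^sup>2) < (2 * Z\<^sup>2) ^ 3 * (2 * \<tau> ^ 3 * Z\<^sup>2)"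
    by (blast intro: le_less_trans[OF mult_right_mono mult_strict_left_mono[OF 2]])
  then have "\<tau> ^ 3 * (16 * (C * (W ^ 6 * X\<^sup>2))) < \<tau> ^ 3 * (16 * Z ^ 8)"
    by (simp add: power_mult_distrib eval_nat_numeral mult_ac)
  then show False using \<tau> assms(1) by simp
qed

lemma leibniz_rule_Icc:
  fixes f f' :: "real \<Rightarrow> real \<Rightarrow> real"
  assumes t: "t \<in> A" and A: "open A" "convex A"
    and d: "\<And>r x. r \<in> A \<Longrightarrow> x \<in> {a..b} \<Longrightarrow> ((\<lambda>r. f r x) has_real_derivative f' r x) (at r)"
    and c: "\<And>r. r \<in> A \<Longrightarrow> continuous_on {a..b} (f r)"
    and c': "continuous_on (A \<times> {a..b}) (\<lambda>(t, x). f' t x)"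
  shows "((\<lambda>r. integral {a..b} (f r)) has_real_derivative integral {a..b} (f' t)) (at t)"
proof -
  have "((\<lambda>r. integral (cbox a b) (f r)) has_real_derivative integral (cbox a b) (f' t)) (at t within A)"
    by (rule leibniz_rule_field_derivative)
      (use t A d c c' in \<open>auto intro: has_field_derivative_at_within integrable_continuous_real\<close>)
  then show ?thesis using t A by (simp add: at_within_open[of t A])
qed

lemma uniform_limit_real_derivative:
  fixes f f1 :: "nat \<Rightarrow> real \<Rightarrow> real"
  assumes d: "\<And>n x. x \<in> {a..b} \<Longrightarrow> (f n has_real_derivative f1 n x) (at x within {a..b})"
    and f: "\<And>n x. x \<in> {a..b} \<Longrightarrow> \<bar>f n x - g x\<bar> \<le> e n"
    and f1: "\<And>n x. x \<in> {a..b} \<Longrightarrow> \<bar>f1 n x - g1 x\<bar> \<le> e n"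
    and e: "e \<longlonglongrightarrow> 0" and x: "x \<in> {a..b}"
  shows "(g has_real_derivative g1 x) (at x within {a..b})"
proof -
  have lim: "(\<lambda>n. f n y) \<longlonglongrightarrow> g y" if "y \<in> {a..b}" for y
    by (rule LIM_zero_cancel, rule Lim_null_comparison[OF _ e]) (use f[OF that] in auto)
  have "\<exists>h. \<forall>y\<in>{a..b}. (\<lambda>n. f n y) \<longlonglongrightarrow> h y \<and> (h has_derivative (*) (g1 y)) (at y within {a..b})"
  proof (rule has_derivative_sequence[where f = f and f' = "\<lambda>n y. (*) (f1 n y)", OF _ _ _ x lim[OF x]])
    show "(f n has_derivative (*) (f1 n y)) (at y within {a..b})" if "y \<in> {a..b}" for n y
      using d[OF that] by (simp add: has_field_derivative_def)
    fix r :: real assume "0 < r"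
    then have "\<forall>\<^sub>F n in sequentially. e n < r" using e by (intro order_tendstoD)
    then show "\<forall>\<^sub>F n in sequentially. \<forall>y\<in>{a..b}. \<forall>h. norm (f1 n y * h - g1 y * h) \<le> r * norm h"
    proof eventually_elim
      case (elim n)
      show ?case
      proof (intro ballI allI)
        fix y h assume "y \<in> {a..b}"
        then have "\<bar>f1 n y - g1 y\<bar> * \<bar>h\<bar> \<le> r * \<bar>h\<bar>"
          using f1[of y n] elim by (intro mult_right_mono) auto
        then show "norm (f1 n y * h - g1 y * h) \<le> r * norm h"
          by (simp add: abs_mult flip: left_diff_distrib)
      qed
    qed
  qed simp
  then obtain h where h: "\<And>y. y \<in> {a..b} \<Longrightarrow> (\<lambda>n. f n y) \<longlonglongrightarrow> h y"
    "\<And>y. y \<in> {a..b} \<Longrightarrow> (h has_derivative (*) (g1 y)) (at y within {a..b})" by blast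
  have "h y = g y" if "y \<in> {a..b}" for y using LIMSEQ_unique[OF h(1)[OF that] lim[OF that]] .
  then have "(g has_derivative (*) (g1 x)) (at x within {a..b})"
    by (intro has_derivative_transform[OF x _ h(2)[OF x]]) simp
  then show ?thesis by (simp add: has_field_derivative_def)
qed

context kdv_burgers
begin

text \<open>The regularity of the orbit is a hypothesis here, so that the bound can first be used
  for test functions, where it is known. Once every orbit is seen to be regular at positive times,
  the bound covers all of L2.\<close>

lemma smoothing_bound:
  obtains C where "0 < C" "\<And>u0 t g. u0 \<in> L2_on \<Omega> \<Longrightarrow> (\<And>t. 0 < t \<Longrightarrow> Adom L 5 (S t u0)) \<Longrightarrow> 0 < t \<Longrightarrow>
    (S t u0, g) \<in> A_graph L \<Longrightarrow> t\<^sup>2 * N g \<le> C * N u0"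
proof -
  let ?I = "integral {-L..L}"
  obtain C where C: "0 < C" "\<And>F F1 F2 F3 G G1 G2 G3. dom3 L F F1 F2 F3 \<Longrightarrow> dom3 L G G1 G2 G3 \<Longrightarrow>
    (\<forall>x\<in>{-L..L}. G x = F2 x - F3 x) \<Longrightarrow>
    N G ^ 8 \<le> C * (N G1 ^ 6 * (N F1)\<^sup>2)"
    by (rule dom3_interpolation[OF L], rule that; assumption)
  \<comment> \<open>The constant \<open>K\<close> of the overview, as dictated by
    \<open>young_from_interpolation\<close>.\<close>
  define \<kappa> where "\<kappa> = 16 * C"
  have "t\<^sup>2 * N g \<le> (4 * sqrt \<kappa>) * N u0"
    if u0: "u0 \<in> L2_on \<Omega>" and dom: "\<And>t. 0 < t \<Longrightarrow> Adom L 5 (S t u0)" and t: "0 < t"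
      and A: "(S t u0, g) \<in> A_graph L" for u0 t g
  proof -
    obtain U V :: "nat \<Rightarrow> real \<Rightarrow> real \<Rightarrow> real" where
      dU: "\<And>t. 0 < t \<Longrightarrow> dom3 L (U 0 t) (U 1 t) (U 2 t) (U 3 t)"
      and SU: "\<And>t. 0 < t \<Longrightarrow> S t u0 \<doteq> U 0 t"
      and dV: "\<And>t. 0 < t \<Longrightarrow> dom3 L (V 0 t) (V 1 t) (V 2 t) (V 3 t)"
      and VU: "\<And>t x. 0 < t \<Longrightarrow> x \<in> {-L..L} \<Longrightarrow> V 0 t x = U 2 t x - U 3 t x"
      and tU: "\<And>t x j. 0 < t \<Longrightarrow> x \<in> {-L..L} \<Longrightarrow> j \<in> {0, 1, 2} \<Longrightarrow>
        ((\<lambda>r. U j r x) has_real_derivative V j t x) (at t)"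
      and tV: "\<And>t x. 0 < t \<Longrightarrow> x \<in> {-L..L} \<Longrightarrow>
        ((\<lambda>r. V 0 r x) has_real_derivative V 2 t x - V 3 t x) (at t)"
      and cU: "\<And>j. j \<in> {0, 1, 2, 3} \<Longrightarrow> continuous_on ({0<..} \<times> {-L..L}) (\<lambda>(t, x). U j t x)"
      and cV: "\<And>j. j \<in> {0, 1, 2, 3} \<Longrightarrow> continuous_on ({0<..} \<times> {-L..L}) (\<lambda>(t, x). V j t x)"
      by (rule classical_solution[OF u0 dom], assumption, rule that; assumption)
    \<comment> \<open>The classical solution exists only at positive times, so the functional starts
      at \<open>t / 2\<close>. Its weight vanishes there, and \<open>(t - \<epsilon>) ^ 4\<close> is
      \<open>t ^ 4 / 16\<close>, whence the factor 4 in the final constant.\<close>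
    define \<epsilon> where "\<epsilon> = t / 2"
    have \<epsilon>: "0 < \<epsilon>" "\<epsilon> < t" using t by (auto simp: \<epsilon>_def)
    define \<Phi> where "\<Phi> r = (r - \<epsilon>) ^ 4 * ?I (\<lambda>x. (V 0 r x)\<^sup>2) + \<kappa> * ?I (\<lambda>x. (U 0 r x)\<^sup>2)" for r
    have D: "(\<Phi> has_real_derivative (4 * (r - \<epsilon>) ^ 3 * ?I (\<lambda>x. (V 0 r x)\<^sup>2)
        + (r - \<epsilon>) ^ 4 * ?I (\<lambda>x. 2 * (V 0 r x * (V 2 r x - V 3 r x)))
        + \<kappa> * ?I (\<lambda>x. 2 * (U 0 r x * V 0 r x)))) (at r)" if r: "0 < r" for r
    proof -
      have "((\<lambda>r. ?I (\<lambda>x. (V 0 r x)\<^sup>2)) has_real_derivative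
          ?I (\<lambda>x. 2 * (V 0 r x * (V 2 r x - V 3 r x)))) (at r)"
        using cV[of 0] cV[of 2] cV[of 3] unfolding split_def
        by (intro leibniz_rule_Icc[where A = "{0<..}"])
          (auto intro!: derivative_eq_intros tV r continuous_intros dom3D(4)[OF dV] simp: split_def)
      moreover have "((\<lambda>r. ?I (\<lambda>x. (U 0 r x)\<^sup>2)) has_real_derivative
          ?I (\<lambda>x. 2 * (U 0 r x * V 0 r x))) (at r)"
        using cV[of 0] cU[of 0] unfolding split_def
        by (intro leibniz_rule_Icc[where A = "{0<..}"])
          (auto intro!: derivative_eq_intros tU r continuous_intros dom3D(4)[OF dU] simp: split_def)
      ultimately show ?thesis
        unfolding \<Phi>_def by (auto intro!: derivative_eq_intros)
    qed
    have neg: "4 * (r - \<epsilon>) ^ 3 * ?I (\<lambda>x. (V 0 r x)\<^sup>2)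
        + (r - \<epsilon>) ^ 4 * ?I (\<lambda>x. 2 * (V 0 r x * (V 2 r x - V 3 r x)))
        + \<kappa> * ?I (\<lambda>x. 2 * (U 0 r x * V 0 r x)) \<le> 0" if r: "\<epsilon> \<le> r" for r
    proof -
      have r0: "0 < r" using r \<epsilon> by simp
      note u = dom3D[OF dU[OF r0]] and v = dom3D[OF dV[OF r0]]
      have "?I (\<lambda>x. V 0 r x * (V 2 r x - V 3 r x)) \<le> - (N (V 1 r))\<^sup>2"
        using dom3_dissipative[OF L dV[OF r0]] by (simp only: L2_norm_continuous[OF v(5)])
      then have 1: "(r - \<epsilon>) ^ 4 * ?I (\<lambda>x. 2 * (V 0 r x * (V 2 r x - V 3 r x))) \<le> - 2 * ((r - \<epsilon>) ^ 4 * (N (V 1 r))\<^sup>2)"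
        using mult_left_mono[of "?I (\<lambda>x. V 0 r x * (V 2 r x - V 3 r x))" "- (N (V 1 r))\<^sup>2" "(r - \<epsilon>) ^ 4"]
        by simp
      have "?I (\<lambda>x. U 0 r x * V 0 r x) = ?I (\<lambda>x. U 0 r x * (U 2 r x - U 3 r x))"
        by (rule integral_cong) (simp add: VU[OF r0])
      then have "?I (\<lambda>x. U 0 r x * V 0 r x) \<le> - (N (U 1 r))\<^sup>2"
        using dom3_dissipative[OF L dU[OF r0]] by (simp only: L2_norm_continuous[OF u(5)])
      then have 2: "\<kappa> * ?I (\<lambda>x. 2 * (U 0 r x * V 0 r x)) \<le> - 2 * (\<kappa> * (N (U 1 r))\<^sup>2)"
        using mult_left_mono[of "?I (\<lambda>x. U 0 r x * V 0 r x)" "- (N (U 1 r))\<^sup>2" \<kappa>] C(1)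
        by (simp add: \<kappa>_def)
      have "4 * (r - \<epsilon>) ^ 3 * (N (V 0 r))\<^sup>2 \<le> 2 * (r - \<epsilon>) ^ 4 * (N (V 1 r))\<^sup>2 + 2 * (16 * C) * (N (U 1 r))\<^sup>2"
        by (rule young_from_interpolation[OF C(2)[OF dU[OF r0] dV[OF r0]]]) (use r C VU[OF r0] in auto)
      then show ?thesis
        using 1 2 unfolding L2_norm_continuous[OF v(4), symmetric] \<kappa>_def by linarith
    qed
    have "\<Phi> t \<le> \<Phi> \<epsilon>"
      by (rule DERIV_nonpos_imp_nonincreasing) (use \<epsilon> D neg in \<open>auto intro: less_le_trans\<close>)
    moreover have "\<Phi> \<epsilon> \<le> \<kappa> * (N u0)\<^sup>2"
    proof -
      note u = dom3D[OF dU[OF \<epsilon>(1)]]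
      have "N (U 0 \<epsilon>) = N (S \<epsilon> u0)"
        by (rule L2_norm_cong[OF ae_eq_on_sym[OF SU[OF \<epsilon>(1)]] continuous_L2_on[OF u(4)] S_L2]) (use \<epsilon> u0 in auto)
      also have "\<dots> \<le> N u0" using \<epsilon> u0 by (intro S_contraction) auto
      finally have "(N (U 0 \<epsilon>))\<^sup>2 \<le> (N u0)\<^sup>2" by (intro power_mono L2_norm_nonneg)
      then show ?thesis
        using C(1) unfolding \<Phi>_def \<kappa>_def by (simp add: L2_norm_continuous[OF u(4)])
    qed
    moreover have "(t - \<epsilon>) ^ 4 * (N g)\<^sup>2 \<le> \<Phi> t"
    proof -
      note u = dom3D[OF dU[OF t]] and v = dom3D[OF dV[OF t]]
      have StL: "S t u0 \<in> L2_on \<Omega>" using t u0 by (intro S_L2) auto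
      have "(S t u0, V 0 t) \<in> A_graph L"
        by (rule dom3_in_A_graph[OF L dU[OF t] StL SU[OF t] continuous_L2_on[OF v(4)]])
          (rule ae_eq_onI, simp add: VU[OF t])
      from L2_norm_cong[OF A_graph_unique[OF A this]] have "N g = N (V 0 t)"
        using A_graph_L2[OF A] continuous_L2_on[OF v(4)] by simp
      moreover have "0 \<le> \<kappa> * (N (U 0 t))\<^sup>2" using C(1) by (simp add: \<kappa>_def)
      ultimately show ?thesis by (simp add: \<Phi>_def L2_norm_continuous[OF u(4)] L2_norm_continuous[OF v(4)])
    qed
    ultimately have "(t - \<epsilon>) ^ 4 * (N g)\<^sup>2 \<le> \<kappa> * (N u0)\<^sup>2" by linarith
    moreover have "16 * ((t - \<epsilon>) ^ 4 * (N g)\<^sup>2) = (t\<^sup>2 * N g)\<^sup>2"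
      unfolding \<epsilon>_def by (simp add: eval_nat_numeral field_simps)
    moreover have "((4 * sqrt \<kappa>) * N u0)\<^sup>2 = 16 * (\<kappa> * (N u0)\<^sup>2)"
      using C(1) by (simp add: power_mult_distrib \<kappa>_def)
    ultimately have "(t\<^sup>2 * N g)\<^sup>2 \<le> ((4 * sqrt \<kappa>) * N u0)\<^sup>2" by linarith
    then show ?thesis
      by (rule power2_le_imp_le) (use C(1) in \<open>auto simp: \<kappa>_def intro!: mult_nonneg_nonneg L2_norm_nonneg\<close>)
  qed
  moreover have "0 < 4 * sqrt \<kappa>" using C(1) by (simp add: \<kappa>_def)
  ultimately show ?thesis using that by blast
qed

lemma Adom_test_function: "test_function_on \<Omega> \<phi> \<Longrightarrow> Adom L n \<phi>"
proof (induction n arbitrary: \<phi>)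
  case 0
  then show ?case by (simp add: test_function_L2_on)
next
  case (Suc n)
  let ?g = "\<lambda>x. deriv (deriv \<phi>) x + -1 * deriv (deriv (deriv \<phi>)) x"
  have g: "test_function_on \<Omega> ?g"
    by (rule test_function_add[OF test_function_deriv[OF test_function_deriv[OF Suc.prems]]
          test_function_cmult[OF test_function_deriv[OF test_function_deriv[OF test_function_deriv[OF Suc.prems]]]]])
  have "(\<phi>, ?g) \<in> A_graph L"
    by (rule dom3_in_A_graph[OF L test_function_dom3[OF Suc.prems] test_function_L2_on[OF Suc.prems]
          ae_eq_on_refl test_function_L2_on[OF g]]) (simp add: ae_eq_on_refl)
  with Suc.IH[OF g] show ?case by auto
qed

end

section \<open>From test functions to all square-integrable data\<close>

context kdv_burgers
begin

lemma A_graph_diff: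
  assumes f: "Adom L 2 f" "(f, g) \<in> A_graph L" and f': "Adom L 2 f'" "(f', g') \<in> A_graph L"
  shows "((\<lambda>x. f x - f' x), (\<lambda>x. g x - g' x)) \<in> A_graph L"
proof -
  note d = dom3_lincomb[OF rep_dom3(1)[OF L f(1)] rep_dom3(1)[OF L f'(1)], of 1 "-1"]
  show ?thesis
  proof (rule dom3_in_A_graph[OF L d])
    show "(\<lambda>x. f x - f' x) \<in> L2_on \<Omega>" "(\<lambda>x. g x - g' x) \<in> L2_on \<Omega>"
      using A_graph_L2[OF f(2)] A_graph_L2[OF f'(2)] by (auto intro: L2_on_diff)
    show "(\<lambda>x. f x - f' x) \<doteq> (\<lambda>x. 1 * rep L f 0 x + -1 * rep L f' 0 x)"
      using rep_dom3(2)[OF L f(1)] rep_dom3(2)[OF L f'(1)] unfolding ae_eq_on_def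
      by eventually_elim simp
    show "(\<lambda>x. g x - g' x) \<doteq> (\<lambda>x. (1 * rep L f 2 x + -1 * rep L f' 2 x) - (1 * rep L f 3 x + -1 * rep L f' 3 x))"
      using rep_A[OF L f] rep_A[OF L f'] unfolding ae_eq_on_def
      by eventually_elim simp
  qed
qed

text \<open>With \<open>r = t / 2\<close>, applying \<open>A\<close> twice to \<open>S t w\<close>
  gives \<open>A S(r)\<close> of \<open>A S(r) w\<close>, so the first-order bound applies twice.
  The second power is what later controls third derivatives.\<close>

lemma smoothing_bound_twice:
  assumes t: "0 < t"
  obtains D where "0 < D" "\<And>w g h. test_function_on \<Omega> w \<Longrightarrow> (S t w, g) \<in> A_graph L \<Longrightarrow> (g, h) \<in> A_graph L \<Longrightarrow>
    N g \<le> D * N w \<and> N h \<le> D * N w"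
proof -
  obtain C where C: "0 < C" "\<And>u0 t g. u0 \<in> L2_on \<Omega> \<Longrightarrow> (\<forall>t>0. Adom L 5 (S t u0)) \<Longrightarrow> 0 < t \<Longrightarrow>
    (S t u0, g) \<in> A_graph L \<Longrightarrow> t\<^sup>2 * N g \<le> C * N u0"
    using smoothing_bound by metis
  define B where "B = C / (t / 2)\<^sup>2"
  have B: "0 < B" using C t by (simp add: B_def)
  have CB: "C / t\<^sup>2 \<le> B" using C(1) t by (auto simp: B_def divide_simps power2_eq_square)
  have "N g \<le> (B + B * B) * N w \<and> N h \<le> (B + B * B) * N w"
    if w: "test_function_on \<Omega> w" and g: "(S t w, g) \<in> A_graph L" and h: "(g, h) \<in> A_graph L" for w g h
  proof -
    define r where "r = t / 2"
    have r: "0 < r" "r + r = t" "0 \<le> r" using t by (auto simp: r_def)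
    have wL: "w \<in> L2_on \<Omega>" by (rule test_function_L2_on[OF w])
    have Aw: "\<forall>t>0. Adom L n (S t w)" for n by (auto intro: Adom_S Adom_test_function[OF w])
    have Nw: "0 \<le> N w" by (rule L2_norm_nonneg)
    have 1: "N g \<le> B * N w"
    proof -
      have "N g \<le> (C / t\<^sup>2) * N w" using C(2)[OF wL Aw t g] t by (simp add: field_simps)
      also have "\<dots> \<le> B * N w" by (rule mult_right_mono[OF CB Nw])
      finally show ?thesis .
    qed
    define y where "y = Aop L (S r w)"
    have y: "(S r w, y) \<in> A_graph L" "Adom L 5 y"
      using Adom_Aop[OF L, of 5 "S r w"] Aw[of 6] r(1) by (simp_all add: y_def eval_nat_numeral)
    have yL: "y \<in> L2_on \<Omega>" using A_graph_L2[OF y(1)] by simp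
    have Ny: "N y \<le> B * N w"
      using C(2)[OF wL Aw r(1) y(1)] r(1) by (simp add: B_def r_def[symmetric] field_simps)
    have "S t w \<doteq> S r (S r w)" using S_add_time[OF r(3,3) wL] r(2) by simp
    from A_graph_cong_left[OF L g S_L2[OF r(3) S_L2[OF r(3) wL]] this]
    have "(S r (S r w), g) \<in> A_graph L" .
    then have "g \<doteq> S r y" by (rule A_graph_unique[OF _ S_graph[OF r(3) y(1)]])
    from A_graph_cong_left[OF L h S_L2[OF r(3) yL] this] have "(S r y, h) \<in> A_graph L" .
    from C(2)[OF yL _ r(1) this] have "N h \<le> B * N y"
      using Adom_S[OF _ y(2)] r(1) by (simp add: B_def r_def[symmetric] field_simps)
    also have "\<dots> \<le> B * (B * N w)" using Ny B by (intro mult_left_mono) auto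
    finally have 2: "N h \<le> B * (B * N w)" .
    have "0 \<le> B * N w" "0 \<le> B * (B * N w)" using B Nw by auto
    with 1 2 show ?thesis by (simp add: distrib_right mult.assoc)
  qed
  moreover have "0 < B + B * B" using B by (simp add: add_pos_pos)
  ultimately show ?thesis using that by blast
qed

text \<open>For test functions approximating \<open>u0\<close>, the representatives at time
  \<open>t\<close> are uniformly Cauchy together with three derivatives: up to order two through the
  graph norm, the third through a uniform bound on \<open>A S(t)\<close> of differences, which comes
  from the second power. The uniform limit is classical and represents
  \<open>S t u0\<close>.\<close>

lemma S_into_domain:
  assumes u0: "u0 \<in> L2_on \<Omega>" and t: "0 < t"
  shows "\<exists>g. (S t u0, g) \<in> A_graph L"
proof -
  have LL: "-L < L" using L by simp
  have t0: "0 \<le> t" using t by simp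
  define e where "e n = 1 / (real n + 1)" for n
  have e: "0 < e n" for n by (simp add: e_def)
  have elim: "e \<longlonglongrightarrow> 0"
    unfolding e_def using LIMSEQ_inverse_real_of_nat by (simp add: inverse_eq_divide add.commute)
  have "\<exists>\<phi>. test_function_on \<Omega> \<phi> \<and> N (\<lambda>x. u0 x - \<phi> x) < e n" for n
    using test_functions_dense_L2[OF LL u0 e[of n]] by blast
  then obtain f where f: "\<And>n. test_function_on \<Omega> (f n)" "\<And>n. N (\<lambda>x. u0 x - f n x) < e n" by metis
  have fL: "f n \<in> L2_on \<Omega>" for n by (rule test_function_L2_on[OF f(1)])
  have ff: "N (\<lambda>x. f n x - f m x) \<le> e n + e m" for n m
    using L2_norm_triangle_diff[OF fL[of n] u0 fL[of m]] f(2)[of n] f(2)[of m]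
      L2_norm_minus_commute[of \<Omega> "f n" u0] by simp
  define v where "v n = S t (f n)" for n
  define a where "a n = Aop L (v n)" for n
  define b where "b n = Aop L (a n)" for n
  have v: "Adom L 4 (v n)" for n unfolding v_def by (intro Adom_S t0 Adom_test_function f)
  have a: "(v n, a n) \<in> A_graph L" "Adom L 3 (a n)" for n
    using Adom_Aop[OF L, of 3 "v n"] v[of n] by (simp_all add: a_def eval_nat_numeral)
  have b: "(a n, b n) \<in> A_graph L" for n
    using Adom_Aop[OF L, of 2 "a n"] a(2)[of n] by (simp_all add: b_def eval_nat_numeral)
  have v2: "Adom L 2 (v n)" and a2: "Adom L 2 (a n)" for n
    by (rule Adom_mono[OF v] Adom_mono[OF a(2)]; simp)+
  obtain D where D: "0 < D" "\<And>w g h. test_function_on \<Omega> w \<Longrightarrow> (S t w, g) \<in> A_graph L \<Longrightarrow> (g, h) \<in> A_graph L \<Longrightarrow>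
    N g \<le> D * N w \<and> N h \<le> D * N w"
    by (rule smoothing_bound_twice[OF t], rule that; assumption)
  obtain K where K: "0 < K" "\<And>P P1 P2 P3 g x. dom3 L P P1 P2 P3 \<Longrightarrow> g \<in> L2_on \<Omega> \<Longrightarrow>
    g \<doteq> (\<lambda>x. P2 x - P3 x) \<Longrightarrow> x \<in> {-L..L} \<Longrightarrow>
    \<bar>P x\<bar> \<le> K * N g \<and> \<bar>P1 x\<bar> \<le> K * N g \<and> \<bar>P2 x\<bar> \<le> K * N g"
    by (rule rep_sup_bound, rule that; assumption)
  have ab: "N (\<lambda>x. a n x - a m x) \<le> D * (e n + e m) \<and> N (\<lambda>x. b n x - b m x) \<le> D * (e n + e m)" for n m
  proof -
    have w: "test_function_on \<Omega> (\<lambda>x. f n x - f m x)"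
      using test_function_add[OF f(1)[of n] test_function_cmult[OF f(1)[of m], of "-1"]] by simp
    note dv = A_graph_diff[OF v2 a(1) v2 a(1), of n m] and da = A_graph_diff[OF a2 b a2 b, of n m]
    have "(S t (\<lambda>x. f n x - f m x), \<lambda>x. a n x - a m x) \<in> A_graph L"
      by (rule A_graph_cong_left[OF L dv S_L2[OF t0 L2_on_diff[OF fL fL]] ae_eq_on_sym])
        (use S_diff[OF t0 fL fL, of n m] in \<open>simp add: v_def\<close>)
    from D(2)[OF w this da] have "N (\<lambda>x. a n x - a m x) \<le> D * N (\<lambda>x. f n x - f m x) \<and>
      N (\<lambda>x. b n x - b m x) \<le> D * N (\<lambda>x. f n x - f m x)" .
    moreover have "D * N (\<lambda>x. f n x - f m x) \<le> D * (e n + e m)"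
      using ff D(1) by (intro mult_left_mono) auto
    ultimately show ?thesis by linarith
  qed
  define R where "R n j x = rep L (v n) j x" for n j x
  \<comment> \<open>The factor 2 is due to the third derivative, a difference of two functions that
    each satisfy the bound with \<open>K * D\<close>.\<close>
  define E where "E = 2 * (K * D)"
  have E: "0 < E" using K(1) D(1) by (simp add: E_def)
  have dR: "dom3 L (R n 0) (R n 1) (R n 2) (R n 3)" for n
    unfolding R_def by (rule rep_dom3(1)[OF L v2])
  have aR: "a n \<doteq> (\<lambda>x. R n 2 x - R n 3 x)" for n unfolding R_def by (rule rep_A[OF L v2 a(1)])
  have R012: "\<bar>R n j x - R m j x\<bar> \<le> K * (D * (e n + e m))" if x: "x \<in> {-L..L}" and j: "j \<in> {0,1,2}" for n m j x
  proof -
    have g: "(\<lambda>x. a n x - a m x) \<doteq> (\<lambda>x. (1 * R n 2 x + -1 * R m 2 x) - (1 * R n 3 x + -1 * R m 3 x))"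
      using aR[of n] aR[of m] unfolding ae_eq_on_def by eventually_elim simp
    have "\<bar>R n j x - R m j x\<bar> \<le> K * N (\<lambda>x. a n x - a m x)"
      using K(2)[OF dom3_lincomb[OF dR dR] L2_on_diff[OF Adom_L2[OF a2] Adom_L2[OF a2]] g x] j by auto
    also have "\<dots> \<le> K * (D * (e n + e m))" using ab K(1) by (intro mult_left_mono) auto
    finally show ?thesis .
  qed
  have Ra: "\<bar>rep L (a n) 0 x - rep L (a m) 0 x\<bar> \<le> K * (D * (e n + e m))" if x: "x \<in> {-L..L}" for n m x
  proof -
    note d = rep_dom3(1)[OF L a2]
    have g: "(\<lambda>x. b n x - b m x) \<doteq> (\<lambda>x. (1 * rep L (a n) 2 x + -1 * rep L (a m) 2 x)
        - (1 * rep L (a n) 3 x + -1 * rep L (a m) 3 x))"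
      using rep_A[OF L a2 b, of n] rep_A[OF L a2 b, of m] unfolding ae_eq_on_def by eventually_elim simp
    have bL: "b n \<in> L2_on \<Omega>" for n using A_graph_L2[OF b] by simp
    have "\<bar>rep L (a n) 0 x - rep L (a m) 0 x\<bar> \<le> K * N (\<lambda>x. b n x - b m x)"
      using K(2)[OF dom3_lincomb[OF d d] L2_on_diff[OF bL bL] g x] by auto
    also have "\<dots> \<le> K * (D * (e n + e m))" using ab K(1) by (intro mult_left_mono) auto
    finally show ?thesis .
  qed
  \<comment> \<open>The third derivative is the second derivative minus the representative of
    \<open>A\<close> applied to the function, so \<open>R012\<close> and \<open>Ra\<close> add
    up.\<close>
  have R: "\<bar>R n j x - R m j x\<bar> \<le> E * (e n + e m)" if x: "x \<in> {-L..L}" and j: "j \<le> 3" for n m j x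
  proof (cases "j = 3")
    case True
    have "R n 3 x = R n 2 x - rep L (a n) 0 x" for n
      using rep_A_eq[OF L v2 a(1) a2 x] by (simp add: R_def)
    then show ?thesis using Ra[OF x, of n m] R012[OF x, of 2 n m] True by (simp add: E_def)
  next
    case False
    then have "j \<in> {0,1,2}" using j by auto
    moreover have "0 \<le> K * (D * (e n + e m))"
      using K(1) D(1) e[of n] e[of m] by (intro mult_nonneg_nonneg) auto
    ultimately show ?thesis using R012[OF x, of j n m] by (simp add: E_def)
  qed
  define F where "F j x = lim (\<lambda>n. R n j x)" for j x
  have RF: "(\<lambda>n. R n j x) \<longlonglongrightarrow> F j x" if x: "x \<in> {-L..L}" and j: "j \<le> 3" for j x
  proof -
    have "Cauchy (\<lambda>n. R n j x)"
    proof (rule CauchyI)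
      fix d :: real assume d: "0 < d"
      then have "\<forall>\<^sub>F n in sequentially. e n < d / (2 * E)" using elim E by (intro order_tendstoD) auto
      then obtain M where M: "\<And>n. n \<ge> M \<Longrightarrow> e n < d / (2 * E)" by (auto simp: eventually_sequentially)
      have "norm (R m j x - R n j x) < d" if "m \<ge> M" "n \<ge> M" for m n
      proof -
        have "E * (e m + e n) < E * (d / (2 * E) + d / (2 * E))"
          using M[OF that(1)] M[OF that(2)] E by (intro mult_strict_left_mono) auto
        also have "\<dots> = d" using E by simp
        finally show ?thesis using R[OF x j, of m n] by simp
      qed
      then show "\<exists>M. \<forall>m\<ge>M. \<forall>n\<ge>M. norm (R m j x - R n j x) < d" by blast
    qed
    then show ?thesis unfolding F_def by (simp add: Cauchy_convergent_iff convergent_LIMSEQ_iff)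
  qed
  have unif: "\<bar>R n j x - F j x\<bar> \<le> E * e n" if x: "x \<in> {-L..L}" and j: "j \<le> 3" for n j x
  proof (rule LIMSEQ_le)
    show "(\<lambda>m. \<bar>R n j x - R m j x\<bar>) \<longlonglongrightarrow> \<bar>R n j x - F j x\<bar>" by (intro tendsto_intros RF x j)
    have "(\<lambda>m. E * (e n + e m)) \<longlonglongrightarrow> E * (e n + 0)" by (intro tendsto_intros elim)
    then show "(\<lambda>m. E * (e n + e m)) \<longlonglongrightarrow> E * e n" by simp
    show "\<exists>N. \<forall>m\<ge>N. \<bar>R n j x - R m j x\<bar> \<le> E * (e n + e m)" using R[OF x j] by blast
  qed
  have Ee: "(\<lambda>n. E * e n) \<longlonglongrightarrow> 0" using tendsto_mult[OF tendsto_const[of E] elim] by simp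
  have dF: "(F 0 has_real_derivative F 1 x) (at x within {-L..L})"
    "(F 1 has_real_derivative F 2 x) (at x within {-L..L})"
    "(F 2 has_real_derivative F 3 x) (at x within {-L..L})" if x: "x \<in> {-L..L}" for x
    by (rule uniform_limit_real_derivative[OF dom3D(1)[OF dR] unif unif Ee x]
        uniform_limit_real_derivative[OF dom3D(2)[OF dR] unif unif Ee x]
        uniform_limit_real_derivative[OF dom3D(3)[OF dR] unif unif Ee x]; simp)+
  have cF3: "continuous_on {-L..L} (F 3)"
  proof (rule uniform_limit_theorem)
    show "uniform_limit {-L..L} (\<lambda>n. R n 3) (F 3) sequentially"
    proof (rule uniform_limitI)
      fix d :: real assume "0 < d"
      then have "\<forall>\<^sub>F n in sequentially. E * e n < d" using Ee by (intro order_tendstoD) auto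
      then show "\<forall>\<^sub>F n in sequentially. \<forall>x\<in>{-L..L}. dist (R n 3 x) (F 3 x) < d"
      proof eventually_elim
          case (elim n)
          show ?case
          proof
            fix x assume "x \<in> {-L..L}"
            from unif[OF this, of 3 n] elim show "dist (R n 3 x) (F 3 x) < d" by (simp add: dist_real_def)
          qed
        qed
    qed
    show "\<forall>\<^sub>F n in sequentially. continuous_on {-L..L} (R n 3)" using dom3D(7)[OF dR] by simp
  qed simp
  have bc: "F 0 (-L) = 0" "F 0 L = 0" "F 1 L = 0"
    using LIMSEQ_unique[OF RF[of "-L" 0]] LIMSEQ_unique[OF RF[of L 0]] LIMSEQ_unique[OF RF[of L 1]]
      dom3D(8-10)[OF dR] L by auto
  have dom: "dom3 L (F 0) (F 1) (F 2) (F 3)"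
    unfolding dom3_def using dF cF3 bc by blast
  have FL: "F 0 \<in> L2_on \<Omega>" by (rule continuous_L2_on[OF dom3D(4)[OF dom]])
  have vL: "v n \<in> L2_on \<Omega>" for n by (rule Adom_L2[OF v])
  have "S t u0 \<doteq> F 0"
  proof (rule L2_norm_tendsto_unique[where v = v and F = sequentially])
    show "(\<lambda>n. N (\<lambda>x. v n x - S t u0 x)) \<longlonglongrightarrow> 0"
    proof (rule tendsto_sandwich[OF _ _ tendsto_const elim])
      have "N (\<lambda>x. v n x - S t u0 x) \<le> e n" for n
        using S_contraction_diff[OF t0 fL u0, of n] f(2)[of n] L2_norm_minus_commute[of \<Omega> "f n" u0]
        by (simp add: v_def)
      then show "\<forall>\<^sub>F n in sequentially. N (\<lambda>x. v n x - S t u0 x) \<le> e n" by simp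
    qed (simp add: L2_norm_nonneg)
    show "(\<lambda>n. N (\<lambda>x. v n x - F 0 x)) \<longlonglongrightarrow> 0"
    proof (rule tendsto_sandwich[OF _ _ tendsto_const])
      have "N (\<lambda>x. v n x - F 0 x) \<le> E * e n * sqrt (L - - L)" for n
      proof -
        have RL: "R n 0 \<in> L2_on \<Omega>" by (rule continuous_L2_on[OF dom3D(4)[OF dR]])
        have "v n \<doteq> R n 0" unfolding R_def by (rule rep_dom3(2)[OF L v2])
        then have "(\<lambda>x. v n x - F 0 x) \<doteq> (\<lambda>x. R n 0 x - F 0 x)"
          unfolding ae_eq_on_def by eventually_elim simp
        then have "N (\<lambda>x. v n x - F 0 x) = N (\<lambda>x. R n 0 x - F 0 x)"
          by (rule L2_norm_cong[OF _ L2_on_diff[OF vL FL] L2_on_diff[OF RL FL]])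
        also have "\<dots> \<le> E * e n * sqrt (L - - L)"
          by (rule L2_norm_uniform_bound[OF less_imp_le[OF LL] L2_onD(1)[OF L2_on_diff[OF RL FL]]])
            (use unif[of _ 0 n] E e[of n] in \<open>auto intro: less_imp_le\<close>)
        finally show ?thesis .
      qed
      then show "\<forall>\<^sub>F n in sequentially. N (\<lambda>x. v n x - F 0 x) \<le> E * e n * sqrt (L - - L)" by simp
      show "(\<lambda>n. E * e n * sqrt (L - - L)) \<longlonglongrightarrow> 0"
        using tendsto_mult[OF Ee tendsto_const] by simp
    qed (simp add: L2_norm_nonneg)
  qed (use S_L2[OF t0 u0] FL vL in simp_all)
  from dom3_in_A_graph[OF L dom S_L2[OF t0 u0] this continuous_L2_on[OF dom3_continuous_op[OF dom]] ae_eq_on_refl]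
  show ?thesis by blast
qed

text \<open>The first half of the time interval gains one power of \<open>A\<close>, the second half
  the remaining ones; the generator commutes with the semigroup.\<close>

lemma Adom_S_pos:
  assumes "u0 \<in> L2_on \<Omega>" "0 < t"
  shows "Adom L n (S t u0)"
  using assms
proof (induction n arbitrary: u0 t)
  case 0
  then show ?case by (simp add: S_L2)
next
  case (Suc n)
  have r: "0 < t / 2" "0 \<le> t / 2" "t / 2 + t / 2 = t" using Suc.prems by auto
  obtain g where g: "(S (t / 2) u0, g) \<in> A_graph L" using S_into_domain[OF Suc.prems(1) r(1)] by blast
  have A: "(S (t / 2) (S (t / 2) u0), S (t / 2) g) \<in> A_graph L" by (rule S_graph[OF r(2) g])
  have "S (t / 2) (S (t / 2) u0) \<doteq> S t u0"
    using S_add_time[OF r(2,2) Suc.prems(1)] r(3) ae_eq_on_sym by auto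
  then have "(S t u0, S (t / 2) g) \<in> A_graph L"
    using A_graph_cong_left[OF L A S_L2] Suc.prems by auto
  moreover have "Adom L n (S (t / 2) g)" using Suc.IH[OF _ r(1)] A_graph_L2[OF g] by blast
  ultimately show ?case by auto
qed

end

section \<open>The Carleman estimate at a fixed time\<close>

text \<open>The pointwise form of integrating \<open>M1 * M2\<close> by parts, with \<open>q\<close>
  and \<open>r\<close> the first two space derivatives of \<open>p\<close>. The first bracket is the
  rate of change of the energy density with \<open>p\<close> frozen in time, the second the expanded
  space derivative of the flux \<open>H\<close> in \<open>carleman_static\<close>. The terms in
  \<open>w1^2\<close> add up to \<open>9 p^2 q w1^2\<close>, which is also present in
  \<open>M1 * M2\<close>.\<close>

lemma carleman_identity:
  fixes p q r w w1 w2 w3 wt wt1 :: real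
  shows "(p^3 * w * wt - 3 * p * w1 * wt1)
    + (3 * p\<^sup>2 * q * w * w2 + p^3 * w1 * w2 + p^3 * w * w3
       - (3/2) * p\<^sup>2 * q * w1\<^sup>2 - p^3 * w1 * w2
       - (6 * p * q\<^sup>2 + 3 * p\<^sup>2 * r) * w * w1 - 3 * p\<^sup>2 * q * w1\<^sup>2 - 3 * p\<^sup>2 * q * w * w2
       + (15/2) * p^4 * q * w\<^sup>2 + 3 * p^5 * w * w1
       + (3/2) * q * w2\<^sup>2 + 3 * p * w2 * w3
       + (27/2) * p\<^sup>2 * q * w1\<^sup>2 + 9 * p^3 * w1 * w2
       + 3 * r * w2 * w1 + 3 * q * w3 * w1 + 3 * q * w2\<^sup>2
       + 3 * q * w1 * wt + 3 * p * w2 * wt + 3 * p * w1 * wt1)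
    = (wt + w3 + 3 * p\<^sup>2 * w1) * (p^3 * w + 3 * p * w2 + 3 * q * w1)
      + (15/2) * p^4 * q * w\<^sup>2 + (9/2) * q * w2\<^sup>2 + 3 * r * w2 * w1
      - (6 * p * q\<^sup>2 + 3 * p\<^sup>2 * r) * w * w1"
  by (simp add: algebra_simps power2_eq_square power3_eq_cube eval_nat_numeral)

lemma abs_mult_le_squares: "\<bar>x * y\<bar> \<le> (x\<^sup>2 + y\<^sup>2) / (2::real)"
  using sum_squares_bound[of "\<bar>x\<bar>" "\<bar>y\<bar>"] by (simp add: abs_mult)

text \<open>The leading form has weights \<open>k^5\<close> and \<open>k\<close>. All remaining
  terms, including \<open>R^2\<close> and those with \<open>a\<close> and \<open>b\<close> that stem
  from the time dependence of the weight, fit into \<open>k^4 w^2 + k^2 w1^2 + w2^2\<close>, one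
  power of \<open>k\<close> lower. Outside \<open>\<omega>\<close> the leading coefficients are at
  most \<open>- c\<close>; on \<open>\<omega>\<close> they are merely bounded.\<close>

lemma carleman_pointwise:
  fixes k :: real
  assumes k: "1 \<le> k" and M: "0 \<le> M" and A: "0 \<le> A"
    and bd: "\<bar>p1\<bar> \<le> M" "\<bar>p2\<bar> \<le> M" "\<bar>p3\<bar> \<le> M" "\<bar>a\<bar> \<le> A * k\<^sup>2" "\<bar>b\<bar> \<le> A * k\<^sup>2"
    and p: "p = k * p1" and q: "q = k * p2" and r: "r = k * p3"
    and pde: "wt + w3 + 3 * p\<^sup>2 * w1 + (p^3 * w + 3 * p * w2 + 3 * q * w1)
      = - a * w + w2 + 2 * p * w1 + (q + p\<^sup>2) * w - (r + 3 * p * q) * w"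
    and c: "0 \<le> c" "\<not> \<omega> \<Longrightarrow> p1 ^ 4 * p2 \<le> - c \<and> p2 \<le> - c"
  shows "p^3 * w * wt - 3 * p * w1 * wt1 + (3/2) * p\<^sup>2 * b * w\<^sup>2 - (3/2) * b * w1\<^sup>2
    + (3 * p\<^sup>2 * q * w * w2 + p^3 * w1 * w2 + p^3 * w * w3
       - (3/2) * p\<^sup>2 * q * w1\<^sup>2 - p^3 * w1 * w2
       - (6 * p * q\<^sup>2 + 3 * p\<^sup>2 * r) * w * w1 - 3 * p\<^sup>2 * q * w1\<^sup>2 - 3 * p\<^sup>2 * q * w * w2
       + (15/2) * p^4 * q * w\<^sup>2 + 3 * p^5 * w * w1
       + (3/2) * q * w2\<^sup>2 + 3 * p * w2 * w3
       + (27/2) * p\<^sup>2 * q * w1\<^sup>2 + 9 * p^3 * w1 * w2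
       + 3 * r * w2 * w1 + 3 * q * w3 * w1 + 3 * q * w2\<^sup>2
       + 3 * q * w1 * wt + 3 * p * w2 * wt + 3 * p * w1 * wt1)
    \<le> - c * (k^5 * w\<^sup>2 + k * w2\<^sup>2)
      + (3 * M + 9 * M^3 + 3 * (M\<^sup>2 * A) + 3 * A + 3 * (A + 2 * M + 4 * M\<^sup>2)\<^sup>2 + 6 * M\<^sup>2 + 3)
        * (k^4 * w\<^sup>2 + k\<^sup>2 * w1\<^sup>2 + w2\<^sup>2)
      + (if \<omega> then ((15/2) * M^5 + (9/2) * M + c) * (k^5 * w\<^sup>2 + k * w2\<^sup>2) else 0)"
proof -
  define R where "R = - a * w + w2 + 2 * p * w1 + (q + p\<^sup>2) * w - (r + 3 * p * q) * w"
  define C0 where "C0 = A + 2 * M + 4 * M\<^sup>2"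
  define X Y Z where "X = k^4 * w\<^sup>2" and "Y = k\<^sup>2 * w1\<^sup>2" and "Z = w2\<^sup>2"
  have k0: "0 \<le> k" using k by simp
  have kk: "k \<le> k\<^sup>2" "1 \<le> k\<^sup>2" using k by (auto simp: power2_eq_square mult_ge1_I mult_left_mono[of 1 k k, simplified])
  have XYZ: "0 \<le> X" "0 \<le> Y" "0 \<le> Z" by (auto simp: X_def Y_def Z_def)
  have ap: "\<bar>p\<bar> \<le> k * M" "\<bar>q\<bar> \<le> k * M" "\<bar>r\<bar> \<le> k * M"
    unfolding p q r abs_mult using bd k0 by (auto intro!: mult_left_mono)
  have kM: "0 \<le> k * M" using k0 M by simp
  have p2: "p\<^sup>2 \<le> k\<^sup>2 * M\<^sup>2"
    using power_mono[OF ap(1) abs_ge_zero, of 2] by (simp add: power_mult_distrib)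
  have M1M2: "(wt + w3 + 3 * p\<^sup>2 * w1) * (p^3 * w + 3 * p * w2 + 3 * q * w1) \<le> R\<^sup>2 / 2"
  proof -
    have "2 * (u * v) \<le> (u + v)\<^sup>2" for u v :: real
      using zero_le_power2[of u] zero_le_power2[of v] by (simp add: power2_sum)
    from this[of "wt + w3 + 3 * p\<^sup>2 * w1" "p^3 * w + 3 * p * w2 + 3 * q * w1"]
    show ?thesis unfolding pde R_def[symmetric] by simp
  qed
  have R: "R\<^sup>2 / 2 \<le> (3/2) * C0\<^sup>2 * X + (3/2) * Z + 6 * M\<^sup>2 * Y"
  proof -
    define \<alpha> where "\<alpha> = - a + q + p\<^sup>2 - r - 3 * (p * q)"
    have pq: "\<bar>p * q\<bar> \<le> k\<^sup>2 * M\<^sup>2"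
      using mult_mono[OF ap(1,2) kM abs_ge_zero] by (simp add: abs_mult power2_eq_square mult_ac)
    have kM2: "k * M \<le> k\<^sup>2 * M" using kk M by (intro mult_right_mono) auto
    have "\<bar>\<alpha>\<bar> \<le> \<bar>a\<bar> + \<bar>q\<bar> + p\<^sup>2 + \<bar>r\<bar> + 3 * \<bar>p * q\<bar>" unfolding \<alpha>_def using zero_le_power2[of p] by linarith
    also have "\<dots> \<le> A * k\<^sup>2 + k\<^sup>2 * M + k\<^sup>2 * M\<^sup>2 + k\<^sup>2 * M + 3 * (k\<^sup>2 * M\<^sup>2)"
      using bd(4) ap p2 pq kM2 by linarith
    also have "\<dots> = C0 * k\<^sup>2" by (simp add: C0_def algebra_simps)
    finally have "\<alpha>\<^sup>2 \<le> (C0 * k\<^sup>2)\<^sup>2"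
      by (metis abs_ge_zero power2_abs power_mono)
    then have \<alpha>: "\<alpha>\<^sup>2 * w\<^sup>2 \<le> C0\<^sup>2 * X"
      using mult_right_mono[of "\<alpha>\<^sup>2" "(C0 * k\<^sup>2)\<^sup>2" "w\<^sup>2"] by (simp add: X_def power_mult_distrib mult.assoc)
    have sq3: "(x + y + z)\<^sup>2 \<le> 3 * (x\<^sup>2 + y\<^sup>2 + z\<^sup>2)" for x y z :: real
      using sum_squares_bound[of x y] sum_squares_bound[of x z] sum_squares_bound[of y z]
      by (simp add: power2_eq_square algebra_simps)
    have "R = \<alpha> * w + w2 + 2 * p * w1" by (simp add: R_def \<alpha>_def algebra_simps)
    then have "R\<^sup>2 \<le> 3 * (\<alpha>\<^sup>2 * w\<^sup>2 + Z + 4 * (p\<^sup>2 * w1\<^sup>2))"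
      using sq3[of "\<alpha> * w" w2 "2 * p * w1"] by (simp add: power_mult_distrib Z_def mult.assoc)
    also have "\<dots> \<le> 3 * (C0\<^sup>2 * X + Z + 4 * (M\<^sup>2 * Y))"
    proof -
      have "p\<^sup>2 * w1\<^sup>2 \<le> M\<^sup>2 * Y"
        using mult_right_mono[OF p2, of "w1\<^sup>2"] by (simp add: Y_def mult_ac)
      with \<alpha> show ?thesis by (intro mult_left_mono add_mono) auto
    qed
    finally show ?thesis by (simp add: field_simps)
  qed
  have T1: "3 * r * w2 * w1 \<le> (3/2) * M * (Z + Y)"
  proof -
    have "r * w2 * w1 \<le> \<bar>r\<bar> * \<bar>w2 * w1\<bar>"
      using abs_ge_self[of "r * (w2 * w1)"] by (simp only: abs_mult mult.assoc)
    also have "\<dots> \<le> k * M * \<bar>w2 * w1\<bar>" using ap(3) by (intro mult_right_mono) auto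
    also have "\<dots> = M * \<bar>w2 * (k * w1)\<bar>" using k0 by (simp add: abs_mult)
    also have "\<dots> \<le> M * ((w2\<^sup>2 + (k * w1)\<^sup>2) / 2)"
      using M by (intro mult_left_mono abs_mult_le_squares)
    finally have "r * w2 * w1 \<le> M * ((w2\<^sup>2 + (k * w1)\<^sup>2) / 2)" .
    moreover have "(3/2) * M * (Z + Y) = 3 * (M * ((w2\<^sup>2 + (k * w1)\<^sup>2) / 2))"
      by (simp add: Y_def Z_def power_mult_distrib)
    moreover have "3 * r * w2 * w1 = 3 * (r * w2 * w1)" by (simp only: mult.assoc)
    ultimately show ?thesis by linarith
  qed
  have T2: "- ((6 * p * q\<^sup>2 + 3 * p\<^sup>2 * r) * w * w1) \<le> (9/2) * M^3 * (X + Y)"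
  proof -
    have cube: "\<bar>x\<bar> * (\<bar>y\<bar> * \<bar>z\<bar>) \<le> (k * M)^3"
      if "\<bar>x\<bar> \<le> k * M" "\<bar>y\<bar> \<le> k * M" "\<bar>z\<bar> \<le> k * M" for x y z :: real
    proof -
      have "\<bar>y\<bar> * \<bar>z\<bar> \<le> (k * M) * (k * M)" by (rule mult_mono[OF that(2,3) kM abs_ge_zero])
      from mult_mono[OF that(1) this kM] show ?thesis by (simp add: power3_eq_cube mult.assoc)
    qed
    have "\<bar>p * q\<^sup>2\<bar> \<le> (k * M)^3"
      using cube[OF ap(1,2,2)] by (simp add: abs_mult power2_eq_square)
    moreover have "\<bar>p\<^sup>2 * r\<bar> \<le> (k * M)^3"
      using cube[OF ap(1,1,3)] by (simp add: abs_mult power2_eq_square mult.assoc)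
    ultimately have "\<bar>6 * p * q\<^sup>2 + 3 * p\<^sup>2 * r\<bar> \<le> 9 * (k * M)^3" by (simp add: mult.assoc)
    then have "\<bar>6 * p * q\<^sup>2 + 3 * p\<^sup>2 * r\<bar> * \<bar>w * w1\<bar> \<le> 9 * (k * M)^3 * \<bar>w * w1\<bar>"
      by (rule mult_right_mono) simp
    also have "\<dots> = 9 * M^3 * \<bar>(k\<^sup>2 * w) * (k * w1)\<bar>"
      using k0 by (simp add: abs_mult power_mult_distrib eval_nat_numeral)
    also have "\<dots> \<le> 9 * M^3 * (((k\<^sup>2 * w)\<^sup>2 + (k * w1)\<^sup>2) / 2)"
      using M by (intro mult_left_mono abs_mult_le_squares) auto
    also have "\<dots> = (9/2) * M^3 * (X + Y)" by (simp add: X_def Y_def power_mult_distrib)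
    finally have "\<bar>6 * p * q\<^sup>2 + 3 * p\<^sup>2 * r\<bar> * \<bar>w * w1\<bar> \<le> (9/2) * M^3 * (X + Y)" .
    moreover have "- ((6 * p * q\<^sup>2 + 3 * p\<^sup>2 * r) * w * w1) \<le> \<bar>6 * p * q\<^sup>2 + 3 * p\<^sup>2 * r\<bar> * \<bar>w * w1\<bar>"
      using abs_ge_minus_self[of "(6 * p * q\<^sup>2 + 3 * p\<^sup>2 * r) * (w * w1)"]
      by (simp only: abs_mult mult.assoc)
    ultimately show ?thesis by linarith
  qed
  have T3: "(3/2) * p\<^sup>2 * b * w\<^sup>2 \<le> (3/2) * M\<^sup>2 * A * X"
  proof -
    have "p\<^sup>2 * b \<le> (k\<^sup>2 * M\<^sup>2) * (A * k\<^sup>2)"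
      using mult_mono[OF p2 order_trans[OF abs_ge_self bd(5)]] mult_left_mono[OF order_trans[OF abs_ge_self bd(5)], of "p\<^sup>2"]
        mult_right_mono[OF p2, of "A * k\<^sup>2"] A by auto
    from mult_right_mono[OF this, of "w\<^sup>2"] show ?thesis
      by (simp add: X_def eval_nat_numeral mult_ac)
  qed
  have T4: "- (3/2) * b * w1\<^sup>2 \<le> (3/2) * A * Y"
  proof -
    have "- b \<le> A * k\<^sup>2" using bd(5) by linarith
    from mult_right_mono[OF this, of "w1\<^sup>2"] show ?thesis by (simp add: Y_def mult.assoc)
  qed
  have main: "(15/2) * p^4 * q * w\<^sup>2 + (9/2) * q * w2\<^sup>2 \<le> - c * (k^5 * w\<^sup>2 + k * w2\<^sup>2)
      + (if \<omega> then ((15/2) * M^5 + (9/2) * M + c) * (k^5 * w\<^sup>2 + k * w2\<^sup>2) else 0)"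
  proof -
    have pq: "p^4 * q = k^5 * (p1^4 * p2)" by (simp add: p q power_mult_distrib eval_nat_numeral)
    have "p^4 * q * w\<^sup>2 = k^5 * (p1^4 * p2) * w\<^sup>2" using pq by simp
    then have e1: "(15/2) * p^4 * q * w\<^sup>2 = (15/2) * (p1^4 * p2 * (k^5 * w\<^sup>2))" by (simp add: mult_ac)
    have e2: "(9/2) * q * w2\<^sup>2 = (9/2) * (p2 * (k * w2\<^sup>2))" by (simp add: q mult_ac)
    have nn: "0 \<le> k^5 * w\<^sup>2" "0 \<le> k * w2\<^sup>2" using k0 by auto
    show ?thesis
    proof (cases \<omega>)
      \<comment> \<open>Here the coefficients may have either sign and are paid for by the local
        term; its extra \<open>c\<close> compensates the \<open>- c\<close> that is claimed
        everywhere.\<close>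
      case True
      have "\<bar>p1^4 * p2\<bar> \<le> M^5"
        using mult_mono[OF power_mono[OF bd(1) abs_ge_zero, of 4] bd(2)] M
        by (simp add: abs_mult power_abs eval_nat_numeral mult_ac)
      then have "p1^4 * p2 * (k^5 * w\<^sup>2) \<le> M^5 * (k^5 * w\<^sup>2)" by (intro mult_right_mono nn) simp
      moreover have "p2 * (k * w2\<^sup>2) \<le> M * (k * w2\<^sup>2)" using bd(2) by (intro mult_right_mono nn) simp
      moreover have "0 \<le> M^5 * (k * w2\<^sup>2)" "0 \<le> M * (k^5 * w\<^sup>2)" using M nn by auto
      ultimately have "(15/2) * (p1^4 * p2 * (k^5 * w\<^sup>2)) + (9/2) * (p2 * (k * w2\<^sup>2))
          \<le> ((15/2) * M^5 + (9/2) * M) * (k^5 * w\<^sup>2 + k * w2\<^sup>2)"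
        by (simp add: distrib_right distrib_left)
      then show ?thesis unfolding e1 e2 using True distrib_right[of "(15/2) * M^5 + (9/2) * M" c "k^5 * w\<^sup>2 + k * w2\<^sup>2"]
        by simp
    next
      case False
      have "p1^4 * p2 * (k^5 * w\<^sup>2) \<le> - c * (k^5 * w\<^sup>2)" "p2 * (k * w2\<^sup>2) \<le> - c * (k * w2\<^sup>2)"
        using c(2)[OF False] by (intro mult_right_mono nn; simp)+
      moreover have "0 \<le> c * (k^5 * w\<^sup>2)" "0 \<le> c * (k * w2\<^sup>2)" using c nn by auto
      ultimately have "(15/2) * (p1^4 * p2 * (k^5 * w\<^sup>2)) + (9/2) * (p2 * (k * w2\<^sup>2))
          \<le> - c * (k^5 * w\<^sup>2 + k * w2\<^sup>2)"
        by (simp add: distrib_left)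
      then show ?thesis unfolding e1 e2 using False by simp
    qed
  qed
  define D where "D = 3 * M + 9 * M^3 + 3 * (M\<^sup>2 * A) + 3 * A + 3 * C0\<^sup>2 + 6 * M\<^sup>2 + 3"
  have D: "(3/2) * C0\<^sup>2 + (9/2) * M^3 + (3/2) * (M\<^sup>2 * A) \<le> D"
    "6 * M\<^sup>2 + (3/2) * M + (9/2) * M^3 + (3/2) * A \<le> D" "3/2 + (3/2) * M \<le> D"
  proof -
    have "0 \<le> M^3" "0 \<le> M\<^sup>2 * A" "0 \<le> C0\<^sup>2" "0 \<le> M\<^sup>2" using M A by auto
    then show "(3/2) * C0\<^sup>2 + (9/2) * M^3 + (3/2) * (M\<^sup>2 * A) \<le> D"
      "6 * M\<^sup>2 + (3/2) * M + (9/2) * M^3 + (3/2) * A \<le> D" "3/2 + (3/2) * M \<le> D"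
      using M A unfolding D_def by linarith+
  qed
  have "(3/2) * C0\<^sup>2 * X + (3/2) * Z + 6 * M\<^sup>2 * Y + (3/2) * M * (Z + Y) + (9/2) * M^3 * (X + Y)
      + (3/2) * M\<^sup>2 * A * X + (3/2) * A * Y
    = ((3/2) * C0\<^sup>2 + (9/2) * M^3 + (3/2) * (M\<^sup>2 * A)) * X
      + (6 * M\<^sup>2 + (3/2) * M + (9/2) * M^3 + (3/2) * A) * Y + (3/2 + (3/2) * M) * Z"
    by (simp add: field_simps)
  also have "\<dots> \<le> D * X + D * Y + D * Z"
    using XYZ D by (intro add_mono mult_right_mono)
  also have "\<dots> = D * (X + Y + Z)" by (simp add: distrib_left)
  finally have "(3/2) * C0\<^sup>2 * X + (3/2) * Z + 6 * M\<^sup>2 * Y + (3/2) * M * (Z + Y) + (9/2) * M^3 * (X + Y)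
      + (3/2) * M\<^sup>2 * A * X + (3/2) * A * Y \<le> D * (X + Y + Z)" .
  then show ?thesis
    using carleman_identity[of p w wt w1 wt1 q w2 w3 r] M1M2 R T1 T2 T3 T4 main
    unfolding C0_def[symmetric] D_def[symmetric] X_def[symmetric] Y_def[symmetric] Z_def[symmetric] by linarith
qed

text \<open>The sign conditions on the weight in quantitative form, obtained by compactness. The
  lower bound \<open>m\<close> gives the exponential decay of the energy, \<open>c\<close> measures
  the concavity outside the observation interval and the outward slope at \<open>-L\<close>, and
  \<open>M\<close> bounds everything else.\<close>

locale carleman_weight =
  fixes L l1 l2 m M c :: real and \<psi> p1 p2 p3 :: "real \<Rightarrow> real"
  assumes L: "0 < L" and l: "-L < l1" "l1 < l2" "l2 < L"
    and const: "0 < m" "0 < M" "0 < c"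
    and d\<psi>: "\<And>x. x \<in> {-L..L} \<Longrightarrow> (\<psi> has_real_derivative p1 x) (at x within {-L..L})"
    and dp1: "\<And>x. x \<in> {-L..L} \<Longrightarrow> (p1 has_real_derivative p2 x) (at x within {-L..L})"
    and dp2: "\<And>x. x \<in> {-L..L} \<Longrightarrow> (p2 has_real_derivative p3 x) (at x within {-L..L})"
    and cp3: "continuous_on {-L..L} p3"
    and bounds: "\<And>x. x \<in> {-L..L} \<Longrightarrow> m \<le> \<psi> x \<and> \<psi> x \<le> M \<and> \<bar>p1 x\<bar> \<le> M \<and> \<bar>p2 x\<bar> \<le> M \<and> \<bar>p3 x\<bar> \<le> M"
    and outside: "\<And>x. x \<in> {-L..L} - {l1<..<l2} \<Longrightarrow> p1 x ^ 4 * p2 x \<le> - c \<and> p2 x \<le> - c"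
    and ends: "p1 (-L) \<le> - c" "0 \<le> p1 L" "\<psi> L = \<psi> (-L)"

lemma weight_function_carleman_weight:
  assumes L: "0 < L" and l: "-L < l1" "l1 < l2" "l2 < L" and w: "weight_function L l1 l2 \<psi>"
  shows "\<exists>m M c p1 p2 p3. carleman_weight L l1 l2 m M c \<psi> p1 p2 p3"
proof -
  obtain p1 p2 p3 where
    d: "\<forall>x\<in>{-L..L}. (\<psi> has_real_derivative p1 x) (at x within {-L..L})"
      "\<forall>x\<in>{-L..L}. (p1 has_real_derivative p2 x) (at x within {-L..L})"
      "\<forall>x\<in>{-L..L}. (p2 has_real_derivative p3 x) (at x within {-L..L})"
    and c3: "continuous_on {-L..L} p3" and pos: "\<forall>x\<in>{-L..L}. \<psi> x > 0"
    and out: "\<forall>x\<in>{-L..L} - {l1<..<l2}. \<bar>p1 x\<bar> > 0 \<and> p2 x < 0 \<and> p1 x * p3 x < 0"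
    and e: "p1 (-L) < 0" "p1 L > 0" "\<psi> (-L) = \<psi> L"
    using w unfolding weight_function_def by metis
  have cont: "continuous_on {-L..L} \<psi>" "continuous_on {-L..L} p1" "continuous_on {-L..L} p2"
    using d by (auto intro: DERIV_continuous_on)
  have ne: "{-L..L} \<noteq> {}" using L by simp
  have "\<exists>B>0. \<forall>x\<in>{-L..L}. \<bar>f x\<bar> \<le> B" if "continuous_on {-L..L} f" for f :: "real \<Rightarrow> real"
    using compact_imp_bounded[OF compact_continuous_image[OF that compact_Icc]]
    by (auto simp: bounded_pos)
  then obtain B0 B1 B2 B3 where B: "B0 > 0" "B1 > 0" "B2 > 0" "B3 > 0"
    "\<forall>x\<in>{-L..L}. \<bar>\<psi> x\<bar> \<le> B0" "\<forall>x\<in>{-L..L}. \<bar>p1 x\<bar> \<le> B1"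
    "\<forall>x\<in>{-L..L}. \<bar>p2 x\<bar> \<le> B2" "\<forall>x\<in>{-L..L}. \<bar>p3 x\<bar> \<le> B3"
    using cont c3 by metis
  define M where "M = B0 + B1 + B2 + B3"
  have M: "0 < M" "B0 \<le> M" "B1 \<le> M" "B2 \<le> M" "B3 \<le> M" using B by (auto simp: M_def)
  obtain x0 where x0: "x0 \<in> {-L..L}" "\<And>x. x \<in> {-L..L} \<Longrightarrow> \<psi> x0 \<le> \<psi> x"
    using continuous_attains_inf[OF compact_Icc ne cont(1)] by blast
  let ?K = "{-L..L} - {l1<..<l2}" and ?f = "\<lambda>x. min (- (p1 x ^ 4 * p2 x)) (- p2 x)"
  have "compact ?K" by (intro compact_diff compact_Icc open_greaterThanLessThan)
  moreover have "L \<in> ?K" using L l by auto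
  then have "?K \<noteq> {}" by blast
  moreover have "continuous_on ?K ?f"
    by (intro continuous_intros; rule continuous_on_subset[OF cont(2)] continuous_on_subset[OF cont(3)]; blast)
  ultimately obtain x1 where x1: "x1 \<in> ?K" "\<And>x. x \<in> ?K \<Longrightarrow> ?f x1 \<le> ?f x"
    using continuous_attains_inf[of ?K ?f] by blast
  have "0 < p1 x1 ^ 4" "p2 x1 < 0" using out x1(1) by (auto simp: zero_less_power_eq)
  then have f1: "0 < ?f x1" by (simp add: mult_pos_neg)
  \<comment> \<open>One constant serves both the interior form and the boundary terms at the left
    end.\<close>
  define c where "c = min (?f x1) (- p1 (-L))"
  have "carleman_weight L l1 l2 (\<psi> x0) M c \<psi> p1 p2 p3"
  proof
    show "0 < \<psi> x0" using pos x0 by blast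
    show "0 < c" using f1 e by (simp add: c_def)
    show "p1 (-L) \<le> - c" by (simp add: c_def)
    show "\<psi> x0 \<le> \<psi> x \<and> \<psi> x \<le> M \<and> \<bar>p1 x\<bar> \<le> M \<and> \<bar>p2 x\<bar> \<le> M \<and> \<bar>p3 x\<bar> \<le> M"
      if "x \<in> {-L..L}" for x
      using x0(2)[OF that] B(5-8) M that by (meson abs_ge_self order_trans)
    show "p1 x ^ 4 * p2 x \<le> - c \<and> p2 x \<le> - c" if "x \<in> ?K" for x
      using x1(2)[OF that] by (auto simp: c_def)
  qed (use L l M d c3 e in auto)
  then show ?thesis by blast
qed

context carleman_weight
begin

abbreviation "I \<equiv> {-L..L}"

lemma cont: "continuous_on I \<psi>" "continuous_on I p1" "continuous_on I p2"
  by (rule DERIV_continuous_on[OF d\<psi>] DERIV_continuous_on[OF dp1] DERIV_continuous_on[OF dp2]; simp)+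

text \<open>The conjugated function \<open>exp (- k \<psi>) u\<close> with its first three derivatives in \<open>x\<close>, its time
  derivative and the mixed derivative. The weight \<open>k\<close> depends on time, with derivative \<open>d\<close>, and
  \<open>v\<close> is the time derivative of \<open>u\<close>.\<close>

definition "W0 k u x = exp (- (k * \<psi> x)) * u x"
definition "W1 k u u1 x = exp (- (k * \<psi> x)) * (u1 x - k * p1 x * u x)"
definition "W2 k u u1 u2 x = exp (- (k * \<psi> x)) * (u2 x - 2 * k * p1 x * u1 x + (k\<^sup>2 * (p1 x)\<^sup>2 - k * p2 x) * u x)"
definition "W3 k u u1 u2 u3 x = exp (- (k * \<psi> x)) * (u3 x - 3 * k * p1 x * u2 x
   + (3 * k\<^sup>2 * (p1 x)\<^sup>2 - 3 * k * p2 x) * u1 x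
   + (- (k^3 * p1 x ^ 3) + 3 * k\<^sup>2 * p1 x * p2 x - k * p3 x) * u x)"
definition "Wt k d u v x = exp (- (k * \<psi> x)) * (v x - d * \<psi> x * u x)"
definition "Wt1 k d u u1 v v1 x = exp (- (k * \<psi> x)) *
   (v1 x - d * \<psi> x * u1 x - d * p1 x * u x - k * p1 x * (v x - d * \<psi> x * u x))"

text \<open>The time derivative of \<open>energy_density\<close>, when \<open>d\<close> is the
  derivative of \<open>k\<close>; the last two terms come from differentiating
  \<open>p = k * p1\<close> in time.\<close>

definition "energy_rate k d u u1 v v1 x =
   (k * p1 x)^3 * W0 k u x * Wt k d u v x - 3 * (k * p1 x) * W1 k u u1 x * Wt1 k d u u1 v v1 x
   + (3/2) * (k * p1 x)\<^sup>2 * (d * p1 x) * (W0 k u x)\<^sup>2 - (3/2) * (d * p1 x) * (W1 k u u1 x)\<^sup>2"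

lemma exp_weight_derivative: "x \<in> I \<Longrightarrow> ((\<lambda>x. exp (- (k * \<psi> x))) has_real_derivative - (k * p1 x) * exp (- (k * \<psi> x))) (at x within I)"
  by (auto intro!: derivative_eq_intros d\<psi>)

lemma W_derivatives:
  assumes U: "dom3 L u u1 u2 u3" and x: "x \<in> I"
  shows "(W0 k u has_real_derivative W1 k u u1 x) (at x within I)"
    "(W1 k u u1 has_real_derivative W2 k u u1 u2 x) (at x within I)"
    "(W2 k u u1 u2 has_real_derivative W3 k u u1 u2 u3 x) (at x within I)"
  unfolding W0_def[abs_def] W1_def[abs_def] W2_def[abs_def] W3_def
  by (auto intro!: derivative_eq_intros exp_weight_derivative dom3D(1-3)[OF U] d\<psi> dp1 dp2 x
      simp: algebra_simps power2_eq_square power3_eq_cube)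

lemma Wt_derivative:
  assumes U: "dom3 L u u1 u2 u3" and V: "dom3 L v v1 v2 v3" and x: "x \<in> I"
  shows "(Wt k d u v has_real_derivative Wt1 k d u u1 v v1 x) (at x within I)"
  unfolding Wt_def[abs_def] Wt1_def
  by (auto intro!: derivative_eq_intros exp_weight_derivative dom3D(1)[OF U] dom3D(1)[OF V] d\<psi> x
      simp: algebra_simps)

text \<open>Conjugation turns the space derivative into itself plus \<open>p\<close> and the time
  derivative into itself plus \<open>d * \<psi>\<close>. The viscous terms and the remaining
  lower-order multiples of \<open>w\<close> are collected on the right.\<close>

lemma W_pde:
  assumes eq: "v x = u2 x - u3 x"
  shows "Wt k d u v x + W3 k u u1 u2 u3 x + 3 * (k * p1 x)\<^sup>2 * W1 k u u1 x
     + ((k * p1 x)^3 * W0 k u x + 3 * (k * p1 x) * W2 k u u1 u2 x + 3 * (k * p2 x) * W1 k u u1 x)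
    = - (d * \<psi> x) * W0 k u x + W2 k u u1 u2 x + 2 * (k * p1 x) * W1 k u u1 x
     + (k * p2 x + (k * p1 x)\<^sup>2) * W0 k u x - (k * p3 x + 3 * (k * p1 x) * (k * p2 x)) * W0 k u x"
  unfolding W0_def W1_def W2_def W3_def Wt_def eq
  by (simp add: algebra_simps power2_eq_square power3_eq_cube)

lemma W_continuous:
  assumes U: "dom3 L u u1 u2 u3"
  shows "continuous_on I (W0 k u)" "continuous_on I (W1 k u u1)" "continuous_on I (W2 k u u1 u2)"
    "continuous_on I (W3 k u u1 u2 u3)"
  unfolding W0_def[abs_def] W1_def[abs_def] W2_def[abs_def] W3_def[abs_def]
  by (intro continuous_intros cont cp3 dom3D(4-7)[OF U])+

lemma Wt_continuous:
  assumes U: "dom3 L u u1 u2 u3" and V: "dom3 L v v1 v2 v3"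
  shows "continuous_on I (Wt k d u v)" "continuous_on I (Wt1 k d u u1 v v1)"
  unfolding Wt_def[abs_def] Wt1_def[abs_def]
  by (intro continuous_intros cont dom3D(4-7)[OF U] dom3D(4-7)[OF V])+

lemma carleman_static:
  assumes T: "0 \<le> T"
  obtains k0 C where "0 < k0" "0 < C"
    "\<And>k d u u1 u2 u3 v v1 v2 v3. k0 \<le> k \<Longrightarrow> \<bar>d\<bar> \<le> T * k\<^sup>2 \<Longrightarrow> dom3 L u u1 u2 u3 \<Longrightarrow> dom3 L v v1 v2 v3 \<Longrightarrow>
      (\<forall>x\<in>I. v x = u2 x - u3 x) \<Longrightarrow>
      (c / 4) * integral I (\<lambda>x. k^5 * (W0 k u x)\<^sup>2 + k^3 * (W1 k u u1 x)\<^sup>2 + k * (W2 k u u1 u2 x)\<^sup>2)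
        + (c * k * (W2 k u u1 u2 (-L))\<^sup>2 + 3 * c^3 * k^3 * (W1 k u u1 (-L))\<^sup>2)
      \<le> - integral I (energy_rate k d u u1 v v1)
        + C * integral {l1..l2} (\<lambda>x. k^5 * (W0 k u x)\<^sup>2 + k * (W2 k u u1 u2 x)\<^sup>2)"
proof -
  define A where "A = T * M"
  define C1 where "C1 = 3 * M + 9 * M^3 + 3 * (M\<^sup>2 * A) + 3 * A + 3 * (A + 2 * M + 4 * M\<^sup>2)\<^sup>2 + 6 * M\<^sup>2 + 3"
  define C2 where "C2 = (15/2) * M^5 + (9/2) * M + c"
  have A: "0 \<le> A" using T const by (simp add: A_def)
  have C1: "0 < C1" using A const unfolding C1_def by (intro add_nonneg_pos add_nonneg_nonneg) auto
  have C2: "0 < C2" using const unfolding C2_def by (intro add_pos_pos) auto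
  \<comment> \<open>\<open>3 * C1 / c\<close> lets the lower-order terms be absorbed by half of the
    leading form; \<open>9 * M^2 / c^4\<close> absorbs the mixed boundary term at
    \<open>-L\<close>.\<close>
  define k0 where "k0 = 1 + 3 * C1 / c + 9 * M\<^sup>2 / c^4"
  have k0: "1 \<le> k0" "3 * C1 / c \<le> k0" "9 * M\<^sup>2 / c^4 \<le> k0" using C1 const by (auto simp: k0_def)
  have LL: "-L \<le> L" using L by simp
  have "(c / 4) * integral I (\<lambda>x. k^5 * (W0 k u x)\<^sup>2 + k^3 * (W1 k u u1 x)\<^sup>2 + k * (W2 k u u1 u2 x)\<^sup>2)
        + (c * k * (W2 k u u1 u2 (-L))\<^sup>2 + 3 * c^3 * k^3 * (W1 k u u1 (-L))\<^sup>2)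
      \<le> - integral I (energy_rate k d u u1 v v1)
        + C2 * integral {l1..l2} (\<lambda>x. k^5 * (W0 k u x)\<^sup>2 + k * (W2 k u u1 u2 x)\<^sup>2)"
    if kk0: "k0 \<le> k" and d: "\<bar>d\<bar> \<le> T * k\<^sup>2" and U: "dom3 L u u1 u2 u3" and V: "dom3 L v v1 v2 v3"
      and eq: "\<forall>x\<in>I. v x = u2 x - u3 x" for k d u u1 u2 u3 v v1 v2 v3
  proof -
    have k: "1 \<le> k" "0 < k" using kk0 k0 by auto
    define w w1 w2 w3 wt wt1 where "w = W0 k u" and "w1 = W1 k u u1" and "w2 = W2 k u u1 u2"
      and "w3 = W3 k u u1 u2 u3" and "wt = Wt k d u v" and "wt1 = Wt1 k d u u1 v v1"
    note wdefs = w_def w1_def w2_def w3_def wt_def wt1_def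
    have dw: "\<And>x. x \<in> I \<Longrightarrow> (w has_real_derivative w1 x) (at x within I)"
      "\<And>x. x \<in> I \<Longrightarrow> (w1 has_real_derivative w2 x) (at x within I)"
      "\<And>x. x \<in> I \<Longrightarrow> (w2 has_real_derivative w3 x) (at x within I)"
      "\<And>x. x \<in> I \<Longrightarrow> (wt has_real_derivative wt1 x) (at x within I)"
      unfolding wdefs using W_derivatives[OF U] Wt_derivative[OF U V] by blast+
    have cw: "continuous_on I w" "continuous_on I w1" "continuous_on I w2" "continuous_on I w3"
      "continuous_on I wt" "continuous_on I wt1"
      unfolding wdefs using W_continuous[OF U] Wt_continuous[OF U V] by blast+
    have bc: "w (-L) = 0" "w L = 0" "w1 L = 0" "wt (-L) = 0" "wt L = 0"
      using dom3D(8-10)[OF U] dom3D(8-10)[OF V] by (auto simp: wdefs W0_def W1_def Wt_def)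
    define p q r where "p x = k * p1 x" and "q x = k * p2 x" and "r x = k * p3 x" for x
    have dp: "\<And>x. x \<in> I \<Longrightarrow> (p has_real_derivative q x) (at x within I)"
      "\<And>x. x \<in> I \<Longrightarrow> (q has_real_derivative r x) (at x within I)"
      unfolding p_def[abs_def] q_def[abs_def] r_def by (auto intro!: derivative_eq_intros dp1 dp2)
    have cp: "continuous_on I p" "continuous_on I q" "continuous_on I r"
      unfolding p_def[abs_def] q_def[abs_def] r_def[abs_def] by (intro continuous_intros cont cp3)+
    define et where "et x = p x^3 * w x * wt x - 3 * p x * w1 x * wt1 x
      + (3/2) * (p x)\<^sup>2 * (d * p1 x) * (w x)\<^sup>2 - (3/2) * (d * p1 x) * (w1 x)\<^sup>2" for x
    have et: "energy_rate k d u u1 v v1 = et"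
      by (rule ext) (simp add: energy_rate_def et_def p_def wdefs)
    \<comment> \<open>The flux left by the integrations by parts. For instance
      \<open>3 p w1 wt\<close> comes from \<open>wt * 3 (p w1)_x\<close>, and
      \<open>(9/2) p^3 w1^2\<close> from the product of \<open>3 p^2 w1\<close> and
      \<open>3 p w2\<close>.\<close>
    define H where "H x = p x^3 * w x * w2 x - (1/2) * p x^3 * (w1 x)\<^sup>2 - 3 * (p x)\<^sup>2 * q x * w x * w1 x
      + (3/2) * p x^5 * (w x)\<^sup>2 + (3/2) * p x * (w2 x)\<^sup>2 + (9/2) * p x^3 * (w1 x)\<^sup>2
      + 3 * q x * w2 x * w1 x + 3 * p x * w1 x * wt x" for x
    define Hd where "Hd x = 3 * (p x)\<^sup>2 * q x * w x * w2 x + p x^3 * w1 x * w2 x + p x^3 * w x * w3 x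
       - (3/2) * (p x)\<^sup>2 * q x * (w1 x)\<^sup>2 - p x^3 * w1 x * w2 x
       - (6 * p x * (q x)\<^sup>2 + 3 * (p x)\<^sup>2 * r x) * w x * w1 x - 3 * (p x)\<^sup>2 * q x * (w1 x)\<^sup>2 - 3 * (p x)\<^sup>2 * q x * w x * w2 x
       + (15/2) * p x^4 * q x * (w x)\<^sup>2 + 3 * p x^5 * w x * w1 x
       + (3/2) * q x * (w2 x)\<^sup>2 + 3 * p x * w2 x * w3 x
       + (27/2) * (p x)\<^sup>2 * q x * (w1 x)\<^sup>2 + 9 * p x^3 * w1 x * w2 x
       + 3 * r x * w2 x * w1 x + 3 * q x * w3 x * w1 x + 3 * q x * (w2 x)\<^sup>2
       + 3 * q x * w1 x * wt x + 3 * p x * w2 x * wt x + 3 * p x * w1 x * wt1 x" for x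
    have dH: "(H has_real_derivative Hd x) (at x within I)" if x: "x \<in> I" for x
      unfolding H_def[abs_def] Hd_def
      by (rule derivative_eq_intros refl dw[OF x] dp[OF x])+
        (simp add: algebra_simps power2_eq_square power3_eq_cube eval_nat_numeral)
    have intHd: "(Hd has_integral (H L - H (-L))) I"
      by (rule fundamental_theorem_of_calculus[OF LL])
        (use dH in \<open>simp flip: has_real_derivative_iff_has_vector_derivative\<close>)
    define J where "J f = integral I f" for f :: "real \<Rightarrow> real"
    have int: "(f has_integral J f) I" if "continuous_on I f" for f
      unfolding J_def by (intro integrable_integral integrable_continuous_real that)
    define A0 A1 A2 where "A0 = J (\<lambda>x. (w x)\<^sup>2)" and "A1 = J (\<lambda>x. (w1 x)\<^sup>2)" and "A2 = J (\<lambda>x. (w2 x)\<^sup>2)"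
    have iA: "((\<lambda>x. (w x)\<^sup>2) has_integral A0) I" "((\<lambda>x. (w1 x)\<^sup>2) has_integral A1) I"
      "((\<lambda>x. (w2 x)\<^sup>2) has_integral A2) I"
      unfolding A0_def A1_def A2_def by (intro int continuous_intros cw)+
    have A012: "0 \<le> A0" "0 \<le> A1" "0 \<le> A2"
      by (rule has_integral_nonneg[OF iA(1)] has_integral_nonneg[OF iA(2)] has_integral_nonneg[OF iA(3)]; simp)+
    let ?g = "\<lambda>x. k^5 * (w x)\<^sup>2 + k * (w2 x)\<^sup>2"
    define O1 where "O1 = integral {l1..l2} ?g"
    have sub: "{l1..l2} \<subseteq> I" using l by auto
    have "(?g has_integral O1) {l1..l2}"
      unfolding O1_def
      by (intro integrable_integral integrable_continuous_real continuous_intros continuous_on_subset[OF _ sub] cw)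
    then have iO: "((\<lambda>x. if x \<in> {l1..l2} then ?g x else 0) has_integral O1) I"
      by (simp only: has_integral_restrict[OF sub])
    have ig: "(?g has_integral (k^5 * A0 + k * A2)) I"
      by (intro has_integral_add has_integral_mult_right iA)
    have pw: "et x + Hd x \<le> - c * ?g x + C1 * (k^4 * (w x)\<^sup>2 + k\<^sup>2 * (w1 x)\<^sup>2 + (w2 x)\<^sup>2)
        + C2 * (if x \<in> {l1..l2} then ?g x else 0)" if x: "x \<in> I" for x
    proof -
      have dk: "\<bar>d * \<psi> x\<bar> \<le> A * k\<^sup>2" "\<bar>d * p1 x\<bar> \<le> A * k\<^sup>2"
      proof -
        have "\<bar>\<psi> x\<bar> \<le> M" "\<bar>p1 x\<bar> \<le> M" using bounds[OF x] const by auto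
        then have "\<bar>d\<bar> * \<bar>\<psi> x\<bar> \<le> (T * k\<^sup>2) * M" "\<bar>d\<bar> * \<bar>p1 x\<bar> \<le> (T * k\<^sup>2) * M"
          using d by (intro mult_mono; simp)+
        then show "\<bar>d * \<psi> x\<bar> \<le> A * k\<^sup>2" "\<bar>d * p1 x\<bar> \<le> A * k\<^sup>2" by (simp_all add: A_def abs_mult mult_ac)
      qed
      have out: "\<not> x \<in> {l1..l2} \<Longrightarrow> p1 x ^ 4 * p2 x \<le> - c \<and> p2 x \<le> - c"
        using outside[of x] x by auto
      have pde: "wt x + w3 x + 3 * (p x)\<^sup>2 * w1 x + (p x^3 * w x + 3 * p x * w2 x + 3 * q x * w1 x)
        = - (d * \<psi> x) * w x + w2 x + 2 * p x * w1 x + (q x + (p x)\<^sup>2) * w x - (r x + 3 * p x * q x) * w x"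
        unfolding wdefs p_def q_def r_def by (rule W_pde) (use eq x in blast)
      have "et x + Hd x \<le> - c * ?g x + C1 * (k^4 * (w x)\<^sup>2 + k\<^sup>2 * (w1 x)\<^sup>2 + (w2 x)\<^sup>2)
        + (if x \<in> {l1..l2} then C2 * ?g x else 0)"
        unfolding et_def Hd_def C1_def C2_def
        by (rule carleman_pointwise[OF k(1) _ A _ _ _ dk p_def q_def r_def pde _ out])
          (use const bounds[OF x] in simp_all)
      then show ?thesis by (cases "x \<in> {l1..l2}") (simp_all only: if_True if_False mult_zero_right)
    qed
    have cet: "continuous_on I et"
      unfolding et_def[abs_def] by (intro continuous_intros cw cp cont)
    have "J et + (H L - H (-L)) \<le> - c * (k^5 * A0 + k * A2) + C1 * (k^4 * A0 + k\<^sup>2 * A1 + A2) + C2 * O1"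
    proof (rule has_integral_le[OF has_integral_add[OF int[OF cet] intHd]])
      show "((\<lambda>x. - c * ?g x + C1 * (k^4 * (w x)\<^sup>2 + k\<^sup>2 * (w1 x)\<^sup>2 + (w2 x)\<^sup>2)
        + C2 * (if x \<in> {l1..l2} then ?g x else 0)) has_integral
        - c * (k^5 * A0 + k * A2) + C1 * (k^4 * A0 + k\<^sup>2 * A1 + A2) + C2 * O1) I"
        by (intro has_integral_add has_integral_mult_right iA ig iO)
    qed (use pw in blast)
    \<comment> \<open>Integrating \<open>k (k^2 w + w2)^2 \<ge> 0\<close> and using that the
      integral of \<open>w1^2\<close> is minus that of \<open>w * w2\<close> bounds the middle term
      by the outer two. The lower-order terms then gain a factor \<open>1 / k\<close>.\<close>
    moreover have "C1 * (k^4 * A0 + k\<^sup>2 * A1 + A2) \<le> (c / 2) * (k^5 * A0 + k * A2)"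
      and k3A1: "2 * (k^3 * A1) \<le> k^5 * A0 + k * A2"
    proof -
      have A1: "A1 = - J (\<lambda>x. w x * w2 x)"
        using integral_by_parts_Icc[OF LL dw(1,2) cw(2,3)] bc
        by (simp add: A1_def J_def power2_eq_square)
      have i: "((\<lambda>x. k^5 * (w x)\<^sup>2 + k * (w2 x)\<^sup>2 + 2 * k^3 * (w x * w2 x)) has_integral
          (k^5 * A0 + k * A2 + 2 * k^3 * J (\<lambda>x. w x * w2 x))) I"
        by (intro has_integral_add has_integral_mult_right iA int continuous_intros cw)
      have nn: "0 \<le> k^5 * (w x)\<^sup>2 + k * (w2 x)\<^sup>2 + 2 * k^3 * (w x * w2 x)" for x
      proof -
        have "k^5 * (w x)\<^sup>2 + k * (w2 x)\<^sup>2 + 2 * k^3 * (w x * w2 x) = k * (k\<^sup>2 * w x + w2 x)\<^sup>2"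
          by (simp add: power2_eq_square eval_nat_numeral algebra_simps)
        then show ?thesis using k by simp
      qed
      show 1: "2 * (k^3 * A1) \<le> k^5 * A0 + k * A2"
        using has_integral_nonneg[OF i nn] by (simp add: A1)
      have "k * (C1 * (k^4 * A0 + k\<^sup>2 * A1 + A2)) = C1 * (k^5 * A0 + k^3 * A1 + k * A2)"
        by (simp add: eval_nat_numeral algebra_simps)
      also have "\<dots> \<le> C1 * ((3/2) * (k^5 * A0 + k * A2))"
      proof (rule mult_left_mono)
        show "k^5 * A0 + k^3 * A1 + k * A2 \<le> (3/2) * (k^5 * A0 + k * A2)"
          using 1 by (simp add: field_simps)
      qed (use C1 in simp)
      also have "\<dots> = (3 * C1) * ((k^5 * A0 + k * A2) / 2)" by simp
      also have "\<dots> \<le> (c * k) * ((k^5 * A0 + k * A2) / 2)"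
      proof (rule mult_right_mono)
        have "3 * C1 / c \<le> k" using k0(2) kk0 by linarith
        then show "3 * C1 \<le> c * k" using const(3) by (simp add: field_simps)
        have "0 \<le> k^5 * A0" "0 \<le> k * A2" using A012 k by simp_all
        then show "0 \<le> (k^5 * A0 + k * A2) / 2" by simp
      qed
      also have "\<dots> = k * ((c / 2) * (k^5 * A0 + k * A2))" by simp
      finally show "C1 * (k^4 * A0 + k\<^sup>2 * A1 + A2) \<le> (c / 2) * (k^5 * A0 + k * A2)"
        using k(2) by (simp only: mult_le_cancel_left_pos)
    qed
    moreover have "c * k * (w2 (-L))\<^sup>2 + 3 * c^3 * k^3 * (w1 (-L))\<^sup>2 \<le> H L - H (-L)"
    proof -
      \<comment> \<open>At \<open>L\<close> all of \<open>w\<close>, \<open>w1\<close>,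
        \<open>wt\<close> vanish and only \<open>(3/2) p w2^2\<close> remains; at \<open>-L\<close>
        the function \<open>w1\<close> survives as well, with coefficient
        \<open>(9/2 - 1/2) p^3\<close>.\<close>
      have HL: "0 \<le> H L" using ends(2) k by (simp add: H_def bc p_def)
      have mL: "-L \<in> I" using L by simp
      define b1 b2 P where "b1 = w1 (-L)" and "b2 = w2 (-L)" and "P = - p1 (-L)"
      have P: "c \<le> P" using ends(1) by (simp add: P_def)
      have HmL: "- H (-L) = 4 * (k * P)^3 * b1\<^sup>2 + (3/2) * (k * P) * b2\<^sup>2 - 3 * (k * p2 (-L)) * b2 * b1"
        by (simp add: H_def bc p_def q_def b1_def b2_def P_def power_mult_distrib eval_nat_numeral algebra_simps)
      have 1: "4 * (k * c)^3 * b1\<^sup>2 \<le> 4 * (k * P)^3 * b1\<^sup>2"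
        using P k const by (intro mult_right_mono mult_left_mono power_mono) auto
      have 2: "(3/2) * (k * c) * b2\<^sup>2 \<le> (3/2) * (k * P) * b2\<^sup>2"
        using P k const by (intro mult_right_mono mult_left_mono) auto
      \<comment> \<open>A weighted Young inequality takes one of the four units of
        \<open>c^3 k^3 b1^2\<close> and one half of the \<open>(3/2) c k b2^2\<close>, which leaves
        the coefficients 3 and 1 of the claim.\<close>
      have 3: "3 * (k * p2 (-L)) * b2 * b1 \<le> (1/2) * (k * c) * b2\<^sup>2 + c^3 * k^3 * b1\<^sup>2"
      proof -
        have "0 \<le> (c * b2 - 3 * p2 (-L) * b1)\<^sup>2" by simp
        then have "2 * (c * (3 * p2 (-L) * b2 * b1)) \<le> c\<^sup>2 * b2\<^sup>2 + 9 * (p2 (-L))\<^sup>2 * b1\<^sup>2"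
          by (simp add: power2_eq_square algebra_simps)
        also have "(p2 (-L))\<^sup>2 \<le> M\<^sup>2" using bounds[OF mL] const by (auto simp: abs_le_square_iff[symmetric])
        then have "9 * (p2 (-L))\<^sup>2 * b1\<^sup>2 \<le> 9 * M\<^sup>2 * b1\<^sup>2" by (intro mult_right_mono) auto
        also have "9 * M\<^sup>2 * b1\<^sup>2 \<le> (c^4 * k\<^sup>2) * b1\<^sup>2"
        proof (rule mult_right_mono)
          have "9 * M\<^sup>2 / c^4 \<le> k" using k0(3) kk0 by linarith
          then have "9 * M\<^sup>2 \<le> c^4 * k" using const(3) by (simp add: field_simps)
          also have "\<dots> \<le> c^4 * k\<^sup>2" using k by (intro mult_left_mono) (auto simp: power2_eq_square)
          finally show "9 * M\<^sup>2 \<le> c^4 * k\<^sup>2" .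
        qed simp
        finally have "2 * (c * (3 * p2 (-L) * b2 * b1)) \<le> c\<^sup>2 * b2\<^sup>2 + (c^4 * k\<^sup>2) * b1\<^sup>2" by simp
        then have "(2 * c) * (3 * p2 (-L) * b2 * b1) \<le> (2 * c) * ((1/2) * c * b2\<^sup>2 + (1/2) * c^3 * k\<^sup>2 * b1\<^sup>2)"
          by (simp add: power2_eq_square eval_nat_numeral algebra_simps)
        then have "3 * p2 (-L) * b2 * b1 \<le> (1/2) * c * b2\<^sup>2 + (1/2) * c^3 * k\<^sup>2 * b1\<^sup>2"
          using const(3) by (simp only: mult_le_cancel_left_pos mult_pos_pos zero_less_numeral)
        then have "k * (3 * p2 (-L) * b2 * b1) \<le> k * ((1/2) * c * b2\<^sup>2 + (1/2) * c^3 * k\<^sup>2 * b1\<^sup>2)"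
          using k by (intro mult_left_mono) auto
        moreover have "0 \<le> c^3 * k^3 * b1\<^sup>2" using k const by simp
        ultimately show ?thesis by (simp add: power2_eq_square eval_nat_numeral algebra_simps)
      qed
      have "c * k * b2\<^sup>2 + 3 * c^3 * k^3 * b1\<^sup>2 \<le> - H (-L)"
        unfolding HmL using 1 2 3 by (simp add: power_mult_distrib algebra_simps)
      then show ?thesis using HL unfolding b1_def b2_def by linarith
    qed
    moreover have "J (\<lambda>x. k^5 * (w x)\<^sup>2 + k^3 * (w1 x)\<^sup>2 + k * (w2 x)\<^sup>2) = k^5 * A0 + k^3 * A1 + k * A2"
      unfolding J_def by (rule integral_unique) (intro has_integral_add has_integral_mult_right iA)
    moreover have "(c / 4) * (k^5 * A0 + k^3 * A1 + k * A2) \<le> (c / 2) * (k^5 * A0 + k * A2)"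
    proof -
      have A1: "0 \<le> k^3 * A1" using k A012 by simp
      have "(c / 4) * (k^5 * A0 + k^3 * A1 + k * A2) \<le> (c / 4) * (2 * (k^5 * A0 + k * A2))"
      proof (rule mult_left_mono)
        show "k^5 * A0 + k^3 * A1 + k * A2 \<le> 2 * (k^5 * A0 + k * A2)"
          using k3A1 A1 by (simp add: field_simps)
      qed (use const in simp)
      moreover have "(c / 4) * (2 * y) = (c / 2) * y" for y by simp
      ultimately show ?thesis by (simp only:)
    qed
    moreover have "s + D \<le> - E + R"
      if "E + B \<le> - c * G + Q + R" "Q \<le> (c / 2) * G" "D \<le> B" "s \<le> (c / 2) * G" for E B G Q R D s :: real
      using that by (simp add: field_simps)
    ultimately show ?thesis
      unfolding J_def[symmetric] O1_def[symmetric] et wdefs[symmetric] by simp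
  qed
  moreover have "0 < k0" using k0 by simp
  ultimately show ?thesis using that C2 by blast
qed

end

section \<open>Return from the conjugated function to the solution\<close>

lemma square_sum2_le: "(a + b)\<^sup>2 \<le> 2 * (a\<^sup>2 + b\<^sup>2)" for a b :: real
  using sum_squares_bound[of a b] by (simp add: power2_sum)

lemma square_sum3_le: "(a + b + c)\<^sup>2 \<le> 3 * (a\<^sup>2 + b\<^sup>2 + c\<^sup>2)" for a b c :: real
  using sum_squares_bound[of a b] sum_squares_bound[of a c] sum_squares_bound[of b c]
  by (simp add: power2_eq_square algebra_simps)

context carleman_weight
begin

text \<open>The integrand of the statement at a fixed time, with \<open>s / (t (T - t))\<close>
  abbreviated to \<open>k\<close>; \<open>weight_rescale\<close> makes the link.\<close>

definition "wdensity k u u1 u2 x =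
  (k^5 * \<psi> x ^ 5 * (u x)\<^sup>2 + k^3 * \<psi> x ^ 3 * (u1 x)\<^sup>2 + k * \<psi> x * (u2 x)\<^sup>2) * exp (- (2 * k * \<psi> x))"

definition "bdensity k u1 u2 =
  (k^3 * \<psi> L ^ 3 * (u1 (-L))\<^sup>2 + k * \<psi> L * (u2 (-L))\<^sup>2) * exp (- (2 * k * \<psi> L))"

lemma exp_minus_double: "exp (- (2 * k * y)) = (exp (- (k * y)))\<^sup>2" for k y :: real
  by (simp add: exp_double[symmetric] mult_ac)

lemma psi_powers:
  assumes "x \<in> I"
  shows "m^n \<le> \<psi> x ^ n" "\<psi> x ^ n \<le> M^n" "0 < \<psi> x"
  using bounds[OF assms] const by (auto intro!: power_mono)

text \<open>Undoing the conjugation, each missing derivative costs a factor \<open>k\<close>. This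
  is exactly the ratio built into the weights \<open>k^5\<close>, \<open>k^3\<close>,
  \<open>k\<close>, so the constant does not depend on \<open>k\<close>.\<close>

lemma wdensity_le_W:
  assumes k: "1 \<le> k" and x: "x \<in> I"
  shows "wdensity k u u1 u2 x \<le> (3 * M^5 + 14 * M^3 + 3 * M + 3 * M * (M\<^sup>2 + M)\<^sup>2) *
    (k^5 * (W0 k u x)\<^sup>2 + k^3 * (W1 k u u1 x)\<^sup>2 + k * (W2 k u u1 u2 x)\<^sup>2)"
proof -
  define e where "e = exp (- (k * \<psi> x))"
  define w w1 w2 P Q where "w = W0 k u x" and "w1 = W1 k u u1 x" and "w2 = W2 k u u1 u2 x"
    and "P = p1 x" and "Q = p2 x"
  have k0: "0 \<le> k" using k by simp
  have kk: "k \<le> k\<^sup>2" using k by (auto simp: power2_eq_square)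
  have PQ: "\<bar>P\<bar> \<le> M" "\<bar>Q\<bar> \<le> M" using bounds[OF x] by (auto simp: P_def Q_def)
  have P2: "P\<^sup>2 \<le> M\<^sup>2" using PQ(1) const by (simp add: abs_le_square_iff[symmetric])
  have eu: "e * u x = w" "e * u1 x = w1 + k * P * w" "e * u2 x = w2 + 2 * k * P * w1 + (k\<^sup>2 * P\<^sup>2 + k * Q) * w"
    unfolding e_def w_def w1_def w2_def W0_def W1_def W2_def P_def Q_def
    by (simp_all add: algebra_simps power2_eq_square)
  have "wdensity k u u1 u2 x = k^5 * \<psi> x ^ 5 * (e * u x)\<^sup>2 + k^3 * \<psi> x ^ 3 * (e * u1 x)\<^sup>2 + k * \<psi> x * (e * u2 x)\<^sup>2"
    unfolding wdensity_def exp_minus_double e_def by (simp add: power_mult_distrib algebra_simps)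
  also have "\<dots> \<le> k^5 * M^5 * (e * u x)\<^sup>2 + k^3 * M^3 * (e * u1 x)\<^sup>2 + k * M * (e * u2 x)\<^sup>2"
    using psi_powers(2)[OF x, of 5] psi_powers(2)[OF x, of 3] psi_powers(2)[OF x, of 1] k0
    by (intro add_mono mult_right_mono mult_left_mono) auto
  finally have D: "wdensity k u u1 u2 x \<le> M^5 * (k^5 * (e * u x)\<^sup>2) + M^3 * (k^3 * (e * u1 x)\<^sup>2) + M * (k * (e * u2 x)\<^sup>2)"
    by (simp add: mult_ac)
  have 1: "k^3 * (e * u1 x)\<^sup>2 \<le> 2 * (k^3 * w1\<^sup>2) + 2 * M\<^sup>2 * (k^5 * w\<^sup>2)"
  proof -
    have "(e * u1 x)\<^sup>2 \<le> 2 * (w1\<^sup>2 + k\<^sup>2 * P\<^sup>2 * w\<^sup>2)"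
      unfolding eu using square_sum2_le[of w1 "k * P * w"] by (simp add: power_mult_distrib)
    also have "\<dots> \<le> 2 * (w1\<^sup>2 + k\<^sup>2 * M\<^sup>2 * w\<^sup>2)"
      using P2 by (intro mult_left_mono add_left_mono mult_right_mono) auto
    finally have "k^3 * (e * u1 x)\<^sup>2 \<le> k^3 * (2 * (w1\<^sup>2 + k\<^sup>2 * M\<^sup>2 * w\<^sup>2))"
      using k0 by (intro mult_left_mono) auto
    then show ?thesis by (simp add: algebra_simps eval_nat_numeral)
  qed
  have 2: "k * (e * u2 x)\<^sup>2 \<le> 3 * (k * w2\<^sup>2) + 12 * M\<^sup>2 * (k^3 * w1\<^sup>2) + 3 * (M\<^sup>2 + M)\<^sup>2 * (k^5 * w\<^sup>2)"
  proof -
    have "\<bar>k\<^sup>2 * P\<^sup>2 + k * Q\<bar> \<le> k\<^sup>2 * M\<^sup>2 + k\<^sup>2 * M"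
    proof -
      have "k\<^sup>2 * P\<^sup>2 \<le> k\<^sup>2 * M\<^sup>2" using P2 by (intro mult_left_mono) auto
      moreover have "\<bar>k * Q\<bar> \<le> k\<^sup>2 * M"
        unfolding abs_mult using PQ(2) kk k0 by (intro mult_mono) auto
      moreover have "0 \<le> k\<^sup>2 * P\<^sup>2" by simp
      ultimately show ?thesis by linarith
    qed
    then have "(k\<^sup>2 * P\<^sup>2 + k * Q)\<^sup>2 \<le> (k\<^sup>2 * (M\<^sup>2 + M))\<^sup>2"
      using const by (simp add: abs_le_square_iff[symmetric] distrib_left)
    then have a: "(k\<^sup>2 * P\<^sup>2 + k * Q)\<^sup>2 * w\<^sup>2 \<le> (k\<^sup>2 * (M\<^sup>2 + M))\<^sup>2 * w\<^sup>2" by (rule mult_right_mono) simp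
    have b: "P\<^sup>2 * w1\<^sup>2 \<le> M\<^sup>2 * w1\<^sup>2" using P2 by (rule mult_right_mono) simp
    have "(e * u2 x)\<^sup>2 \<le> 3 * (w2\<^sup>2 + 4 * k\<^sup>2 * (P\<^sup>2 * w1\<^sup>2) + (k\<^sup>2 * P\<^sup>2 + k * Q)\<^sup>2 * w\<^sup>2)"
      unfolding eu using square_sum3_le[of w2 "2 * k * P * w1" "(k\<^sup>2 * P\<^sup>2 + k * Q) * w"]
      by (simp add: power_mult_distrib mult_ac)
    also have "\<dots> \<le> 3 * (w2\<^sup>2 + 4 * k\<^sup>2 * (M\<^sup>2 * w1\<^sup>2) + (k\<^sup>2 * (M\<^sup>2 + M))\<^sup>2 * w\<^sup>2)"
      using a b by (intro mult_left_mono add_mono) auto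
    finally have "k * (e * u2 x)\<^sup>2 \<le> k * (3 * (w2\<^sup>2 + 4 * k\<^sup>2 * (M\<^sup>2 * w1\<^sup>2) + (k\<^sup>2 * (M\<^sup>2 + M))\<^sup>2 * w\<^sup>2))"
      using k0 by (intro mult_left_mono) auto
    then show ?thesis by (simp add: power_mult_distrib) (simp add: algebra_simps eval_nat_numeral)
  qed
  define X Y Z where "X = k^5 * w\<^sup>2" and "Y = k^3 * w1\<^sup>2" and "Z = k * w2\<^sup>2"
  have XYZ: "0 \<le> X" "0 \<le> Y" "0 \<le> Z" using k0 by (auto simp: X_def Y_def Z_def)
  define C where "C = 3 * M^5 + 14 * M^3 + 3 * M + 3 * M * (M\<^sup>2 + M)\<^sup>2"
  have nn: "0 \<le> M^5" "0 \<le> M^3" "0 \<le> M" "0 \<le> M * (M\<^sup>2 + M)\<^sup>2" using const by auto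
  have "M^3 * (k^3 * (e * u1 x)\<^sup>2) \<le> M^3 * (2 * Y + 2 * M\<^sup>2 * X)"
    using 1 nn unfolding X_def Y_def by (intro mult_left_mono) auto
  moreover have "M * (k * (e * u2 x)\<^sup>2) \<le> M * (3 * Z + 12 * M\<^sup>2 * Y + 3 * (M\<^sup>2 + M)\<^sup>2 * X)"
    using 2 nn unfolding X_def Y_def Z_def by (intro mult_left_mono) auto
  ultimately have "wdensity k u u1 u2 x \<le> M^5 * X + M^3 * (2 * Y + 2 * M\<^sup>2 * X) + M * (3 * Z + 12 * M\<^sup>2 * Y + 3 * (M\<^sup>2 + M)\<^sup>2 * X)"
    using D unfolding eu(1) X_def[symmetric] by linarith
  also have "\<dots> = (3 * M^5 + 3 * (M * (M\<^sup>2 + M)\<^sup>2)) * X + 14 * M^3 * Y + 3 * M * Z"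
    by (simp add: algebra_simps eval_nat_numeral)
  also have "\<dots> \<le> C * X + C * Y + C * Z"
    using XYZ nn by (intro add_mono mult_right_mono) (auto simp: C_def)
  also have "\<dots> = C * (X + Y + Z)" by (simp add: distrib_left)
  finally show ?thesis by (simp add: C_def X_def Y_def Z_def w_def w1_def w2_def)
qed

text \<open>The converse comparison, for the local term. The left side has no \<open>w1\<close>, yet
  the full density is needed on the right because \<open>w2\<close> contains
  \<open>k * p1 * u1\<close>.\<close>

lemma W_le_density:
  assumes k: "1 \<le> k" and x: "x \<in> I"
  shows "k^5 * (W0 k u x)\<^sup>2 + k * (W2 k u u1 u2 x)\<^sup>2
    \<le> (1 / m^5 + 3 / m + 12 * M\<^sup>2 / m^3 + 3 * (M\<^sup>2 + M)\<^sup>2 / m^5) * wdensity k u u1 u2 x"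
proof -
  define e where "e = exp (- (k * \<psi> x))"
  define P Q where "P = p1 x" and "Q = p2 x"
  have k0: "0 \<le> k" using k by simp
  have kk: "k \<le> k\<^sup>2" using k by (auto simp: power2_eq_square)
  have PQ: "\<bar>P\<bar> \<le> M" "\<bar>Q\<bar> \<le> M" using bounds[OF x] by (auto simp: P_def Q_def)
  have P2: "P\<^sup>2 \<le> M\<^sup>2" using PQ(1) const by (simp add: abs_le_square_iff[symmetric])
  define X Y Z where "X = k^5 * (\<psi> x ^ 5 * (e * u x)\<^sup>2)" and "Y = k^3 * (\<psi> x ^ 3 * (e * u1 x)\<^sup>2)"
    and "Z = k * (\<psi> x * (e * u2 x)\<^sup>2)"
  have \<psi>0: "0 < \<psi> x" by (rule psi_powers(3)[OF x])
  have XYZ: "0 \<le> X" "0 \<le> Y" "0 \<le> Z" using k0 \<psi>0 by (auto simp: X_def Y_def Z_def)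
  have D: "wdensity k u u1 u2 x = X + Y + Z"
    unfolding wdensity_def exp_minus_double e_def X_def Y_def Z_def by (simp add: power_mult_distrib algebra_simps)
  have inv: "y \<le> (1 / m^n) * (\<psi> x ^ n * y)" if "0 \<le> y" for y n
    using mult_right_mono[OF psi_powers(1)[OF x, of n] that] const by (simp add: field_simps)
  have x0: "k^5 * (e * u x)\<^sup>2 \<le> (1 / m^5) * X"
    unfolding X_def using inv[of "(e * u x)\<^sup>2" 5] mult_left_mono[of "(e * u x)\<^sup>2" "(1 / m^5) * (\<psi> x ^ 5 * (e * u x)\<^sup>2)" "k^5"] k0
    by (simp add: mult_ac)
  have x1: "k^3 * (e * u1 x)\<^sup>2 \<le> (1 / m^3) * Y"
    unfolding Y_def using inv[of "(e * u1 x)\<^sup>2" 3] mult_left_mono[of "(e * u1 x)\<^sup>2" "(1 / m^3) * (\<psi> x ^ 3 * (e * u1 x)\<^sup>2)" "k^3"] k0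
    by (simp add: mult_ac)
  have x2: "k * (e * u2 x)\<^sup>2 \<le> (1 / m) * Z"
    unfolding Z_def using inv[of "(e * u2 x)\<^sup>2" 1] mult_left_mono[of "(e * u2 x)\<^sup>2" "(1 / m) * (\<psi> x * (e * u2 x)\<^sup>2)" "k"] k0
    by (simp add: mult_ac)
  have w0: "W0 k u x = e * u x" by (simp add: W0_def e_def)
  have w2: "W2 k u u1 u2 x = e * u2 x + (- 2 * k * P * (e * u1 x)) + (k\<^sup>2 * P\<^sup>2 - k * Q) * (e * u x)"
    by (simp add: W2_def e_def P_def Q_def algebra_simps)
  have 2: "k * (W2 k u u1 u2 x)\<^sup>2 \<le> 3 * (k * (e * u2 x)\<^sup>2) + 12 * M\<^sup>2 * (k^3 * (e * u1 x)\<^sup>2)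
      + 3 * (M\<^sup>2 + M)\<^sup>2 * (k^5 * (e * u x)\<^sup>2)"
  proof -
    have "\<bar>k\<^sup>2 * P\<^sup>2 - k * Q\<bar> \<le> k\<^sup>2 * M\<^sup>2 + k\<^sup>2 * M"
    proof -
      have "k\<^sup>2 * P\<^sup>2 \<le> k\<^sup>2 * M\<^sup>2" using P2 by (intro mult_left_mono) auto
      moreover have "\<bar>k * Q\<bar> \<le> k\<^sup>2 * M"
        unfolding abs_mult using PQ(2) kk k0 by (intro mult_mono) auto
      moreover have "0 \<le> k\<^sup>2 * P\<^sup>2" by simp
      ultimately show ?thesis by linarith
    qed
    then have "(k\<^sup>2 * P\<^sup>2 - k * Q)\<^sup>2 \<le> (k\<^sup>2 * (M\<^sup>2 + M))\<^sup>2"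
      using const by (simp add: abs_le_square_iff[symmetric] distrib_left)
    then have a: "(k\<^sup>2 * P\<^sup>2 - k * Q)\<^sup>2 * (e * u x)\<^sup>2 \<le> (k\<^sup>2 * (M\<^sup>2 + M))\<^sup>2 * (e * u x)\<^sup>2" by (rule mult_right_mono) simp
    have b: "P\<^sup>2 * (e * u1 x)\<^sup>2 \<le> M\<^sup>2 * (e * u1 x)\<^sup>2" using P2 by (rule mult_right_mono) simp
    have "(W2 k u u1 u2 x)\<^sup>2 \<le> 3 * ((e * u2 x)\<^sup>2 + 4 * k\<^sup>2 * (P\<^sup>2 * (e * u1 x)\<^sup>2) + (k\<^sup>2 * P\<^sup>2 - k * Q)\<^sup>2 * (e * u x)\<^sup>2)"
      unfolding w2 using square_sum3_le[of "e * u2 x" "- 2 * k * P * (e * u1 x)" "(k\<^sup>2 * P\<^sup>2 - k * Q) * (e * u x)"]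
      by (simp add: power_mult_distrib mult_ac)
    also have "\<dots> \<le> 3 * ((e * u2 x)\<^sup>2 + 4 * k\<^sup>2 * (M\<^sup>2 * (e * u1 x)\<^sup>2) + (k\<^sup>2 * (M\<^sup>2 + M))\<^sup>2 * (e * u x)\<^sup>2)"
      using a b by (intro mult_left_mono add_mono) auto
    finally have "k * (W2 k u u1 u2 x)\<^sup>2 \<le> k * (3 * ((e * u2 x)\<^sup>2 + 4 * k\<^sup>2 * (M\<^sup>2 * (e * u1 x)\<^sup>2) + (k\<^sup>2 * (M\<^sup>2 + M))\<^sup>2 * (e * u x)\<^sup>2))"
      using k0 by (intro mult_left_mono) auto
    also have "\<dots> = 3 * (k * (e * u2 x)\<^sup>2) + 12 * M\<^sup>2 * (k^3 * (e * u1 x)\<^sup>2) + 3 * (M\<^sup>2 + M)\<^sup>2 * (k^5 * (e * u x)\<^sup>2)"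
      unfolding power_mult_distrib[of "k\<^sup>2" "M\<^sup>2 + M"] by (simp add: algebra_simps eval_nat_numeral)
    finally show ?thesis .
  qed
  define c0 c1 c2 c3 where "c0 = 1 / m^5" and "c1 = 12 * M\<^sup>2 / m^3" and "c2 = 3 / m" and "c3 = 3 * (M\<^sup>2 + M)\<^sup>2 / m^5"
  have c: "0 \<le> c0" "0 \<le> c1" "0 \<le> c2" "0 \<le> c3" using const by (auto simp: c0_def c1_def c2_def c3_def)
  have "12 * M\<^sup>2 * (k^3 * (e * u1 x)\<^sup>2) \<le> c1 * Y"
    using mult_left_mono[OF x1, of "12 * M\<^sup>2"] by (simp add: c1_def)
  moreover have "3 * (M\<^sup>2 + M)\<^sup>2 * (k^5 * (e * u x)\<^sup>2) \<le> c3 * X"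
    using mult_left_mono[OF x0, of "3 * (M\<^sup>2 + M)\<^sup>2"] by (simp add: c3_def)
  moreover have "3 * (k * (e * u2 x)\<^sup>2) \<le> c2 * Z" using x2 by (simp add: c2_def)
  moreover have "k^5 * (W0 k u x)\<^sup>2 \<le> c0 * X" using x0 unfolding w0 c0_def .
  ultimately have "k^5 * (W0 k u x)\<^sup>2 + k * (W2 k u u1 u2 x)\<^sup>2 \<le> (c0 + c3) * X + c1 * Y + c2 * Z"
    using 2 unfolding distrib_right by linarith
  also have "\<dots> \<le> (c0 + c2 + c1 + c3) * X + (c0 + c2 + c1 + c3) * Y + (c0 + c2 + c1 + c3) * Z"
    using XYZ c by (intro add_mono mult_right_mono) auto
  also have "\<dots> = (c0 + c2 + c1 + c3) * wdensity k u u1 u2 x" unfolding D by (simp add: distrib_left)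
  finally show ?thesis by (simp add: c0_def c1_def c2_def c3_def)
qed

text \<open>At \<open>-L\<close> the function \<open>u\<close> vanishes, so conjugation mixes only
  \<open>u1\<close> into \<open>w2\<close>. The density carries the weight at \<open>L\<close>,
  which equals that at \<open>-L\<close>.\<close>

lemma bdensity_le_W:
  assumes k: "1 \<le> k" and u: "u (-L) = 0"
  shows "bdensity k u1 u2 \<le> (9 * M^3 + 2 * M) * (k^3 * (W1 k u u1 (-L))\<^sup>2 + k * (W2 k u u1 u2 (-L))\<^sup>2)"
proof -
  define e where "e = exp (- (k * \<psi> (-L)))"
  define w1 w2 P where "w1 = W1 k u u1 (-L)" and "w2 = W2 k u u1 u2 (-L)" and "P = p1 (-L)"
  have mL: "-L \<in> I" using L by simp
  have k0: "0 \<le> k" using k by simp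
  have P2: "P\<^sup>2 \<le> M\<^sup>2" using bounds[OF mL] const by (simp add: abs_le_square_iff[symmetric] P_def)
  have eu: "e * u1 (-L) = w1" "e * u2 (-L) = w2 + 2 * k * P * w1"
    unfolding e_def w1_def w2_def W1_def W2_def P_def using u by (simp_all add: algebra_simps)
  have "bdensity k u1 u2 = k^3 * \<psi> (-L) ^ 3 * (e * u1 (-L))\<^sup>2 + k * \<psi> (-L) * (e * u2 (-L))\<^sup>2"
    unfolding bdensity_def exp_minus_double e_def ends(3) by (simp add: power_mult_distrib algebra_simps)
  also have "\<dots> \<le> k^3 * M^3 * w1\<^sup>2 + k * M * (2 * (w2\<^sup>2 + 4 * k\<^sup>2 * M\<^sup>2 * w1\<^sup>2))"
  proof (intro add_mono mult_mono mult_left_mono)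
    show "\<psi> (-L) ^ 3 \<le> M^3" "\<psi> (-L) \<le> M" using psi_powers(2)[OF mL, of 3] bounds[OF mL] by auto
    have "(e * u2 (-L))\<^sup>2 \<le> 2 * (w2\<^sup>2 + 4 * k\<^sup>2 * (P\<^sup>2 * w1\<^sup>2))"
      unfolding eu using square_sum2_le[of w2 "2 * k * P * w1"] by (simp add: power_mult_distrib mult_ac)
    also have "\<dots> \<le> 2 * (w2\<^sup>2 + 4 * k\<^sup>2 * (M\<^sup>2 * w1\<^sup>2))"
      using P2 by (intro mult_left_mono add_left_mono mult_right_mono) auto
    finally show "(e * u2 (-L))\<^sup>2 \<le> 2 * (w2\<^sup>2 + 4 * k\<^sup>2 * M\<^sup>2 * w1\<^sup>2)" by (simp add: mult.assoc)
  qed (use k0 const eu psi_powers(3)[OF mL] in auto)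
  also have "\<dots> = 9 * M^3 * (k^3 * w1\<^sup>2) + 2 * M * (k * w2\<^sup>2)"
    by (simp add: algebra_simps eval_nat_numeral)
  also have "\<dots> \<le> (9 * M^3 + 2 * M) * (k^3 * w1\<^sup>2) + (9 * M^3 + 2 * M) * (k * w2\<^sup>2)"
    using k0 const by (intro add_mono mult_right_mono) auto
  finally show ?thesis by (simp add: w1_def w2_def distrib_left)
qed

lemma wdensity_continuous:
  assumes "dom3 L u u1 u2 u3"
  shows "continuous_on I (wdensity k u u1 u2)"
  unfolding wdensity_def[abs_def] by (intro continuous_intros cont dom3D(4-6)[OF assms])

lemma wdensity_nonneg: "0 \<le> k \<Longrightarrow> x \<in> I \<Longrightarrow> 0 \<le> wdensity k u u1 u2 x"
  unfolding wdensity_def using psi_powers(3)[of x]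
  by (intro mult_nonneg_nonneg add_nonneg_nonneg) (auto intro: less_imp_le)

lemma bdensity_nonneg: "0 \<le> k \<Longrightarrow> 0 \<le> bdensity k u1 u2"
  unfolding bdensity_def using psi_powers(3)[of L] L
  by (intro mult_nonneg_nonneg add_nonneg_nonneg) (auto intro: less_imp_le)

lemma carleman_static_u:
  assumes T: "0 \<le> T"
  obtains k0 C D where "1 \<le> k0" "0 < C" "0 < D"
    "\<And>k d u u1 u2 u3 v v1 v2 v3. k0 \<le> k \<Longrightarrow> \<bar>d\<bar> \<le> T * k\<^sup>2 \<Longrightarrow> dom3 L u u1 u2 u3 \<Longrightarrow> dom3 L v v1 v2 v3 \<Longrightarrow>
      (\<forall>x\<in>I. v x = u2 x - u3 x) \<Longrightarrow>
      integral I (wdensity k u u1 u2) + bdensity k u1 u2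
      \<le> C * (- integral I (energy_rate k d u u1 v v1)) + D * integral {l1..l2} (wdensity k u u1 u2)"
proof -
  obtain k0 C2 where k0: "0 < k0" and C2: "0 < C2"
    and main: "\<And>k d u u1 u2 u3 v v1 v2 v3. k0 \<le> k \<Longrightarrow> \<bar>d\<bar> \<le> T * k\<^sup>2 \<Longrightarrow> dom3 L u u1 u2 u3 \<Longrightarrow> dom3 L v v1 v2 v3 \<Longrightarrow>
      (\<forall>x\<in>I. v x = u2 x - u3 x) \<Longrightarrow>
      (c / 4) * integral I (\<lambda>x. k^5 * (W0 k u x)\<^sup>2 + k^3 * (W1 k u u1 x)\<^sup>2 + k * (W2 k u u1 u2 x)\<^sup>2)
        + (c * k * (W2 k u u1 u2 (-L))\<^sup>2 + 3 * c^3 * k^3 * (W1 k u u1 (-L))\<^sup>2)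
      \<le> - integral I (energy_rate k d u u1 v v1)
        + C2 * integral {l1..l2} (\<lambda>x. k^5 * (W0 k u x)\<^sup>2 + k * (W2 k u u1 u2 x)\<^sup>2)"
    by (rule carleman_static[OF T], rule that; assumption)
  define a1 where "a1 = 3 * M^5 + 14 * M^3 + 3 * M + 3 * M * (M\<^sup>2 + M)\<^sup>2"
  define a2 where "a2 = 1 / m^5 + 3 / m + 12 * M\<^sup>2 / m^3 + 3 * (M\<^sup>2 + M)\<^sup>2 / m^5"
  define a3 where "a3 = 9 * M^3 + 2 * M"
  have a: "0 < a1" "0 < a2" "0 < a3"
  proof -
    have "0 < M\<^sup>2 + M" using const by (intro add_pos_pos) auto
    then have "0 < (M\<^sup>2 + M)\<^sup>2" by (rule zero_less_power)
    with const show "0 < a1" "0 < a2" "0 < a3"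
      unfolding a1_def a2_def a3_def by (intro add_pos_pos mult_pos_pos divide_pos_pos; simp)+
  qed
  define \<delta> where "\<delta> = min c (3 * c^3)"
  have \<delta>: "0 < \<delta>" "\<delta> \<le> c" "\<delta> \<le> 3 * c^3" using const by (auto simp: \<delta>_def)
  \<comment> \<open>Large enough for \<open>K\<close> times the left side of the static estimate to
    dominate the interior density and the boundary density at the same time.\<close>
  define K where "K = 4 * a1 / c + a3 / \<delta>"
  have K: "0 < K" "4 * a1 / c \<le> K" "a3 / \<delta> \<le> K" using a \<delta> const by (auto simp: K_def intro!: add_pos_pos)
  have K': "a1 \<le> K * (c / 4)" "a3 \<le> K * \<delta>"
    using K(2,3) const \<delta>(1) by (auto simp: field_simps)
  have step: "integral I (wdensity k u u1 u2) + bdensity k u1 u2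
      \<le> K * (- integral I (energy_rate k d u u1 v v1)) + K * (C2 * a2) * integral {l1..l2} (wdensity k u u1 u2)"
    if k: "max 1 k0 \<le> k" and d: "\<bar>d\<bar> \<le> T * k\<^sup>2" and U: "dom3 L u u1 u2 u3" and V: "dom3 L v v1 v2 v3"
      and eq: "\<forall>x\<in>I. v x = u2 x - u3 x" for k d u u1 u2 u3 v v1 v2 v3
  proof -
    have k1: "1 \<le> k" "k0 \<le> k" "0 \<le> k" using k by auto
    let ?Q = "\<lambda>x. k^5 * (W0 k u x)\<^sup>2 + k^3 * (W1 k u u1 x)\<^sup>2 + k * (W2 k u u1 u2 x)\<^sup>2"
    let ?q = "\<lambda>x. k^5 * (W0 k u x)\<^sup>2 + k * (W2 k u u1 u2 x)\<^sup>2"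
    define b1 b2 where "b1 = k^3 * (W1 k u u1 (-L))\<^sup>2" and "b2 = k * (W2 k u u1 u2 (-L))\<^sup>2"
    have b: "0 \<le> b1" "0 \<le> b2" using k1 by (auto simp: b1_def b2_def)
    have sub: "{l1..l2} \<subseteq> I" using l by auto
    have cQ: "continuous_on I ?Q" "continuous_on I ?q" by (intro continuous_intros W_continuous[OF U])+
    have Q0: "0 \<le> integral I ?Q"
      using k1 by (intro integral_nonneg integrable_continuous_real cQ) auto
    have 1: "integral I (wdensity k u u1 u2) \<le> a1 * integral I ?Q"
    proof -
      have "integral I (wdensity k u u1 u2) \<le> integral I (\<lambda>x. a1 * ?Q x)"
        by (intro integral_le integrable_continuous_real continuous_on_mult continuous_on_const cQ wdensity_continuous[OF U])
          (simp add: a1_def wdensity_le_W[OF k1(1)])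
      then show ?thesis by simp
    qed
    have 2: "integral {l1..l2} ?q \<le> a2 * integral {l1..l2} (wdensity k u u1 u2)"
    proof -
      have "integral {l1..l2} ?q \<le> integral {l1..l2} (\<lambda>x. a2 * wdensity k u u1 u2 x)"
        by (intro integral_le integrable_continuous_real continuous_on_mult continuous_on_const
            continuous_on_subset[OF cQ(2) sub] continuous_on_subset[OF wdensity_continuous[OF U] sub])
          (use sub W_le_density[OF k1(1)] in \<open>auto simp: a2_def\<close>)
      then show ?thesis by simp
    qed
    have "bdensity k u1 u2 \<le> a3 * (b1 + b2)"
      unfolding a3_def b1_def b2_def by (rule bdensity_le_W[where u = u, OF k1(1) dom3D(8)[OF U]])
    also have "\<dots> \<le> K * \<delta> * (b1 + b2)" using K'(2) b by (intro mult_right_mono) auto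
    also have "\<dots> = K * (\<delta> * b2 + \<delta> * b1)" by (simp add: algebra_simps)
    also have "\<dots> \<le> K * (c * b2 + 3 * c^3 * b1)"
      using \<delta> b K by (intro mult_left_mono add_mono mult_right_mono) auto
    finally have 3: "bdensity k u1 u2 \<le> K * (c * b2 + 3 * c^3 * b1)" .
    have 4: "a1 * integral I ?Q \<le> K * ((c / 4) * integral I ?Q)"
      using mult_right_mono[OF K'(1) Q0] by (simp only: mult.assoc)
    have "(c / 4) * integral I ?Q + (c * b2 + 3 * c^3 * b1)
      \<le> - integral I (energy_rate k d u u1 v v1) + C2 * integral {l1..l2} ?q"
      using main[OF k1(2) d U V eq] by (simp only: b1_def b2_def mult.assoc)
    also have "\<dots> \<le> - integral I (energy_rate k d u u1 v v1) + C2 * (a2 * integral {l1..l2} (wdensity k u u1 u2))"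
      using 2 C2 by (intro add_left_mono mult_left_mono) auto
    finally have "K * ((c / 4) * integral I ?Q + (c * b2 + 3 * c^3 * b1)) \<le>
        K * (- integral I (energy_rate k d u u1 v v1) + C2 * (a2 * integral {l1..l2} (wdensity k u u1 u2)))"
      using K(1) by (intro mult_left_mono) auto
    then show ?thesis using 1 3 4 unfolding distrib_left mult.assoc by linarith
  qed
  have "1 \<le> max 1 k0" "0 < K * (C2 * a2)" using K(1) C2 a by simp_all
  with step K(1) that show ?thesis by blast
qed

end

section \<open>Integration in time\<close>

lemma nn_integral_Ioo_continuous:
  fixes f :: "real \<Rightarrow> real"
  assumes "continuous_on {a..b} f" "\<And>x. x \<in> {a..b} \<Longrightarrow> 0 \<le> f x"
  shows "(\<integral>\<^sup>+ x\<in>{a<..<b}. ennreal (f x) \<partial>lebesgue) = ennreal (integral {a..b} f)"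
proof -
  have "(f has_integral integral {a..b} f) {a<..<b}"
    using integrable_integral[OF integrable_continuous_real[OF assms(1)]] by (simp add: has_integral_Icc_iff_Ioo)
  from nn_integral_has_integral_lebesgue'[OF _ this] assms(2) show ?thesis
    by (simp add: nn_integral_completion)
qed

lemma nn_integral_Icc_has_integral:
  fixes f :: "real \<Rightarrow> real"
  assumes "(f has_integral i) {a..b}" "\<And>x. x \<in> {a..b} \<Longrightarrow> 0 \<le> f x"
  shows "(\<integral>\<^sup>+ x\<in>{a..b}. ennreal (f x) \<partial>lebesgue) = ennreal i"
  using nn_integral_has_integral_lebesgue'[OF assms(2,1)] by (simp add: nn_integral_completion)

lemma borel_measurable_ennreal_continuous_on:
  fixes f :: "real \<Rightarrow> real"
  assumes "A \<in> sets borel" "continuous_on A f"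
  shows "(\<lambda>x. ennreal (f x) * indicator A x) \<in> borel_measurable borel"
proof -
  have "(\<lambda>x. ennreal (indicator A x *\<^sub>R f x)) \<in> borel_measurable borel"
    using borel_measurable_continuous_on_indicator[OF assms] by measurable
  also have "(\<lambda>x. ennreal (indicator A x *\<^sub>R f x)) = (\<lambda>x. ennreal (f x) * indicator A x)"
    by (auto simp: indicator_def)
  finally show ?thesis .
qed

text \<open>On a compact subinterval the energy contributes only its two end values, which become
  arbitrarily small; monotone convergence then exhausts (0,T). With nonnegative integrals the right
  side may be infinite, so integrability up to the end points is never an issue.\<close>

lemma nn_integral_Ioo_energy_estimate:
  fixes G O1 E E' :: "real \<Rightarrow> real"
  assumes T: "0 < T" and KC: "0 \<le> K" "0 \<le> C"
    and c: "continuous_on {0<..<T} G" "continuous_on {0<..<T} O1"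
    and nn: "\<And>t. t \<in> {0<..<T} \<Longrightarrow> 0 \<le> G t" "\<And>t. t \<in> {0<..<T} \<Longrightarrow> 0 \<le> O1 t"
    and E: "\<And>t. t \<in> {0<..<T} \<Longrightarrow> (E has_real_derivative E' t) (at t)"
    and le: "\<And>t. t \<in> {0<..<T} \<Longrightarrow> G t \<le> K * (- E' t) + C * O1 t"
    and lim: "(E \<longlongrightarrow> 0) (at_right 0)" "(E \<longlongrightarrow> 0) (at_left T)"
  shows "(\<integral>\<^sup>+ t\<in>{0<..<T}. ennreal (G t) \<partial>lebesgue) \<le> ennreal C * (\<integral>\<^sup>+ t\<in>{0<..<T}. ennreal (O1 t) \<partial>lebesgue)"
proof (rule ennreal_le_epsilon)
  fix e :: real assume e: "0 < e"
  let ?R = "\<integral>\<^sup>+ t\<in>{0<..<T}. ennreal (O1 t) \<partial>lebesgue"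
  \<comment> \<open>Each end point receives half of the error; \<open>K + 1\<close> keeps the
    quotient meaningful for \<open>K = 0\<close>.\<close>
  define e' where "e' = e / (K + 1) / 2"
  have e': "0 < e'" "K * (e' + e') \<le> e"
  proof -
    show "0 < e'" using e KC(1) by (simp add: e'_def)
    have "e' + e' = e / (K + 1)" unfolding e'_def by (rule field_sum_of_halves)
    then have "K * (e' + e') = K / (K + 1) * e" by simp
    also have "\<dots> \<le> 1 * e" using e KC(1) by (intro mult_right_mono) auto
    finally show "K * (e' + e') \<le> e" by simp
  qed
  have "\<forall>\<^sub>F t in at_right 0. \<bar>E t\<bar> < e'" "\<forall>\<^sub>F t in at_left T. \<bar>E t\<bar> < e'"
    using tendstoD[OF lim(1) e'(1)] tendstoD[OF lim(2) e'(1)] by (simp_all add: dist_real_def)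
  then obtain \<alpha> \<beta> where \<alpha>: "0 < \<alpha>" "\<And>t. 0 < t \<Longrightarrow> t < \<alpha> \<Longrightarrow> \<bar>E t\<bar> < e'"
    and \<beta>: "\<beta> < T" "\<And>t. \<beta> < t \<Longrightarrow> t < T \<Longrightarrow> \<bar>E t\<bar> < e'"
    unfolding eventually_at_right_field eventually_at_left_field by metis
  have bound: "(\<integral>\<^sup>+ t\<in>{a..b}. ennreal (G t) \<partial>lebesgue) \<le> ennreal C * ?R + ennreal e"
    if a: "0 < a" "a < \<alpha>" and b: "\<beta> < b" "b < T" and ab: "a \<le> b" for a b
  proof -
    have sub: "{a..b} \<subseteq> {0<..<T}" using a b by auto
    define IG where "IG = integral {a..b} G"
    define IO where "IO = integral {a..b} O1"
    have iG: "(G has_integral IG) {a..b}" and iO: "(O1 has_integral IO) {a..b}"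
      unfolding IG_def IO_def
      by (intro integrable_integral integrable_continuous_real continuous_on_subset[OF _ sub] c)+
    have iE: "(E' has_integral (E b - E a)) {a..b}"
    proof (rule fundamental_theorem_of_calculus[OF ab])
      fix t assume "t \<in> {a..b}"
      with sub have "(E has_real_derivative E' t) (at t within {a..b})"
        by (intro has_field_derivative_at_within[OF E]) auto
      then show "(E has_vector_derivative E' t) (at t within {a..b})"
        by (simp add: has_real_derivative_iff_has_vector_derivative)
    qed
    have "IG \<le> K * (- (E b - E a)) + C * IO"
      by (rule has_integral_le[OF iG has_integral_add[OF has_integral_mult_right[OF has_integral_neg[OF iE]]
              has_integral_mult_right[OF iO]]])
        (use le sub in auto)
    also have "K * (- (E b - E a)) \<le> K * (e' + e')"
      using \<alpha>(2)[OF a] \<beta>(2)[OF b] KC(1) by (intro mult_left_mono) auto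
    finally have "IG \<le> e + C * IO" using e'(2) by linarith
    then have "ennreal IG \<le> ennreal (C * IO + e)" by (simp add: ennreal_leI add.commute)
    also have "\<dots> = ennreal C * ennreal IO + ennreal e"
      using KC(2) e has_integral_nonneg[OF iO] nn(2) sub by (auto simp: ennreal_mult subset_iff)
    also have "ennreal IO = (\<integral>\<^sup>+ t\<in>{a..b}. ennreal (O1 t) \<partial>lebesgue)"
      by (rule nn_integral_Icc_has_integral[OF iO, symmetric]) (use nn sub in auto)
    also have "\<dots> \<le> ?R"
      by (rule nn_integral_mono) (use sub in \<open>auto simp: indicator_def\<close>)
    finally have "ennreal IG \<le> ennreal C * ?R + ennreal e" by (simp add: mult_left_mono add_right_mono)
    then show ?thesis
      using nn_integral_Icc_has_integral[OF iG] nn(1) sub by (simp add: subset_iff)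
  qed
  \<comment> \<open>The shift by 3 puts \<open>a n\<close> into the first third and
    \<open>b n\<close> into the last third of (0,T), so that \<open>a n \<le> b n\<close> holds from
    the start.\<close>
  define a where "a n = min \<alpha> T / (real n + 3)" for n :: nat
  define b where "b n = T - min (T - \<beta>) T / (real n + 3)" for n :: nat
  have mn: "0 < min \<alpha> T" "0 < min (T - \<beta>) T" using \<alpha>(1) \<beta>(1) T by auto
  have frac: "0 < y / (real n + 3)" "y / (real n + 3) < y" "y / (real n + 3) \<le> y / 3" if "0 < y" for y :: real and n
    using divide_strict_left_mono[of 1 "real n + 3" y] divide_left_mono[of 3 "real n + 3" y] that
    by simp_all
  have ab: "0 < a n" "a n < \<alpha>" "\<beta> < b n" "b n < T" "a n \<le> b n" for n
  proof -
    show "0 < a n" "a n < \<alpha>" using frac(1,2)[OF mn(1), of n] by (auto simp: a_def)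
    show "\<beta> < b n" "b n < T" using frac(1,2)[OF mn(2), of n] by (auto simp: b_def)
    show "a n \<le> b n" using frac(3)[OF mn(1), of n] frac(3)[OF mn(2), of n] T by (auto simp: a_def b_def)
  qed
  let ?f = "\<lambda>n t. ennreal (G t) * indicator {a n..b n} t"
  have anti: "y / (real n' + 3) \<le> y / (real n + 3)" if "0 < y" "n \<le> n'" for y :: real and n n'
    using that by (intro divide_left_mono) auto
  have inc: "incseq ?f"
  proof (rule incseq_SucI, rule le_funI)
    fix n t
    have "a (Suc n) \<le> a n" "b n \<le> b (Suc n)"
      using anti[OF mn(1), of n "Suc n"] anti[OF mn(2), of n "Suc n"] unfolding a_def b_def by auto
    then show "?f n t \<le> ?f (Suc n) t" by (auto simp: indicator_def)
  qed
  have meas: "?f n \<in> borel_measurable lebesgue" for n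
  proof -
    have "{a n..b n} \<subseteq> {0<..<T}" using ab[of n] by auto
    then have "?f n \<in> borel_measurable borel"
      by (intro borel_measurable_ennreal_continuous_on continuous_on_subset[OF c(1)]) auto
    then show ?thesis by (simp add: measurable_completion)
  qed
  have sup: "(SUP n. ?f n t) = ennreal (G t) * indicator {0<..<T} t" for t
  proof (cases "t \<in> {0<..<T}")
    case True
    have lim0: "(\<lambda>n. y / (real n + 3)) \<longlonglongrightarrow> 0" for y :: real
      by (subst add.commute, rule real_tendsto_divide_at_top[OF tendsto_const])
        (rule filterlim_tendsto_add_at_top[OF tendsto_const filterlim_real_sequentially])
    have "\<forall>\<^sub>F n in sequentially. a n < t" "\<forall>\<^sub>F n in sequentially. min (T - \<beta>) T / (real n + 3) < T - t"
      using True lim0[of "min \<alpha> T"] lim0[of "min (T - \<beta>) T"] unfolding a_def by (auto intro!: order_tendstoD(2))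
    then have "\<forall>\<^sub>F n in sequentially. a n < t \<and> t < b n"
      by eventually_elim (auto simp: b_def)
    then obtain n where "a n < t" "t < b n" by (auto simp: eventually_sequentially)
    then have "ennreal (G t) \<le> (SUP n. ?f n t)" by (intro SUP_upper2[of n]) auto
    moreover have "(SUP n. ?f n t) \<le> ennreal (G t)" by (rule SUP_least) (auto simp: indicator_def)
    ultimately show ?thesis using True by (simp add: antisym)
  next
    case False
    have "t \<notin> {a n..b n}" for n using ab[of n] False by auto
    then have "(\<lambda>n. ?f n t) = (\<lambda>n. 0)" by (simp add: indicator_def fun_eq_iff)
    then have "(SUP n. ?f n t) = (SUP n::nat. 0)" by (rule arg_cong)
    then show ?thesis using False by simp
  qed
  have "(\<integral>\<^sup>+ t\<in>{0<..<T}. ennreal (G t) \<partial>lebesgue) = (\<integral>\<^sup>+ t. (SUP n. ?f n t) \<partial>lebesgue)"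
    by (simp only: sup)
  also have "\<dots> = (SUP n. integral\<^sup>N lebesgue (?f n))"
    by (rule nn_integral_monotone_convergence_SUP[OF inc meas])
  also have "\<dots> \<le> ennreal C * ?R + ennreal e"
    by (rule SUP_least) (rule bound[OF ab])
  finally show "(\<integral>\<^sup>+ t\<in>{0<..<T}. ennreal (G t) \<partial>lebesgue) \<le> ennreal C * ?R + ennreal e" .
qed

lemma set_nn_integral_cong_ae:
  assumes "ae_eq_on {a<..<b} f f'" "ae_eq_on {a<..<b} g g'" "ae_eq_on {a<..<b} h h'"
    and "{c<..<d} \<subseteq> {a<..<b::real}"
  shows "(\<integral>\<^sup>+ x\<in>{c<..<d}. F x (f x) (g x) (h x) \<partial>lebesgue) =
    (\<integral>\<^sup>+ x\<in>{c<..<d}. F x (f' x) (g' x) (h' x) \<partial>lebesgue)"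
proof (rule nn_integral_cong_AE)
  have "AE x in lebesgue. x \<in> {a<..<b} \<longrightarrow> f x = f' x" "AE x in lebesgue. x \<in> {a<..<b} \<longrightarrow> g x = g' x"
    "AE x in lebesgue. x \<in> {a<..<b} \<longrightarrow> h x = h' x"
    using assms(1-3) by (simp_all add: ae_eq_on_def AE_restrict_space_iff)
  then show "AE x in lebesgue. F x (f x) (g x) (h x) * indicator {c<..<d} x = F x (f' x) (g' x) (h' x) * indicator {c<..<d} x"
    by eventually_elim (use assms(4) in \<open>auto simp: indicator_def\<close>)
qed

section \<open>Decay of the energy at both ends of the time interval\<close>

context carleman_weight
begin

definition "energy_density k u u1 x = (1/2) * (k * p1 x)^3 * (W0 k u x)\<^sup>2 - (3/2) * (k * p1 x) * (W1 k u u1 x)\<^sup>2"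

text \<open>Since \<open>\<psi> \<ge> m\<close>, the conjugating factor is at most
  \<open>exp (- (m * k))\<close>. The energy thus decays exponentially in \<open>k\<close>, up to
  powers of \<open>k\<close> and the C^1 size of \<open>u\<close>.\<close>

lemma energy_bound:
  assumes k: "1 \<le> k" and U: "dom3 L u u1 u2 u3"
    and B: "\<And>x. x \<in> I \<Longrightarrow> \<bar>u x\<bar> \<le> B" "\<And>x. x \<in> I \<Longrightarrow> \<bar>u1 x\<bar> \<le> B"
  shows "\<bar>integral I (energy_density k u u1)\<bar>
    \<le> 2 * L * (M^3 + 2 * M * (1 + M)\<^sup>2) * (k^3 * exp (- (2 * m * k)) * B\<^sup>2)"
proof -
  have k0: "0 \<le> k" using k by simp
  have B0: "0 \<le> B" using B(1)[of L] L by auto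
  have "\<bar>energy_density k u u1 x\<bar> \<le> (M^3 + 2 * M * (1 + M)\<^sup>2) * (k^3 * exp (- (2 * m * k)) * B\<^sup>2)" if x: "x \<in> I" for x
  proof -
    define e where "e = exp (- (m * k))"
    have e: "0 < e" by (simp add: e_def)
    have e2: "exp (- (2 * m * k)) = e\<^sup>2" unfolding e_def by (simp add: exp_double[symmetric])
    have ex: "exp (- (k * \<psi> x)) \<le> e"
      unfolding e_def using bounds[OF x] k0 by (simp add: mult.commute mult_left_mono)
    have P: "\<bar>p1 x\<bar> \<le> M" using bounds[OF x] by simp
    have kP: "\<bar>k * p1 x\<bar> \<le> k * M" unfolding abs_mult using P k0 by (simp add: mult_left_mono)
    have w0: "\<bar>W0 k u x\<bar> \<le> e * B"
      unfolding W0_def abs_mult using ex B(1)[OF x] e by (intro mult_mono) auto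
    have w1: "\<bar>W1 k u u1 x\<bar> \<le> e * (k * (1 + M) * B)"
      unfolding W1_def abs_mult
    proof (rule mult_mono)
      have "\<bar>u1 x - k * p1 x * u x\<bar> \<le> \<bar>u1 x\<bar> + \<bar>k * p1 x\<bar> * \<bar>u x\<bar>"
        by (simp add: abs_mult[symmetric])
      also have "\<dots> \<le> B + (k * M) * B"
        using B[OF x] kP k0 const by (intro add_mono mult_mono) auto
      also have "\<dots> \<le> k * B + (k * M) * B" using k B0 by (simp add: mult_right_mono[of 1 k B, simplified])
      also have "\<dots> = k * (1 + M) * B" by (simp add: algebra_simps)
      finally show "\<bar>u1 x - k * p1 x * u x\<bar> \<le> k * (1 + M) * B" .
    qed (use ex e in auto)
    have s0: "(W0 k u x)\<^sup>2 \<le> (e * B)\<^sup>2" using power_mono[OF w0 abs_ge_zero, of 2] by simp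
    have s1: "(W1 k u u1 x)\<^sup>2 \<le> (e * (k * (1 + M) * B))\<^sup>2" using power_mono[OF w1 abs_ge_zero, of 2] by simp
    have "\<bar>(k * p1 x)^3 * (W0 k u x)\<^sup>2\<bar> \<le> (k * M)^3 * (e * B)\<^sup>2"
      unfolding abs_mult power_abs using power_mono[OF kP abs_ge_zero, of 3] s0 k0 const
      by (intro mult_mono) (auto simp: power_abs)
    moreover have "\<bar>(k * p1 x) * (W1 k u u1 x)\<^sup>2\<bar> \<le> (k * M) * (e * (k * (1 + M) * B))\<^sup>2"
      unfolding abs_mult[of "k * p1 x"] using kP s1 k0 const by (intro mult_mono) auto
    moreover have "\<bar>energy_density k u u1 x\<bar> \<le> (1/2) * \<bar>(k * p1 x)^3 * (W0 k u x)\<^sup>2\<bar> + (3/2) * \<bar>(k * p1 x) * (W1 k u u1 x)\<^sup>2\<bar>"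
      unfolding energy_density_def by (simp add: abs_if)
    ultimately have "\<bar>energy_density k u u1 x\<bar> \<le> 1 * ((k * M)^3 * (e * B)\<^sup>2) + 2 * ((k * M) * (e * (k * (1 + M) * B))\<^sup>2)"
      by linarith
    also have "\<dots> = (M^3 + 2 * M * (1 + M)\<^sup>2) * (k^3 * e\<^sup>2 * B\<^sup>2)"
      by (simp add: power_mult_distrib) (simp add: algebra_simps eval_nat_numeral)
    finally show ?thesis by (simp add: e2)
  qed
  moreover have "continuous_on I (energy_density k u u1)"
    unfolding energy_density_def[abs_def] by (intro continuous_intros cont W_continuous[OF U])
  ultimately have "norm (integral I (energy_density k u u1)) \<le> (M^3 + 2 * M * (1 + M)\<^sup>2) * (k^3 * exp (- (2 * m * k)) * B\<^sup>2) * (L - - L)"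
    using L by (intro integral_bound) auto
  moreover have "y * z * (L - - L) = 2 * L * y * z" for y z :: real by simp
  ultimately show ?thesis by (simp only: real_norm_def)
qed

end

lemma power_mult_exp_tendsto_0:
  fixes b :: real
  assumes "0 < b"
  shows "((\<lambda>k. k ^ n * exp (- (b * k))) \<longlongrightarrow> 0) at_top"
proof -
  have "filterlim (\<lambda>k. b * k) at_top at_top"
    by (rule filterlim_tendsto_pos_mult_at_top[OF tendsto_const assms filterlim_ident])
  from filterlim_compose[OF tendsto_power_div_exp_0 this, of n]
  have "((\<lambda>k. (1 / b ^ n) * ((b * k) ^ n / exp (b * k))) \<longlongrightarrow> (1 / b ^ n) * 0) at_top"
    by (intro tendsto_mult tendsto_const)
  moreover have "(\<lambda>k. (1 / b ^ n) * ((b * k) ^ n / exp (b * k))) = (\<lambda>k. k ^ n * exp (- (b * k)))"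
    using assms by (auto simp: power_mult_distrib exp_minus divide_inverse)
  ultimately show ?thesis by simp
qed

lemma time_weight_at_top:
  fixes s T :: real
  assumes s: "0 < s" and T: "0 < T"
  shows "filterlim (\<lambda>t. s / (t * (T - t))) at_top (at_right 0)"
    "filterlim (\<lambda>t. s / (t * (T - t))) at_top (at_left T)"
proof -
  have *: "filterlim (\<lambda>t. s / (t * (T - t))) at_top F"
    if "((\<lambda>t. t * (T - t)) \<longlongrightarrow> 0) F" "\<forall>\<^sub>F t in F. 0 < t * (T - t)" for F :: "real filter"
  proof -
    have "filterlim (\<lambda>t. t * (T - t)) (at_right 0) F"
      using that by (auto simp: filterlim_at elim: eventually_mono)
    from filterlim_compose[OF filterlim_inverse_at_top_right this]
    have "filterlim (\<lambda>t. s * inverse (t * (T - t))) at_top F"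
      by (rule filterlim_tendsto_pos_mult_at_top[OF tendsto_const s])
    then show ?thesis by (simp add: divide_inverse)
  qed
  show "filterlim (\<lambda>t. s / (t * (T - t))) at_top (at_right 0)"
  proof (rule *)
    have "((\<lambda>t. t * (T - t)) \<longlongrightarrow> 0 * (T - 0)) (at_right 0)" by (intro tendsto_intros)
    then show "((\<lambda>t. t * (T - t)) \<longlongrightarrow> 0) (at_right 0)" by simp
    show "\<forall>\<^sub>F t in at_right 0. 0 < t * (T - t)"
      using T unfolding eventually_at_right_field by (auto intro!: exI[of _ T])
  qed
  show "filterlim (\<lambda>t. s / (t * (T - t))) at_top (at_left T)"
  proof (rule *)
    have "((\<lambda>t. t * (T - t)) \<longlongrightarrow> T * (T - T)) (at_left T)" by (intro tendsto_intros)
    then show "((\<lambda>t. t * (T - t)) \<longlongrightarrow> 0) (at_left T)" by simp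
    show "\<forall>\<^sub>F t in at_left T. 0 < t * (T - t)"
      using T unfolding eventually_at_left_field by (auto intro!: exI[of _ 0])
  qed
qed

context carleman_weight
begin

lemma W_time_derivatives:
  assumes k: "(k has_real_derivative d) (at t)"
    and u: "((\<lambda>r. u r x) has_real_derivative v x) (at t)"
    and u1: "((\<lambda>r. u1 r x) has_real_derivative v1 x) (at t)"
  shows "((\<lambda>r. W0 (k r) (u r) x) has_real_derivative Wt (k t) d (u t) v x) (at t)"
    "((\<lambda>r. W1 (k r) (u r) (u1 r) x) has_real_derivative Wt1 (k t) d (u t) (u1 t) v v1 x) (at t)"
  unfolding W0_def W1_def Wt_def Wt1_def
  by (auto intro!: derivative_eq_intros k u u1 simp: algebra_simps)

lemma energy_density_time_derivative:
  assumes k: "(k has_real_derivative d) (at t)"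
    and u: "((\<lambda>r. u r x) has_real_derivative v x) (at t)"
    and u1: "((\<lambda>r. u1 r x) has_real_derivative v1 x) (at t)"
  shows "((\<lambda>r. energy_density (k r) (u r) (u1 r) x) has_real_derivative
    energy_rate (k t) d (u t) (u1 t) v v1 x) (at t)"
proof -
  note W = W_time_derivatives[where u = u and v = v and ?u1.0 = u1 and ?v1.0 = v1, OF assms]
  show ?thesis
    unfolding energy_density_def energy_rate_def
    by (rule derivative_eq_intros refl W k)+
      (simp add: algebra_simps power2_eq_square power3_eq_cube)
qed

text \<open>The estimate for the classical representatives. Continuity in time is recorded with it
  because the measurability needed to separate interior and boundary integrals is derived from
  it.\<close>

definition carleman_estimate :: "real \<Rightarrow> real \<Rightarrow> real \<Rightarrow> (real \<Rightarrow> (real \<Rightarrow> real) \<Rightarrow> real \<Rightarrow> real) \<Rightarrow> (real \<Rightarrow> real) \<Rightarrow> bool"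
  where "carleman_estimate T C s S u0 \<longleftrightarrow>
    (\<exists>U :: nat \<Rightarrow> real \<Rightarrow> real \<Rightarrow> real.
        (\<forall>t>0. dom3 L (U 0 t) (U 1 t) (U 2 t) (U 3 t) \<and> ae_eq_on {-L<..<L} (S t u0) (U 0 t)) \<and>
        continuous_on {0<..<T} (\<lambda>t. integral I (wdensity (s / (t * (T - t))) (U 0 t) (U 1 t) (U 2 t))) \<and>
        continuous_on {0<..<T} (\<lambda>t. bdensity (s / (t * (T - t))) (U 1 t) (U 2 t)) \<and>
        (\<integral>\<^sup>+ t\<in>{0<..<T}. ennreal (integral I (wdensity (s / (t * (T - t))) (U 0 t) (U 1 t) (U 2 t))
           + bdensity (s / (t * (T - t))) (U 1 t) (U 2 t)) \<partial>lebesgue)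
        \<le> ennreal C * (\<integral>\<^sup>+ t\<in>{0<..<T}. ennreal (integral {l1..l2} (wdensity (s / (t * (T - t))) (U 0 t) (U 1 t) (U 2 t))) \<partial>lebesgue))"

lemma carleman_in_time:
  assumes T: "0 < T"
  shows "\<exists>s0 C. 0 < s0 \<and> 0 < C \<and> (\<forall>S s u0. is_S_L L S \<longrightarrow> s0 \<le> s \<longrightarrow> u0 \<in> L2_on {-L<..<L} \<longrightarrow>
      carleman_estimate T C s S u0)"
proof -
  obtain k0 K C where kKC: "1 \<le> k0" "0 < K" "0 < C"
    and static: "\<And>k d u u1 u2 u3 v v1 v2 v3. k0 \<le> k \<Longrightarrow> \<bar>d\<bar> \<le> T * k\<^sup>2 \<Longrightarrow> dom3 L u u1 u2 u3 \<Longrightarrow> dom3 L v v1 v2 v3 \<Longrightarrow>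
      (\<forall>x\<in>I. v x = u2 x - u3 x) \<Longrightarrow>
      integral I (wdensity k u u1 u2) + bdensity k u1 u2
      \<le> K * (- integral I (energy_rate k d u u1 v v1)) + C * integral {l1..l2} (wdensity k u u1 u2)"
    by (rule carleman_static_u[OF less_imp_le[OF T]], rule that; assumption)
  \<comment> \<open>As \<open>t (T - t) \<le> T^2\<close>, the bound \<open>k0 * T^2\<close> forces
    \<open>k \<ge> k0\<close> on all of (0,T); \<open>s \<ge> 1\<close> gives
    \<open>|k'| \<le> T k^2\<close>.\<close>
  define s0 where "s0 = max 1 (k0 * T\<^sup>2)"
  have s0: "0 < s0" by (simp add: s0_def)
  have main: "carleman_estimate T C s S u0"
    if S: "is_S_L L S" and ss0: "s0 \<le> s" and u0: "u0 \<in> L2_on {-L<..<L}" for S s u0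
  proof -
    interpret kdv_burgers L S by unfold_locales (use L S in auto)
    have s: "1 \<le> s" "k0 * T\<^sup>2 \<le> s" "0 < s" using ss0 by (auto simp: s0_def)
    define A where "A = {0<..<T}"
    define k where "k t = s / (t * (T - t))" for t
    define d where "d t = - s * (T - 2 * t) / (t * (T - t))\<^sup>2" for t
    have tT: "0 < t * (T - t)" "t * (T - t) \<le> T\<^sup>2" if "t \<in> A" for t
    proof -
      show "0 < t * (T - t)" using that by (simp add: A_def)
      have "t * (T - t) \<le> T * T" using that T by (intro mult_mono) (auto simp: A_def)
      then show "t * (T - t) \<le> T\<^sup>2" by (simp add: power2_eq_square)
    qed
    have k: "k0 \<le> k t" "1 \<le> k t" if t: "t \<in> A" for t
    proof -
      have "k0 * (t * (T - t)) \<le> k0 * T\<^sup>2" using tT[OF t] kKC(1) by (intro mult_left_mono) auto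
      then have "k0 * (t * (T - t)) \<le> s" using s by linarith
      then show "k0 \<le> k t" using tT(1)[OF t] by (simp add: k_def pos_le_divide_eq)
      then show "1 \<le> k t" using kKC by simp
    qed
    have d: "\<bar>d t\<bar> \<le> T * (k t)\<^sup>2" if t: "t \<in> A" for t
    proof -
      have "\<bar>d t\<bar> = s * \<bar>T - 2 * t\<bar> / (t * (T - t))\<^sup>2" using s by (simp add: d_def abs_mult)
      also have "\<dots> \<le> (s * s) * T / (t * (T - t))\<^sup>2"
      proof (rule divide_right_mono)
        have "s * \<bar>T - 2 * t\<bar> \<le> (s * s) * T"
          using s t by (intro mult_mono) (auto simp: A_def)
        then show "s * \<bar>T - 2 * t\<bar> \<le> (s * s) * T" .
      qed simp
      also have "\<dots> = T * (k t)\<^sup>2" by (simp add: k_def power_divide power2_eq_square)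
      finally show ?thesis .
    qed
    have dk: "(k has_real_derivative d t) (at t)" if t: "t \<in> A" for t
    proof -
      have "t * (T - t) \<noteq> 0" using t by (auto simp: A_def)
      then show ?thesis unfolding k_def[abs_def] d_def
        by (auto intro!: derivative_eq_intros simp: power2_eq_square algebra_simps)
    qed
    obtain U V :: "nat \<Rightarrow> real \<Rightarrow> real \<Rightarrow> real" where
      dU: "\<And>t. 0 < t \<Longrightarrow> dom3 L (U 0 t) (U 1 t) (U 2 t) (U 3 t)"
      and SU: "\<And>t. 0 < t \<Longrightarrow> S t u0 \<doteq> U 0 t"
      and dV: "\<And>t. 0 < t \<Longrightarrow> dom3 L (V 0 t) (V 1 t) (V 2 t) (V 3 t)"
      and VU: "\<And>t x. 0 < t \<Longrightarrow> x \<in> {-L..L} \<Longrightarrow> V 0 t x = U 2 t x - U 3 t x"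
      and tU: "\<And>t x j. 0 < t \<Longrightarrow> x \<in> {-L..L} \<Longrightarrow> j \<in> {0, 1, 2} \<Longrightarrow>
        ((\<lambda>r. U j r x) has_real_derivative V j t x) (at t)"
      and tV: "\<And>t x. 0 < t \<Longrightarrow> x \<in> {-L..L} \<Longrightarrow>
        ((\<lambda>r. V 0 r x) has_real_derivative V 2 t x - V 3 t x) (at t)"
      and cU: "\<And>j. j \<in> {0, 1, 2, 3} \<Longrightarrow> continuous_on ({0<..} \<times> {-L..L}) (\<lambda>(t, x). U j t x)"
      and cV: "\<And>j. j \<in> {0, 1, 2, 3} \<Longrightarrow> continuous_on ({0<..} \<times> {-L..L}) (\<lambda>(t, x). V j t x)"
      by (rule classical_solution[OF u0 Adom_S_pos[OF u0]], assumption, rule that; assumption)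
    have A0: "0 < t" if "t \<in> A" for t using that by (simp add: A_def)
    have AI: "A \<times> I \<subseteq> {0<..} \<times> {-L..L}" by (auto simp: A_def)
    have cUV: "continuous_on (A \<times> I) (\<lambda>q. U j (fst q) (snd q))" "continuous_on (A \<times> I) (\<lambda>q. V j (fst q) (snd q))"
      if "j \<in> {0, 1, 2, 3}" for j
      using continuous_on_subset[OF cU[OF that] AI] continuous_on_subset[OF cV[OF that] AI]
      by (simp_all add: split_def)
    have ck: "continuous_on A k" "continuous_on A d"
    proof -
      have "t \<noteq> 0 \<and> T \<noteq> t" if "t \<in> A" for t using that by (auto simp: A_def)
      then show "continuous_on A k" "continuous_on A d"
        unfolding k_def[abs_def] d_def[abs_def] by (intro continuous_intros; auto)+
    qed
    have ckp: "continuous_on (A \<times> I) (\<lambda>q. k (fst q))" "continuous_on (A \<times> I) (\<lambda>q. d (fst q))"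
      by (rule continuous_on_compose2[OF ck(1) continuous_on_fst[OF continuous_on_id]]
          continuous_on_compose2[OF ck(2) continuous_on_fst[OF continuous_on_id]]; auto)+
    have cpp: "continuous_on (A \<times> I) (\<lambda>q. \<psi> (snd q))" "continuous_on (A \<times> I) (\<lambda>q. p1 (snd q))"
      by (rule continuous_on_compose2[OF cont(1) continuous_on_snd[OF continuous_on_id]]
          continuous_on_compose2[OF cont(2) continuous_on_snd[OF continuous_on_id]]; auto)+
    define W where "W t = wdensity (k t) (U 0 t) (U 1 t) (U 2 t)" for t
    have cW: "continuous_on (A \<times> I) (\<lambda>(t, x). W t x)"
      unfolding W_def wdensity_def split_def
      by (intro continuous_intros ckp cpp cUV) auto
    define G1 where "G1 t = integral I (W t)" for t
    define G2 where "G2 t = bdensity (k t) (U 1 t) (U 2 t)" for t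
    define O1 where "O1 t = integral {l1..l2} (W t)" for t
    have sub: "{l1..l2} \<subseteq> I" using l by auto
    have cG1: "continuous_on A G1"
      unfolding G1_def[abs_def] using integral_continuous_on_param[of A "-L" L W] cW by simp
    have "A \<times> {l1..l2} \<subseteq> A \<times> I" using sub by blast
    from integral_continuous_on_param[of A l1 l2 W] continuous_on_subset[OF cW this]
    have cO1: "continuous_on A O1" unfolding O1_def[abs_def] by simp
    have cend: "continuous_on A (\<lambda>t. U j t (-L))" if j: "j \<in> {0, 1, 2, 3}" for j
    proof -
      have c: "continuous_on A (\<lambda>t. (t, -L))" "(\<lambda>t. (t, -L)) ` A \<subseteq> A \<times> I"
        using L by (auto intro!: continuous_intros)
      from continuous_on_compose2[OF cUV(1)[OF j] c] show ?thesis by (simp only: fst_conv snd_conv)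
    qed
    have cG2: "continuous_on A G2"
      unfolding G2_def[abs_def] bdensity_def by (intro continuous_intros ck cend) auto
    define E where "E t = integral I (energy_density (k t) (U 0 t) (U 1 t))" for t
    define E' where "E' t = integral I (energy_rate (k t) (d t) (U 0 t) (U 1 t) (V 0 t) (V 1 t))" for t
    have dE: "(E has_real_derivative E' t) (at t)" if t: "t \<in> A" for t
      unfolding E_def[abs_def] E'_def
    proof (rule leibniz_rule_Icc[where A = A and f' = "\<lambda>t. energy_rate (k t) (d t) (U 0 t) (U 1 t) (V 0 t) (V 1 t)", OF t])
      show "open A" "convex A" by (auto simp: A_def)
      show "((\<lambda>r. energy_density (k r) (U 0 r) (U 1 r) x) has_real_derivative
          energy_rate (k r) (d r) (U 0 r) (U 1 r) (V 0 r) (V 1 r) x) (at r)" if "r \<in> A" "x \<in> I" for r x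
        by (rule energy_density_time_derivative[where u = "U 0" and ?u1.0 = "U 1" and v = "V 0 r" and ?v1.0 = "V 1 r",
              OF dk[OF that(1)] tU[OF A0[OF that(1)] that(2)] tU[OF A0[OF that(1)] that(2)]]) auto
      show "continuous_on I (energy_density (k r) (U 0 r) (U 1 r))" if "r \<in> A" for r
        unfolding energy_density_def[abs_def] by (intro continuous_intros cont W_continuous[OF dU[OF A0[OF that]]])
      show "continuous_on (A \<times> I) (\<lambda>(t, x). energy_rate (k t) (d t) (U 0 t) (U 1 t) (V 0 t) (V 1 t) x)"
        unfolding energy_rate_def W0_def W1_def Wt_def Wt1_def split_def
        by (intro continuous_intros ckp cpp cUV) auto
    qed
    have G: "G1 t + G2 t \<le> K * (- E' t) + C * O1 t" if t: "t \<in> A" for t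
      unfolding G1_def G2_def E'_def O1_def W_def
      by (rule static[OF k(1)[OF t] d[OF t] dU[OF A0[OF t]] dV[OF A0[OF t]]]) (use VU A0[OF t] in auto)
    have W0: "0 \<le> W t x" if "t \<in> A" "x \<in> I" for t x
      unfolding W_def using k(2)[OF that(1)] that(2) by (intro wdensity_nonneg) auto
    have cWt: "continuous_on I (W t)" if "t \<in> A" for t
      unfolding W_def by (rule wdensity_continuous[OF dU[OF A0[OF that]]])
    have G0: "0 \<le> G1 t + G2 t" if t: "t \<in> A" for t
    proof -
      have "0 \<le> G1 t" unfolding G1_def
        by (rule integral_nonneg[OF integrable_continuous_real[OF cWt[OF t]] W0[OF t]])
      moreover have "0 \<le> G2 t" unfolding G2_def using k(2)[OF t] by (intro bdensity_nonneg) auto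
      ultimately show ?thesis by simp
    qed
    have O0: "0 \<le> O1 t" if t: "t \<in> A" for t
      unfolding O1_def
      by (rule integral_nonneg[OF integrable_continuous_real[OF continuous_on_subset[OF cWt[OF t] sub]]])
        (use W0[OF t] sub in auto)
    \<comment> \<open>Smoothing bounds the L2 norm of \<open>A S(t) u0\<close> by a multiple of
      \<open>t^(-2)\<close>, and that norm controls \<open>u\<close> and \<open>u_x\<close>
      uniformly.\<close>
    obtain D where D: "\<And>t x. 0 < t \<Longrightarrow> x \<in> I \<Longrightarrow> \<bar>U 0 t x\<bar> \<le> D / t\<^sup>2 \<and> \<bar>U 1 t x\<bar> \<le> D / t\<^sup>2"
    proof -
      obtain B where B: "0 < B" "\<And>F F1 F2 F3 x. dom3 L F F1 F2 F3 \<Longrightarrow> x \<in> {-L..L} \<Longrightarrow>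
        \<bar>F x\<bar> \<le> B * N (\<lambda>x. F2 x - F3 x) \<and> \<bar>F1 x\<bar> \<le> B * N (\<lambda>x. F2 x - F3 x) \<and>
        \<bar>F2 x\<bar> \<le> B * N (\<lambda>x. F2 x - F3 x)"
        by (rule dom3_sup_bound[OF L], rule that; assumption)
      obtain C0 where C0: "0 < C0" "\<And>u0 t g. u0 \<in> L2_on \<Omega> \<Longrightarrow> (\<forall>t>0. Adom L 5 (S t u0)) \<Longrightarrow> 0 < t \<Longrightarrow>
        (S t u0, g) \<in> A_graph L \<Longrightarrow> t\<^sup>2 * N g \<le> C0 * N u0"
        using smoothing_bound by metis
      show ?thesis
      proof (rule that)
        fix t x assume t: "0 < (t::real)" and x: "x \<in> I"
        let ?g = "\<lambda>x. U 2 t x - U 3 t x"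
        have "(S t u0, ?g) \<in> A_graph L"
          by (rule dom3_in_A_graph[OF L dU[OF t] S_L2[OF less_imp_le[OF t] u0] SU[OF t]
                continuous_L2_on[OF dom3_continuous_op[OF dU[OF t]]] ae_eq_on_refl])
        then have "t\<^sup>2 * N ?g \<le> C0 * N u0"
          by (intro C0(2) u0 t) (auto intro: Adom_S_pos u0)
        then have "B * N ?g \<le> B * (C0 * N u0 / t\<^sup>2)"
          using B(1) t by (intro mult_left_mono) (auto simp: field_simps)
        then show "\<bar>U 0 t x\<bar> \<le> (B * (C0 * N u0)) / t\<^sup>2 \<and> \<bar>U 1 t x\<bar> \<le> (B * (C0 * N u0)) / t\<^sup>2"
          using B(2)[OF dU[OF t] x] by auto
      qed
    qed
    \<comment> \<open>From \<open>1 / t \<le> (T / s) * k\<close> the factor \<open>t^(-4)\<close>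
      of the squared bound becomes \<open>(T / s)^4 * k^4\<close>; with the \<open>k^3\<close> of
      \<open>energy_bound\<close> this gives the power 7.\<close>
    define c0 where "c0 = 2 * L * (M^3 + 2 * M * (1 + M)\<^sup>2) * D\<^sup>2 * (T / s)^4"
    have Ebound: "\<bar>E t\<bar> \<le> c0 * ((k t)^7 * exp (- ((2 * m) * k t)))" if t: "t \<in> A" for t
    proof -
      have t0: "0 < t" "t < T" using t by (auto simp: A_def)
      have "\<bar>E t\<bar> \<le> 2 * L * (M^3 + 2 * M * (1 + M)\<^sup>2) * ((k t)^3 * exp (- (2 * m * k t)) * (D / t\<^sup>2)\<^sup>2)"
        unfolding E_def by (rule energy_bound[OF k(2)[OF t] dU[OF t0(1)]]) (use D[OF t0(1)] in auto)
      also have "\<dots> \<le> 2 * L * (M^3 + 2 * M * (1 + M)\<^sup>2) * ((k t)^3 * exp (- (2 * m * k t)) * (D\<^sup>2 * (T / s * k t)^4))"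
      proof (intro mult_left_mono)
        have "1 / t \<le> T / s * k t"
          using t0 s by (simp add: k_def field_simps)
        then have "(1 / t)^4 \<le> (T / s * k t)^4" using t0 by (intro power_mono) auto
        then have "D\<^sup>2 * (1 / t)^4 \<le> D\<^sup>2 * (T / s * k t)^4" by (intro mult_left_mono) auto
        then show "(D / t\<^sup>2)\<^sup>2 \<le> D\<^sup>2 * (T / s * k t)^4"
          by (simp add: power_divide flip: power_mult)
      qed (use k(2)[OF t] const L in auto)
      also have "\<dots> = c0 * ((k t)^7 * exp (- ((2 * m) * k t)))"
        unfolding power_mult_distrib[of "T / s" "k t" 4] c0_def by (simp add: eval_nat_numeral mult_ac)
      finally show ?thesis .
    qed
    have Elim: "(E \<longlongrightarrow> 0) F" if F: "filterlim k at_top F" "\<forall>\<^sub>F t in F. t \<in> A" for F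
    proof (rule Lim_null_comparison)
      show "\<forall>\<^sub>F t in F. norm (E t) \<le> c0 * ((k t)^7 * exp (- ((2 * m) * k t)))"
        using F(2) by eventually_elim (use Ebound in auto)
      have "((\<lambda>t. c0 * ((k t)^7 * exp (- ((2 * m) * k t)))) \<longlongrightarrow> c0 * 0) F"
        by (intro tendsto_mult tendsto_const filterlim_compose[OF power_mult_exp_tendsto_0 F(1)])
          (use const in auto)
      then show "((\<lambda>t. c0 * ((k t)^7 * exp (- ((2 * m) * k t)))) \<longlongrightarrow> 0) F" by simp
    qed
    have lim0: "(E \<longlongrightarrow> 0) (at_right 0)"
      by (rule Elim) (use time_weight_at_top(1)[OF s(3) T] T in
          \<open>auto simp: k_def[abs_def] A_def eventually_at_right_field intro!: exI[of _ T]\<close>)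
    have limT: "(E \<longlongrightarrow> 0) (at_left T)"
      by (rule Elim) (use time_weight_at_top(2)[OF s(3) T] T in
          \<open>auto simp: k_def[abs_def] A_def eventually_at_left_field intro!: exI[of _ 0]\<close>)
    have "(\<integral>\<^sup>+ t\<in>{0<..<T}. ennreal (G1 t + G2 t) \<partial>lebesgue) \<le> ennreal C * (\<integral>\<^sup>+ t\<in>{0<..<T}. ennreal (O1 t) \<partial>lebesgue)"
      by (rule nn_integral_Ioo_energy_estimate[OF T less_imp_le[OF kKC(2)] less_imp_le[OF kKC(3)] _ _ _ _ _ _ lim0 limT])
        (use cG1 cG2 cO1 G0 O0 dE G in \<open>auto simp: A_def intro: continuous_on_add\<close>)
    then show ?thesis
      using dU SU cG1 cG2 unfolding carleman_estimate_def G1_def[abs_def] G2_def[abs_def] O1_def W_def k_def A_def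
      by (intro exI[of _ U]) auto
  qed
  show ?thesis
    using main s0 kKC(3) by blast
qed

end

section \<open>Translation into weak derivatives and traces\<close>

lemma set_nn_integral_cong:
  "(\<And>t. t \<in> A \<Longrightarrow> f t = g t) \<Longrightarrow> (\<integral>\<^sup>+ t\<in>A. f t \<partial>M) = (\<integral>\<^sup>+ t\<in>A. g t \<partial>M)"
  by (rule nn_integral_cong) (simp add: indicator_def)

lemma weight_rescale:
  fixes s t T y a b c :: real
  shows "(s ^ 5 * y ^ 5 / (t ^ 5 * (T - t) ^ 5) * \<bar>a\<bar> ^ 2
      + s ^ 3 * y ^ 3 / (t ^ 3 * (T - t) ^ 3) * \<bar>b\<bar> ^ 2
      + s * y / (t * (T - t)) * \<bar>c\<bar> ^ 2) * exp (- (2 * s * y) / (t * (T - t)))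
    = ((s / (t * (T - t))) ^ 5 * y ^ 5 * a\<^sup>2 + (s / (t * (T - t))) ^ 3 * y ^ 3 * b\<^sup>2
      + (s / (t * (T - t))) * y * c\<^sup>2) * exp (- (2 * (s / (t * (T - t))) * y))"
  by (simp add: power_divide power_mult_distrib)

theorem lemma2p4:
  fixes L T l\<^sub>1 l\<^sub>2 :: real and \<psi> :: "real \<Rightarrow> real"
  assumes "L > 0" and "T > 0" and "-L < l\<^sub>1" and "l\<^sub>1 < l\<^sub>2" and "l\<^sub>2 < L"
    and "weight_function L l\<^sub>1 l\<^sub>2 \<psi>"
  shows "\<exists>s\<^sub>0>0. \<exists>C>0. \<forall>S. is_S_L L S \<longrightarrow>
    (\<forall>s\<ge>s\<^sub>0. \<forall>u\<^sub>0\<in>L2_on {-L<..<L}.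
      (let u = (\<lambda>x t. S t u\<^sub>0 x);
           u_x = (\<lambda>x t. weak_deriv_on {-L<..<L} 1 (S t u\<^sub>0) x);
           u_xx = (\<lambda>x t. weak_deriv_on {-L<..<L} 2 (S t u\<^sub>0) x);
           u_x_left = (\<lambda>t. trace_on {-L<..<L} (weak_deriv_on {-L<..<L} 1 (S t u\<^sub>0)) (-L));
           u_xx_left = (\<lambda>t. trace_on {-L<..<L} (weak_deriv_on {-L<..<L} 2 (S t u\<^sub>0)) (-L))
       in
         (\<integral>\<^sup>+ t\<in>{0<..<T}. (\<integral>\<^sup>+ x\<in>{-L<..<L}. ennreal
            ((s ^ 5 * \<psi> x ^ 5 / (t ^ 5 * (T - t) ^ 5) * \<bar>u x t\<bar> ^ 2
              + s ^ 3 * \<psi> x ^ 3 / (t ^ 3 * (T - t) ^ 3) * \<bar>u_x x t\<bar> ^ 2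
              + s * \<psi> x / (t * (T - t)) * \<bar>u_xx x t\<bar> ^ 2)
             * exp (- (2 * s * \<psi> x) / (t * (T - t)))) \<partial>lebesgue) \<partial>lebesgue)
         + (\<integral>\<^sup>+ t\<in>{0<..<T}. ennreal
            ((s ^ 3 * \<psi> L ^ 3 / (t ^ 3 * (T - t) ^ 3) * \<bar>u_x_left t\<bar> ^ 2
              + s * \<psi> L / (t * (T - t)) * \<bar>u_xx_left t\<bar> ^ 2)
             * exp (- (2 * s * \<psi> L) / (t * (T - t)))) \<partial>lebesgue)
         \<le> ennreal C *
         (\<integral>\<^sup>+ t\<in>{0<..<T}. (\<integral>\<^sup>+ x\<in>{l\<^sub>1<..<l\<^sub>2}. ennreal
            ((s ^ 5 * \<psi> x ^ 5 / (t ^ 5 * (T - t) ^ 5) * \<bar>u x t\<bar> ^ 2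
              + s ^ 3 * \<psi> x ^ 3 / (t ^ 3 * (T - t) ^ 3) * \<bar>u_x x t\<bar> ^ 2
              + s * \<psi> x / (t * (T - t)) * \<bar>u_xx x t\<bar> ^ 2)
             * exp (- (2 * s * \<psi> x) / (t * (T - t)))) \<partial>lebesgue) \<partial>lebesgue)))"
proof -
  obtain m M c p1 p2 p3 where "carleman_weight L l\<^sub>1 l\<^sub>2 m M c \<psi> p1 p2 p3"
    using weight_function_carleman_weight[OF assms(1,3,4,5,6)] by blast
  then interpret carleman_weight L l\<^sub>1 l\<^sub>2 m M c \<psi> p1 p2 p3 .
  let ?\<Omega> = "{-L<..<L}"
  have LL: "-L < L" using L by simp
  obtain s0 C where sC: "0 < s0" "0 < C"
    and main: "\<And>S s u0. is_S_L L S \<Longrightarrow> s0 \<le> s \<Longrightarrow> u0 \<in> L2_on ?\<Omega> \<Longrightarrow> carleman_estimate T C s S u0"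
    using carleman_in_time[OF assms(2)] by blast
  \<comment> \<open>The inequality of the statement with its local abbreviations expanded, kept
    opaque while the quantifiers are treated.\<close>
  define claim where "claim C S s u0 \<longleftrightarrow>
      (\<integral>\<^sup>+ t\<in>{0<..<T}. (\<integral>\<^sup>+ x\<in>?\<Omega>. ennreal
              ((s ^ 5 * \<psi> x ^ 5 / (t ^ 5 * (T - t) ^ 5) * \<bar>S t u0 x\<bar> ^ 2
                + s ^ 3 * \<psi> x ^ 3 / (t ^ 3 * (T - t) ^ 3) * \<bar>weak_deriv_on ?\<Omega> 1 (S t u0) x\<bar> ^ 2
                + s * \<psi> x / (t * (T - t)) * \<bar>weak_deriv_on ?\<Omega> 2 (S t u0) x\<bar> ^ 2)
               * exp (- (2 * s * \<psi> x) / (t * (T - t)))) \<partial>lebesgue) \<partial>lebesgue)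
           + (\<integral>\<^sup>+ t\<in>{0<..<T}. ennreal
              ((s ^ 3 * \<psi> L ^ 3 / (t ^ 3 * (T - t) ^ 3) * \<bar>trace_on ?\<Omega> (weak_deriv_on ?\<Omega> 1 (S t u0)) (-L)\<bar> ^ 2
                + s * \<psi> L / (t * (T - t)) * \<bar>trace_on ?\<Omega> (weak_deriv_on ?\<Omega> 2 (S t u0)) (-L)\<bar> ^ 2)
               * exp (- (2 * s * \<psi> L) / (t * (T - t)))) \<partial>lebesgue)
           \<le> ennreal C *
           (\<integral>\<^sup>+ t\<in>{0<..<T}. (\<integral>\<^sup>+ x\<in>{l\<^sub>1<..<l\<^sub>2}. ennreal
              ((s ^ 5 * \<psi> x ^ 5 / (t ^ 5 * (T - t) ^ 5) * \<bar>S t u0 x\<bar> ^ 2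
                + s ^ 3 * \<psi> x ^ 3 / (t ^ 3 * (T - t) ^ 3) * \<bar>weak_deriv_on ?\<Omega> 1 (S t u0) x\<bar> ^ 2
                + s * \<psi> x / (t * (T - t)) * \<bar>weak_deriv_on ?\<Omega> 2 (S t u0) x\<bar> ^ 2)
               * exp (- (2 * s * \<psi> x) / (t * (T - t)))) \<partial>lebesgue) \<partial>lebesgue)"
    for C :: real and S :: "real \<Rightarrow> (real \<Rightarrow> real) \<Rightarrow> real \<Rightarrow> real" and s :: real and u0 :: "real \<Rightarrow> real"
  have "\<exists>s0>0. \<exists>C>0. \<forall>S. is_S_L L S \<longrightarrow> (\<forall>s\<ge>s0. \<forall>u0\<in>L2_on ?\<Omega>. claim C S s u0)"
  proof (rule exI[of _ s0], intro conjI sC(1), rule exI[of _ C], intro conjI sC(2) allI impI ballI)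
    fix S s u0 assume S: "is_S_L L S" and s: "s0 \<le> s" and u0: "u0 \<in> L2_on ?\<Omega>"
    interpret kdv_burgers L S by unfold_locales (use L S in auto)
    obtain U :: "nat \<Rightarrow> real \<Rightarrow> real \<Rightarrow> real" where
      U: "\<And>t. 0 < t \<Longrightarrow> dom3 L (U 0 t) (U 1 t) (U 2 t) (U 3 t)" "\<And>t. 0 < t \<Longrightarrow> ae_eq_on ?\<Omega> (S t u0) (U 0 t)"
      and cG: "continuous_on {0<..<T} (\<lambda>t. integral I (wdensity (s / (t * (T - t))) (U 0 t) (U 1 t) (U 2 t)))"
        "continuous_on {0<..<T} (\<lambda>t. bdensity (s / (t * (T - t))) (U 1 t) (U 2 t))"
      and le: "(\<integral>\<^sup>+ t\<in>{0<..<T}. ennreal (integral I (wdensity (s / (t * (T - t))) (U 0 t) (U 1 t) (U 2 t))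
           + bdensity (s / (t * (T - t))) (U 1 t) (U 2 t)) \<partial>lebesgue)
        \<le> ennreal C * (\<integral>\<^sup>+ t\<in>{0<..<T}. ennreal (integral {l\<^sub>1..l\<^sub>2} (wdensity (s / (t * (T - t))) (U 0 t) (U 1 t) (U 2 t))) \<partial>lebesgue)"
      using main[OF S s u0] unfolding carleman_estimate_def by (elim exE conjE) (rule that; (assumption | blast))
    define k where "k t = s / (t * (T - t))" for t
    have k0: "0 \<le> k t" if "t \<in> {0<..<T}" for t using that s sC(1) by (simp add: k_def)
    define P where "P a b t = (\<integral>\<^sup>+ x\<in>{a<..<b}. ennreal
          ((s ^ 5 * \<psi> x ^ 5 / (t ^ 5 * (T - t) ^ 5) * \<bar>S t u0 x\<bar> ^ 2
            + s ^ 3 * \<psi> x ^ 3 / (t ^ 3 * (T - t) ^ 3) * \<bar>weak_deriv_on ?\<Omega> 1 (S t u0) x\<bar> ^ 2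
            + s * \<psi> x / (t * (T - t)) * \<bar>weak_deriv_on ?\<Omega> 2 (S t u0) x\<bar> ^ 2)
           * exp (- (2 * s * \<psi> x) / (t * (T - t)))) \<partial>lebesgue)" for a b t
    define Q where "Q t = ((s ^ 3 * \<psi> L ^ 3 / (t ^ 3 * (T - t) ^ 3) * \<bar>trace_on ?\<Omega> (weak_deriv_on ?\<Omega> 1 (S t u0)) (-L)\<bar> ^ 2
          + s * \<psi> L / (t * (T - t)) * \<bar>trace_on ?\<Omega> (weak_deriv_on ?\<Omega> 2 (S t u0)) (-L)\<bar> ^ 2)
         * exp (- (2 * s * \<psi> L) / (t * (T - t))))" for t
    \<comment> \<open>The weak derivatives agree almost everywhere with the classical ones, which
      the inner integral cannot distinguish; the density is continuous, so its integral over the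
      open interval is a Riemann integral over the closed one.\<close>
    have inner: "P a b t = ennreal (integral {a..b} (wdensity (k t) (U 0 t) (U 1 t) (U 2 t)))"
      if t: "t \<in> {0<..<T}" and ab: "-L \<le> a" "b \<le> L" for t a b
    proof -
      have t0: "0 < t" using t by simp
      have sub: "{a<..<b} \<subseteq> ?\<Omega>" "{a..b} \<subseteq> I" using ab by auto
      note ae = U(2)[OF t0] dom3_weak_derivs_ae(1,2)[OF L U(1)[OF t0] S_L2[OF less_imp_le[OF t0] u0] U(2)[OF t0]]
      have "(\<integral>\<^sup>+ x\<in>{a<..<b}. ennreal (wdensity (k t) (U 0 t) (U 1 t) (U 2 t) x) \<partial>lebesgue)
          = ennreal (integral {a..b} (wdensity (k t) (U 0 t) (U 1 t) (U 2 t)))"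
        by (rule nn_integral_Ioo_continuous[OF continuous_on_subset[OF wdensity_continuous[OF U(1)[OF t0]] sub(2)]])
          (use sub wdensity_nonneg[OF k0[OF t]] in auto)
      then show ?thesis
        unfolding P_def weight_rescale wdensity_def k_def[symmetric]
        using set_nn_integral_cong_ae[OF ae sub(1), of "\<lambda>x y z w. ennreal
          (((k t) ^ 5 * \<psi> x ^ 5 * y\<^sup>2 + (k t) ^ 3 * \<psi> x ^ 3 * z\<^sup>2 + k t * \<psi> x * w\<^sup>2) * exp (- (2 * k t * \<psi> x)))"]
        by simp
    qed
    have bdry: "Q t = bdensity (k t) (U 1 t) (U 2 t)"
      if t: "t \<in> {0<..<T}" for t
    proof -
      have t0: "0 < t" using t by simp
      note ae = dom3_weak_derivs_ae(1,2)[OF L U(1)[OF t0] S_L2[OF less_imp_le[OF t0] u0] U(2)[OF t0]]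
      have "trace_on ?\<Omega> (weak_deriv_on ?\<Omega> 1 (S t u0)) (-L) = U 1 t (-L)"
        "trace_on ?\<Omega> (weak_deriv_on ?\<Omega> 2 (S t u0)) (-L) = U 2 t (-L)"
        by (rule trace_on_continuous[OF LL dom3D(5)[OF U(1)[OF t0]] ae(1)]
            trace_on_continuous[OF LL dom3D(6)[OF U(1)[OF t0]] ae(2)]; use L in simp)+
      then show ?thesis
        using weight_rescale[of s "\<psi> L" t T 0 "U 1 t (-L)" "U 2 t (-L)"]
        by (simp add: Q_def bdensity_def k_def)
    qed
    define G1 G2 O1 where "G1 t = integral I (wdensity (k t) (U 0 t) (U 1 t) (U 2 t))"
      and "G2 t = bdensity (k t) (U 1 t) (U 2 t)"
      and "O1 t = integral {l\<^sub>1..l\<^sub>2} (wdensity (k t) (U 0 t) (U 1 t) (U 2 t))" for t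
    \<comment> \<open>Adding the interior and boundary integrals under one integral sign requires
      measurability in time.\<close>
    have meas: "(\<lambda>t. ennreal (f t) * indicator {0<..<T} t) \<in> borel_measurable lebesgue"
      if "continuous_on {0<..<T} f" for f :: "real \<Rightarrow> real"
      by (intro measurable_completion) (simp add: borel_measurable_ennreal_continuous_on[OF _ that])
    have nn: "0 \<le> G1 t" "0 \<le> G2 t" if t: "t \<in> {0<..<T}" for t
    proof -
      have t0: "0 < t" using t by simp
      show "0 \<le> G1 t" unfolding G1_def
        by (rule integral_nonneg[OF integrable_continuous_real[OF wdensity_continuous[OF U(1)[OF t0]]] wdensity_nonneg[OF k0[OF t]]])
      show "0 \<le> G2 t" unfolding G2_def by (rule bdensity_nonneg[OF k0[OF t]])
    qed
    have "(\<integral>\<^sup>+ t\<in>{0<..<T}. ennreal (G1 t) \<partial>lebesgue) + (\<integral>\<^sup>+ t\<in>{0<..<T}. ennreal (G2 t) \<partial>lebesgue)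
        = (\<integral>\<^sup>+ t. ennreal (G1 t) * indicator {0<..<T} t + ennreal (G2 t) * indicator {0<..<T} t \<partial>lebesgue)"
      using cG unfolding G1_def[abs_def] G2_def[abs_def] k_def by (intro nn_integral_add[symmetric] meas)
    also have "\<dots> = (\<integral>\<^sup>+ t\<in>{0<..<T}. ennreal (G1 t + G2 t) \<partial>lebesgue)"
      by (rule nn_integral_cong) (auto simp: indicator_def nn)
    also have "\<dots> \<le> ennreal C * (\<integral>\<^sup>+ t\<in>{0<..<T}. ennreal (O1 t) \<partial>lebesgue)"
      using le unfolding G1_def G2_def O1_def k_def .
    finally have fin: "(\<integral>\<^sup>+ t\<in>{0<..<T}. ennreal (G1 t) \<partial>lebesgue) + (\<integral>\<^sup>+ t\<in>{0<..<T}. ennreal (G2 t) \<partial>lebesgue)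
      \<le> ennreal C * (\<integral>\<^sup>+ t\<in>{0<..<T}. ennreal (O1 t) \<partial>lebesgue)" .
    show "claim C S s u0"
    proof -
      have e1: "(\<integral>\<^sup>+ t\<in>{0<..<T}. P (-L) L t \<partial>lebesgue) = (\<integral>\<^sup>+ t\<in>{0<..<T}. ennreal (G1 t) \<partial>lebesgue)"
        by (rule set_nn_integral_cong) (simp add: inner G1_def)
      have e2: "(\<integral>\<^sup>+ t\<in>{0<..<T}. P l\<^sub>1 l\<^sub>2 t \<partial>lebesgue) = (\<integral>\<^sup>+ t\<in>{0<..<T}. ennreal (O1 t) \<partial>lebesgue)"
        by (rule set_nn_integral_cong) (use l in \<open>simp add: inner O1_def\<close>)
      have e3: "(\<integral>\<^sup>+ t\<in>{0<..<T}. ennreal (Q t) \<partial>lebesgue) = (\<integral>\<^sup>+ t\<in>{0<..<T}. ennreal (G2 t) \<partial>lebesgue)"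
        by (rule set_nn_integral_cong) (simp add: bdry G2_def)
      show ?thesis
        unfolding claim_def using fin unfolding e1[symmetric] e2[symmetric] e3[symmetric] P_def Q_def .
    qed
  qed
  then show ?thesis unfolding claim_def Let_def .
qed

end
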